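(* Consider the problem ${\rm APP}=\{{\rm APP}_d\}_{d\in\mathbb{N}}$ in the randomized setting for the absolute error criterion. Then: (1) For each of the four notions ALG-SPT, ALG-PT, ALG-QPT, ALG-WT, the notion holds for $\Lambda^{\rm all}$ if and only if the same notion holds for $\Lambda^{\rm std}$. (2) The exponents of ALG-SPT for $\Lambda^{\rm all}$ and $\Lambda^{\rm std}$ are the same, i.e. ALG-$p^{\rm ran,ABS}(\Lambda^{\rm all})=$ ALG-$p^{\rm ran,ABS}(\Lambda^{\rm std})$, and the exponents of ALG-QPT for $\Lambda^{\rm all}$ and $\Lambda^{\rm std}$ are the same, i.e. ALG-$t^{\rm ran,ABS}(\Lambda^{\rm all})=$ ALG-$t^{\rm ran,ABS}(\Lambda^{\rm std})$.
   Context: Setting. For each $d\in\mathbb{N}$, $D_d\subset\mathbb{R}^d$ is a Borel measurable set of positive Lebesgue measure, $\rho_d$ is a probability density function on $D_d$, $G_d=L_2(D_d,\rho_d(x)\,dx)$, and $F_d$ is a separable Hilbert space of functions on $D_d$ that is compactly embedded in $G_d$; ${\rm APP}_d:F_d\to G_d$, ${\rm APP}_d f=f$, is the compact embedding operator. Information. $\Lambda^{\rm all}$ is the extended class of all linear functionals (not necessarily continuous), and $\Lambda^{\rm std}\subset\Lambda^{\rm all}$ is the extended class of all function values $f\mapsto f(x)$, $x\in D_d$ (defined only almost everywhere). Randomized setting. For $\Lambda\in\{\Lambda^{\rm all},\Lambda^{\rm std}\}$, randomized algorithms have the form $A_{n,d}^\omega(f)=\phi_{n,d,\omega}(L_{1,\omega}(f),\dots,L_{n,\omega}(f))$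 with $L_{j,\omega}\in\Lambda$, where $\phi_{n,d,\omega}$ and $L_{j,\omega}$ may be randomly selected according to some probability space $(\Omega,\Sigma,\mathcal P)$; for each fixed $\omega$ the algorithm is a deterministic method with cardinality $n=n(f,\omega)$, which may be random and may depend adaptively on the input. Its cardinality is ${\rm Card}(A_{n,d}^\omega)=\sup_{\|f\|_{F_d}\le1}\mathbb{E}_\omega n(f,\omega)$ and its error is $$e^{\rm ran}(A_{n,d}^\omega)=\sup_{\|f\|_{F_d}\le1}\Big(\mathbb{E}_\omega\|{\rm APP}_d f-A_{n,d}^\omega(f)\|_{G_d}^2\Big)^{1/2}.$$ Define $e^{\rm ran}(n,d;\Lambda)=\inf e^{\rm ran}(A_{n,d}^\omega)$, the infimum being over all such algorithms using information from $\Lambda$ with ${\rm Card}(A_{n,d}^\omega)\le n$. For $n=0$ the zero algorithm is used, so $e^{\rm ran}(0,d;\Lambda)=\sup_{\|f\|_{F_d}\le1}\|{\rm APP}_d f\|_{G_d}$. Information complexity (absolute error criterion): $n(\varepsilon,d;\Lambda):=n^{\rm ran,ABS}(\varepsilon,d;\Lambda)=\inf\{n\in\{0,1,2,\dots\}: e^{\rm ran}(n,d;\Lambda)\le\varepsilon\}$, for $\varepsilon\in(0,1)$, $d\in\mathbb{N}$. Tractability notions (randomized setting, absolute error criterion, class $\Lambda$). APP is: - ALG-SPT if there are $C>0$, $p\ge0$ with $n(\varepsilon,d;\Lambda)\le C\varepsilon^{-p}$ for all $d\in\mathbb{N}$, $\varepsilon\in(0,1)$; the exponent ALG-$p^{\rm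 ran,ABS}(\Lambda)$ is the infimum of all such $p$. - ALG-PT if there are $C>0$, $p,q\ge0$ with $n(\varepsilon,d;\Lambda)\le Cd^q\varepsilon^{-p}$ for all $d\in\mathbb{N}$, $\varepsilon\in(0,1)$. - ALG-QPT if there are $C>0$, $t\ge0$ with $n(\varepsilon,d;\Lambda)\le C\exp\big(t(1+\ln d)(1+\ln\varepsilon^{-1})\big)$ for all $d\in\mathbb{N}$, $\varepsilon\in(0,1)$; the exponent ALG-$t^{\rm ran,ABS}(\Lambda)$ is the infimum of all such $t$. - ALG-WT if $\displaystyle\lim_{\varepsilon^{-1}+d\to\infty}\frac{\ln n(\varepsilon,d;\Lambda)}{\varepsilon^{-1}+d}=0$ (limit over $\varepsilon\in(0,1)$, $d\in\mathbb{N}$; convention $\ln0:=0$).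
   Formalization: Randomized algorithms must have cardinality and error jointly measurable in (f,ω) on finite-dimensional subspaces of F_d (otherwise one linear functional can give error zero); probability spaces live on subsets of an arbitrary fixed set of at least continuum size. *)

theory Defs
  imports "HOL-Probability.Probability"
begin

(* Points of R^d are extensional functions on {..<d}.  Scalars live in a subfield K of the
   complex numbers, which is instantiated to the reals or to all complex numbers, so that real
   and complex Hilbert spaces of functions are covered at the same time. *)

type_synonym point = "nat \<Rightarrow> real"
type_synonym func = "point \<Rightarrow> complex"

definition lebesgue_d :: "nat \<Rightarrow> point measure" where
  "lebesgue_d d = (\<Pi>\<^sub>M i\<in>{..<d}. lborel)"

record approx_problem =
  domain :: "point set"
  weight :: "point \<Rightarrow> real"
  spaceF :: "func set"
  innerF :: "func \<Rightarrow> func \<Rightarrow> complex"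


section \<open>The spaces G and F\<close>

definition weighted_measure :: "nat \<Rightarrow> approx_problem \<Rightarrow> point measure" where
  "weighted_measure d P =
     density (restrict_space (lebesgue_d d) (domain P)) (\<lambda>x. ennreal (weight P x))"

definition admissible_domain :: "nat \<Rightarrow> approx_problem \<Rightarrow> bool" where
  "admissible_domain d P \<longleftrightarrow>
     domain P \<in> sets (lebesgue_d d) \<and> emeasure (lebesgue_d d) (domain P) > 0"

definition probability_density :: "nat \<Rightarrow> approx_problem \<Rightarrow> bool" where
  "probability_density d P \<longleftrightarrow>
     weight P \<in> borel_measurable (restrict_space (lebesgue_d d) (domain P)) \<and>
     (\<forall>x\<in>domain P. weight P x \<ge> 0) \<and>
     (\<integral>\<^sup>+x. ennreal (weight P x) \<partial>restrict_space (lebesgue_d d) (domain P)) = 1"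

(* Functions on the domain are represented by functions vanishing outside of it; the elements of
   spaceG are representatives of the elements of L_2. *)
definition spaceG :: "complex set \<Rightarrow> nat \<Rightarrow> approx_problem \<Rightarrow> func set" where
  "spaceG K d P =
     {g. g \<in> borel_measurable (weighted_measure d P) \<and>
         integrable (weighted_measure d P) (\<lambda>x. (cmod (g x))\<^sup>2) \<and>
         (\<forall>x. g x \<in> K) \<and> (\<forall>x. x \<notin> domain P \<longrightarrow> g x = 0)}"

definition normG :: "nat \<Rightarrow> approx_problem \<Rightarrow> func \<Rightarrow> real" where
  "normG d P g = sqrt (\<integral>x. (cmod (g x))\<^sup>2 \<partial>weighted_measure d P)"

definition normF :: "approx_problem \<Rightarrow> func \<Rightarrow> real" where
  "normF P f = sqrt (Re (innerF P f f))"

definition linear_space :: "complex set \<Rightarrow> func set \<Rightarrow> bool" where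
  "linear_space K V \<longleftrightarrow>
     (\<lambda>x. 0) \<in> V \<and>
     (\<forall>f\<in>V. \<forall>g\<in>V. (\<lambda>x. f x + g x) \<in> V) \<and>
     (\<forall>c\<in>K. \<forall>f\<in>V. (\<lambda>x. c * f x) \<in> V)"

(* Functions that agree almost everywhere are identified, which is why only null functions are
   required to have norm zero.  spaceF may consist of one function per class (a space of
   genuine functions), or of all representatives of its classes, in which case function values are
   determined by an element of the Hilbert space only almost everywhere. *)
definition inner_product_space :: "complex set \<Rightarrow> nat \<Rightarrow> approx_problem \<Rightarrow> bool" where
  "inner_product_space K d P \<longleftrightarrow>
     linear_space K (spaceF P) \<and>
     (\<forall>f\<in>spaceF P. \<forall>g\<in>spaceF P. innerF P f g \<in> K \<and> innerF P g f = cnj (innerF P f g)) \<and>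
     (\<forall>f\<in>spaceF P. \<forall>g\<in>spaceF P. \<forall>h\<in>spaceF P.
        innerF P (\<lambda>x. f x + g x) h = innerF P f h + innerF P g h) \<and>
     (\<forall>c\<in>K. \<forall>f\<in>spaceF P. \<forall>h\<in>spaceF P. innerF P (\<lambda>x. c * f x) h = c * innerF P f h) \<and>
     (\<forall>f\<in>spaceF P. Re (innerF P f f) \<ge> 0) \<and>
     (\<forall>f\<in>spaceF P. innerF P f f = 0 \<longleftrightarrow> (AE x in weighted_measure d P. f x = 0))"

definition completeF :: "approx_problem \<Rightarrow> bool" where
  "completeF P \<longleftrightarrow>
     (\<forall>u :: nat \<Rightarrow> func.
        (\<forall>n. u n \<in> spaceF P) \<and>
        (\<forall>e>0. \<exists>N. \<forall>m\<ge>N. \<forall>n\<ge>N. normF P (\<lambda>x. u m x - u n x) < e) \<longrightarrow>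
        (\<exists>f\<in>spaceF P. (\<lambda>n. normF P (\<lambda>x. u n x - f x)) \<longlonglongrightarrow> 0))"

definition separableF :: "approx_problem \<Rightarrow> bool" where
  "separableF P \<longleftrightarrow>
     (\<exists>S\<subseteq>spaceF P. countable S \<and>
        (\<forall>f\<in>spaceF P. \<forall>e>0. \<exists>s\<in>S. normF P (\<lambda>x. f x - s x) < e))"

definition separable_hilbert_space :: "complex set \<Rightarrow> nat \<Rightarrow> approx_problem \<Rightarrow> bool" where
  "separable_hilbert_space K d P \<longleftrightarrow>
     inner_product_space K d P \<and> completeF P \<and> separableF P"

definition unit_ballF :: "approx_problem \<Rightarrow> func set" where
  "unit_ballF P = {f \<in> spaceF P. normF P f \<le> 1}"

(* The embedding is f \<mapsto> f; it is compact iff the image of the unit ball is relatively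
   (sequentially) compact in G. *)
definition compactly_embedded :: "complex set \<Rightarrow> nat \<Rightarrow> approx_problem \<Rightarrow> bool" where
  "compactly_embedded K d P \<longleftrightarrow>
     spaceF P \<subseteq> spaceG K d P \<and>
     (\<forall>u :: nat \<Rightarrow> func. (\<forall>n. u n \<in> unit_ballF P) \<longrightarrow>
        (\<exists>g\<in>spaceG K d P. \<exists>r :: nat \<Rightarrow> nat. strict_mono r \<and>
           (\<lambda>n. normG d P (\<lambda>x. u (r n) x - g x)) \<longlonglongrightarrow> 0))"

definition is_approx_problem :: "complex set \<Rightarrow> nat \<Rightarrow> approx_problem \<Rightarrow> bool" where
  "is_approx_problem K d P \<longleftrightarrow>
     admissible_domain d P \<and> probability_density d P \<and>
     separable_hilbert_space K d P \<and> compactly_embedded K d P"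


section \<open>Information and randomized algorithms\<close>

datatype info_class = Info_all | Info_std

fun functionals :: "complex set \<Rightarrow> approx_problem \<Rightarrow> info_class \<Rightarrow> (func \<Rightarrow> complex) set" where
  "functionals K P Info_all =
     {L. (\<forall>f\<in>spaceF P. L f \<in> K) \<and>
         (\<forall>f\<in>spaceF P. \<forall>g\<in>spaceF P. L (\<lambda>x. f x + g x) = L f + L g) \<and>
         (\<forall>c\<in>K. \<forall>f\<in>spaceF P. L (\<lambda>x. c * f x) = c * L f)}"
| "functionals K P Info_std = {L. \<exists>x\<in>domain P. L = (\<lambda>f. f x)}"

(* For each elementary event w, the queries, the halting rule and the output are functions of the
   list of information values obtained so far (adaption, variable cardinality). *)
record 'w ran_alg =
  prob_space_of :: "'w measure"
  query :: "'w \<Rightarrow> complex list \<Rightarrow> func \<Rightarrow> complex"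
  halts :: "'w \<Rightarrow> complex list \<Rightarrow> bool"
  outcome :: "'w \<Rightarrow> complex list \<Rightarrow> func"

primrec info_values :: "'w ran_alg \<Rightarrow> 'w \<Rightarrow> func \<Rightarrow> nat \<Rightarrow> complex list" where
  "info_values A w f 0 = []"
| "info_values A w f (Suc j) =
     info_values A w f j @ [query A w (info_values A w f j) f]"

definition cardinality :: "'w ran_alg \<Rightarrow> func \<Rightarrow> 'w \<Rightarrow> nat" where
  "cardinality A f w = (LEAST j. halts A w (info_values A w f j))"

definition run :: "'w ran_alg \<Rightarrow> 'w \<Rightarrow> func \<Rightarrow> func" where
  "run A w f = outcome A w (info_values A w f (cardinality A f w))"

definition event_error :: "nat \<Rightarrow> approx_problem \<Rightarrow> 'w ran_alg \<Rightarrow> func \<Rightarrow> 'w \<Rightarrow> real" where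
  "event_error d P A f w = normG d P (\<lambda>x. f x - run A w f x)"

definition lin_comb :: "nat \<Rightarrow> (nat \<Rightarrow> func) \<Rightarrow> (nat \<Rightarrow> complex) \<Rightarrow> func" where
  "lin_comb m g c = (\<lambda>x. \<Sum>i<m. c i * g i x)"

definition scalar_vectors :: "complex set \<Rightarrow> nat \<Rightarrow> (nat \<Rightarrow> complex) measure" where
  "scalar_vectors K m = (\<Pi>\<^sub>M i\<in>{..<m}. restrict_space borel K)"

(* Cardinality and error are jointly measurable in (f, w) for f ranging over any finite-dimensional
   subspace of F; with m = 1 this contains measurability in w for every fixed f.  Measurability in w
   alone is too weak: under the continuum hypothesis, a Sierpinski-type argument yields for
   Info_all an algorithm of cardinality one with error zero.  Measurability on all of F is too strong
   for Info_std, since function values need not be measurable functionals on F. *)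
definition jointly_measurable ::
    "complex set \<Rightarrow> nat \<Rightarrow> approx_problem \<Rightarrow> 'w ran_alg \<Rightarrow> bool" where
  "jointly_measurable K d P A \<longleftrightarrow>
     (\<forall>m. \<forall>g :: nat \<Rightarrow> func. (\<forall>i<m. g i \<in> spaceF P) \<longrightarrow>
        (\<lambda>(c, w). cardinality A (lin_comb m g c) w)
          \<in> measurable (scalar_vectors K m \<Otimes>\<^sub>M prob_space_of A) (count_space UNIV) \<and>
        (\<lambda>(c, w). event_error d P A (lin_comb m g c) w)
          \<in> borel_measurable (scalar_vectors K m \<Otimes>\<^sub>M prob_space_of A))"

definition randomized_algorithm ::
    "complex set \<Rightarrow> nat \<Rightarrow> approx_problem \<Rightarrow> info_class \<Rightarrow> 'w ran_alg \<Rightarrow> bool" where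
  "randomized_algorithm K d P \<Lambda> A \<longleftrightarrow>
     prob_space (prob_space_of A) \<and>
     (\<forall>w\<in>space (prob_space_of A).
        (\<forall>ys. query A w ys \<in> functionals K P \<Lambda>) \<and>
        (\<forall>f\<in>spaceF P. \<exists>j. halts A w (info_values A w f j)) \<and>
        (\<forall>ys. outcome A w ys \<in> spaceG K d P)) \<and>
     jointly_measurable K d P A"

definition ran_card :: "approx_problem \<Rightarrow> 'w ran_alg \<Rightarrow> ennreal" where
  "ran_card P A =
     (SUP f\<in>unit_ballF P. \<integral>\<^sup>+w. of_nat (cardinality A f w) \<partial>prob_space_of A)"

definition ennreal_sqrt :: "ennreal \<Rightarrow> ennreal" where
  "ennreal_sqrt x = (if x = \<top> then \<top> else ennreal (sqrt (enn2real x)))"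

definition ran_error :: "nat \<Rightarrow> approx_problem \<Rightarrow> 'w ran_alg \<Rightarrow> ennreal" where
  "ran_error d P A =
     (SUP f\<in>unit_ballF P.
        ennreal_sqrt (\<integral>\<^sup>+w. ennreal ((event_error d P A f w)\<^sup>2) \<partial>prob_space_of A))"

(* HOL cannot quantify over types inside a definition, hence the type 'w of elementary events
   is a parameter: all probability spaces carried by subsets of 'w are admitted. *)
definition min_ran_error ::
    "'w itself \<Rightarrow> complex set \<Rightarrow> nat \<Rightarrow> approx_problem \<Rightarrow> info_class \<Rightarrow> nat \<Rightarrow> ennreal" where
  "min_ran_error _ K d P \<Lambda> n =
     (if n = 0 then (SUP f\<in>unit_ballF P. ennreal (normG d P f))
      else (INF A\<in>{A :: 'w ran_alg. randomized_algorithm K d P \<Lambda> A \<and> ran_card P A \<le> of_nat n}.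
              ran_error d P A))"

definition info_complexity ::
    "'w itself \<Rightarrow> complex set \<Rightarrow> (nat \<Rightarrow> approx_problem) \<Rightarrow> info_class \<Rightarrow> real \<Rightarrow> nat \<Rightarrow> enat" where
  "info_complexity W K APP \<Lambda> \<epsilon> d =
     (INF n\<in>{n. min_ran_error W K d (APP d) \<Lambda> n \<le> ennreal \<epsilon>}. enat n)"


section \<open>Algebraic tractability\<close>

definition SPT_with ::
    "'w itself \<Rightarrow> complex set \<Rightarrow> (nat \<Rightarrow> approx_problem) \<Rightarrow> info_class \<Rightarrow> real \<Rightarrow> bool" where
  "SPT_with W K APP \<Lambda> p \<longleftrightarrow> p \<ge> 0 \<and>
     (\<exists>C>0. \<forall>d\<ge>1. \<forall>\<epsilon>\<in>{0<..<1}.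
        ereal_of_enat (info_complexity W K APP \<Lambda> \<epsilon> d) \<le> ereal (C * \<epsilon> powr (- p)))"

definition ALG_SPT ::
    "'w itself \<Rightarrow> complex set \<Rightarrow> (nat \<Rightarrow> approx_problem) \<Rightarrow> info_class \<Rightarrow> bool" where
  "ALG_SPT W K APP \<Lambda> \<longleftrightarrow> (\<exists>p. SPT_with W K APP \<Lambda> p)"

(* The exponents are infinite if the corresponding notion does not hold. *)
definition ALG_SPT_exponent ::
    "'w itself \<Rightarrow> complex set \<Rightarrow> (nat \<Rightarrow> approx_problem) \<Rightarrow> info_class \<Rightarrow> ereal" where
  "ALG_SPT_exponent W K APP \<Lambda> = (INF p\<in>{p. SPT_with W K APP \<Lambda> p}. ereal p)"

definition ALG_PT ::
    "'w itself \<Rightarrow> complex set \<Rightarrow> (nat \<Rightarrow> approx_problem) \<Rightarrow> info_class \<Rightarrow> bool" where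
  "ALG_PT W K APP \<Lambda> \<longleftrightarrow>
     (\<exists>C>0. \<exists>p\<ge>0. \<exists>q\<ge>0. \<forall>d\<ge>1. \<forall>\<epsilon>\<in>{0<..<1}.
        ereal_of_enat (info_complexity W K APP \<Lambda> \<epsilon> d)
          \<le> ereal (C * real d powr q * \<epsilon> powr (- p)))"

definition QPT_with ::
    "'w itself \<Rightarrow> complex set \<Rightarrow> (nat \<Rightarrow> approx_problem) \<Rightarrow> info_class \<Rightarrow> real \<Rightarrow> bool" where
  "QPT_with W K APP \<Lambda> t \<longleftrightarrow> t \<ge> 0 \<and>
     (\<exists>C>0. \<forall>d\<ge>1. \<forall>\<epsilon>\<in>{0<..<1}.
        ereal_of_enat (info_complexity W K APP \<Lambda> \<epsilon> d)
          \<le> ereal (C * exp (t * (1 + ln (real d)) * (1 + ln (1 / \<epsilon>)))))"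

definition ALG_QPT ::
    "'w itself \<Rightarrow> complex set \<Rightarrow> (nat \<Rightarrow> approx_problem) \<Rightarrow> info_class \<Rightarrow> bool" where
  "ALG_QPT W K APP \<Lambda> \<longleftrightarrow> (\<exists>t. QPT_with W K APP \<Lambda> t)"

definition ALG_QPT_exponent ::
    "'w itself \<Rightarrow> complex set \<Rightarrow> (nat \<Rightarrow> approx_problem) \<Rightarrow> info_class \<Rightarrow> ereal" where
  "ALG_QPT_exponent W K APP \<Lambda> = (INF t\<in>{t. QPT_with W K APP \<Lambda> t}. ereal t)"

definition ln_enat :: "enat \<Rightarrow> ereal" where
  "ln_enat N =
     (case N of enat n \<Rightarrow> (if n = 0 then 0 else ereal (ln (real n))) | \<infinity> \<Rightarrow> \<infinity>)"

definition ALG_WT ::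
    "'w itself \<Rightarrow> complex set \<Rightarrow> (nat \<Rightarrow> approx_problem) \<Rightarrow> info_class \<Rightarrow> bool" where
  "ALG_WT W K APP \<Lambda> \<longleftrightarrow>
     ((\<lambda>(\<epsilon>, d). ln_enat (info_complexity W K APP \<Lambda> \<epsilon> d) / ereal (1 / \<epsilon> + real d))
        \<longlongrightarrow> 0)
     (inf (filtercomap (\<lambda>(\<epsilon>, d). 1 / \<epsilon> + real d) at_top) (principal ({0<..<1} \<times> {1..})))"

end

theory Submission
  imports Defs
begin

text \<open>
  Function values are linear functionals, so a tractability bound for standard information is also
  one for arbitrary linear information. All that matters is the converse, and it follows from one
  comparison of information complexities: for every \<open>\<delta> \<in> (0, 1]\<close> there is a constant \<open>C\<close>, the same for
  all problems, dimensions and error demands, with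
  \<open>n(\<epsilon>, d; std) \<le> C \<cdot> n(\<epsilon> / (1 + \<delta>), d; all) ^ (1 + \<delta>)\<close> (\<open>info_complexity_comparison\<close>). Both losses
  disappear as \<open>\<delta> \<rightarrow> 0\<close>. A fixed loss in \<open>\<epsilon>\<close>, such as a factor 2, would do for the notions but
  not for the exponent of quasi-polynomial tractability, since \<open>(1 + ln d) ln 2\<close> grows with \<open>d\<close>.

  The comparison passes through the singular values of the embedding. Fix a threshold \<open>\<theta>\<close>. Greedy
  maximization of the G-norm over unit balls of F-orthogonal complements either produces any
  prescribed number \<open>m\<close> of functions that are orthonormal in F, orthogonal in G and have squared
  G-norm above \<open>\<theta>\<close>, or it stops with \<open>k < m\<close> of them and the squared norm of the embedding on their
  complement is at most \<open>\<theta>\<close> (\<open>singular_value_dichotomy\<close>). If the first case holds with \<open>m\<close> a large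
  multiple of \<open>n\<close>, then randomized algorithms of cardinality \<open>n\<close> have squared error at least about
  \<open>\<theta>\<close>, whatever functionals they use. In the second case sampling about \<open>k ln k\<close> points yields
  squared error at most about \<open>\<theta>\<close>.

  The lower bound (\<open>randomized_lower_bound\<close>) averages over Gaussian inputs in the real span of the
  \<open>m\<close> functions. Conditioning a Gaussian on linear information lowers the dimension of the slice that
  contains the input and leaves a Gaussian weight there, and guessing on a slice of \<open>k\<close> dimensions
  costs at least \<open>k\<close> times a fixed amount. Hence a method that pays this amount for each dimension
  that it removes cannot do better than guessing at once (\<open>slice_bound_leaf\<close>). This covers adaptive
  methods with varying cardinality, because the price is linear in the cardinality. Since error
  bounds are known in the unit ball only, the variance is chosen so that the Gaussian stays in the
  ball apart from an exponentially small part (\<open>gaussian_tail\<close>).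

  The upper bound (\<open>singular_system_sampling\<close>) needs a bound in terms of \<open>\<theta>\<close> alone, while the norm of
  the embedding may be arbitrarily large. Therefore the \<open>k\<close>-dimensional span has to be reproduced
  exactly: interpolation at \<open>k\<close> points drawn with the density
  \<open>\<bar>det (e_j (x_i))\<bar>\<^sup>2 / k!\<close> does that, and orthogonality of determinants shows that the rest \<open>g\<close> of the
  input is amplified in mean square by the factor \<open>k\<close> only (\<open>expected_residual_0\<close>). Afterwards each
  further point, drawn from the average of the \<open>\<bar>e_j\<bar>\<^sup>2\<close>, takes one small stochastic gradient step
  towards the least squares coefficients (\<open>expected_update\<close>). The step size \<open>\<delta> / k\<close> shrinks the
  coefficient error geometrically down to \<open>\<delta> \<parallel>g\<parallel>\<^sup>2\<close>, so the factor \<open>k\<close> is removed by \<open>O(k ln k)\<close> steps.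
\<close>

section \<open>Lebesgue measure and Gaussian weights on affine families\<close>

abbreviation leb :: "nat set \<Rightarrow> (nat \<Rightarrow> real) measure" where
  "leb I \<equiv> (\<Pi>\<^sub>M i\<in>I. lborel)"

interpretation lborel_product: product_sigma_finite "\<lambda>_ :: nat. lborel :: real measure"
  by standard

lemma nn_integral_leb_affine:
  assumes "finite I" "h \<in> borel_measurable (leb I)" "\<sigma> \<noteq> 0"
  shows "(\<integral>\<^sup>+c. h c \<partial>leb I) = ennreal (\<bar>\<sigma>\<bar> ^ card I) * (\<integral>\<^sup>+c. h (\<lambda>i\<in>I. t i + \<sigma> * c i) \<partial>leb I)"
  using assms(1,2)
proof (induction I arbitrary: h rule: finite_induct)
  case empty
  then show ?case by (simp add: PiM_empty nn_integral_count_space_finite restrict_def)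
next
  case (insert i I)
  have [measurable]: "h \<in> borel_measurable (leb (insert i I))" by fact
  have m1[measurable]: "(\<lambda>(x, y). h (x(i := y))) \<in> borel_measurable (leb I \<Otimes>\<^sub>M lborel)"
    using measurable_compose[OF measurable_add_dim insert.prems]
    by (simp add: case_prod_unfold)
  have m2: "(\<lambda>(x, y). h (x(i := t i + \<sigma> * y))) \<in> borel_measurable (leb I \<Otimes>\<^sub>M lborel)"
    using measurable_compose[OF _ m1, of "\<lambda>(x,y). (x, t i + \<sigma> * y)" "leb I \<Otimes>\<^sub>M lborel"]
    by (simp add: case_prod_unfold)
  have m3: "(\<lambda>c. \<integral>\<^sup>+y. h (c(i := t i + \<sigma> * y)) \<partial>lborel) \<in> borel_measurable (leb I)"
    using m2 by (rule lborel.borel_measurable_nn_integral)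
  have "(\<integral>\<^sup>+c. h c \<partial>leb (insert i I)) = (\<integral>\<^sup>+x. \<integral>\<^sup>+y. h (x(i := y)) \<partial>lborel \<partial>leb I)"
    using insert by (intro lborel_product.product_nn_integral_insert) auto
  also have "\<dots> = (\<integral>\<^sup>+x. ennreal \<bar>\<sigma>\<bar> * (\<integral>\<^sup>+y. h (x(i := t i + \<sigma> * y)) \<partial>lborel) \<partial>leb I)"
  proof (intro nn_integral_cong)
    fix x assume "x \<in> space (leb I)"
    then have "(\<lambda>y. h (x(i := y))) \<in> borel_measurable lborel"
      using measurable_compose[OF measurable_Pair1' m1] by (simp add: comp_def)
    then show "(\<integral>\<^sup>+y. h (x(i := y)) \<partial>lborel)
        = ennreal \<bar>\<sigma>\<bar> * (\<integral>\<^sup>+y. h (x(i := t i + \<sigma> * y)) \<partial>lborel)"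
      using nn_integral_real_affine[of "\<lambda>y. h (x(i := y))" \<sigma> "t i"] assms(3) by simp
  qed
  also have "\<dots> = ennreal \<bar>\<sigma>\<bar> * (\<integral>\<^sup>+x. (\<integral>\<^sup>+y. h (x(i := t i + \<sigma> * y)) \<partial>lborel) \<partial>leb I)"
    using m3 by (rule nn_integral_cmult)
  also have "(\<integral>\<^sup>+x. (\<integral>\<^sup>+y. h (x(i := t i + \<sigma> * y)) \<partial>lborel) \<partial>leb I) =
     ennreal (\<bar>\<sigma>\<bar> ^ card I) * (\<integral>\<^sup>+x. (\<integral>\<^sup>+y. h ((\<lambda>j\<in>I. t j + \<sigma> * x j)(i := t i + \<sigma> * y)) \<partial>lborel) \<partial>leb I)"
    by (rule insert.IH[OF m3])
  also have "(\<integral>\<^sup>+x. (\<integral>\<^sup>+y. h ((\<lambda>j\<in>I. t j + \<sigma> * x j)(i := t i + \<sigma> * y)) \<partial>lborel) \<partial>leb I)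
     = (\<integral>\<^sup>+x. (\<integral>\<^sup>+y. h (\<lambda>j\<in>insert i I. t j + \<sigma> * (x(i := y)) j) \<partial>lborel) \<partial>leb I)"
  proof -
    have "(\<lambda>j\<in>I. t j + \<sigma> * x j)(i := t i + \<sigma> * y) = (\<lambda>j\<in>insert i I. t j + \<sigma> * (x(i := y)) j)" for x y
      using insert(2) by (auto simp: fun_eq_iff)
    then show ?thesis by simp
  qed
  also have "\<dots> = (\<integral>\<^sup>+c. h (\<lambda>j\<in>insert i I. t j + \<sigma> * c j) \<partial>leb (insert i I))"
    using insert by (intro lborel_product.product_nn_integral_insert[symmetric]) auto
  finally show ?case
    by (simp only: card_insert_disjoint[OF insert(1,2)] power_Suc mult.assoc
        ennreal_mult[OF abs_ge_zero zero_le_power[OF abs_ge_zero]])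
qed

text \<open>
  Moving the \<open>i\<close>-th coordinate by a linear function of the others preserves Lebesgue measure. In the
  new coordinates the level sets of a linear functional with nonzero \<open>i\<close>-th coefficient are the
  coordinate slices \<open>y = const\<close>.
\<close>
lemma nn_integral_leb_slice:
  assumes "finite J" "i \<notin> J" and [measurable]: "h \<in> borel_measurable (leb (insert i J))"
  shows "(\<integral>\<^sup>+c. h c \<partial>leb (insert i J))
    = (\<integral>\<^sup>+y. \<integral>\<^sup>+c. h (c(i := y - (\<Sum>j\<in>J. r j * c j))) \<partial>leb J \<partial>lborel)"
proof -
  interpret J: finite_product_sigma_finite "\<lambda>_ :: nat. lborel :: real measure" J
    by standard (use assms in auto)
  interpret pair_sigma_finite "leb J" "lborel :: real measure" by standard
  have m1[measurable]: "(\<lambda>(x, y). h (x(i := y))) \<in> borel_measurable (leb J \<Otimes>\<^sub>M lborel)"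
    using measurable_compose[OF measurable_add_dim assms(3)]
    by (simp add: case_prod_unfold)
  have m2: "(\<lambda>(x, y). h (x(i := y - (\<Sum>j\<in>J. r j * x j)))) \<in> borel_measurable (leb J \<Otimes>\<^sub>M lborel)"
    using measurable_compose[OF _ m1, of "\<lambda>(x,y). (x, y - (\<Sum>j\<in>J. r j * x j))" "leb J \<Otimes>\<^sub>M lborel"]
    by (simp add: case_prod_unfold)
  have "(\<integral>\<^sup>+c. h c \<partial>leb (insert i J)) = (\<integral>\<^sup>+x. \<integral>\<^sup>+y. h (x(i := y)) \<partial>lborel \<partial>leb J)"
    using assms by (intro lborel_product.product_nn_integral_insert) auto
  also have "\<dots> = (\<integral>\<^sup>+x. \<integral>\<^sup>+y. h (x(i := y - (\<Sum>j\<in>J. r j * x j))) \<partial>lborel \<partial>leb J)"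
  proof (rule nn_integral_cong)
    fix x assume "x \<in> space (leb J)"
    then have "(\<lambda>y. h (x(i := y))) \<in> borel_measurable lborel"
      using measurable_compose[OF measurable_Pair1' m1] by (simp add: comp_def)
    then show "(\<integral>\<^sup>+y. h (x(i := y)) \<partial>lborel) = (\<integral>\<^sup>+y. h (x(i := y - (\<Sum>j\<in>J. r j * x j))) \<partial>lborel)"
      using nn_integral_real_affine[of "\<lambda>y. h (x(i := y))" 1 "- (\<Sum>j\<in>J. r j * x j)"] by simp
  qed
  also have "\<dots> = (\<integral>\<^sup>+y. \<integral>\<^sup>+c. h (c(i := y - (\<Sum>j\<in>J. r j * c j))) \<partial>leb J \<partial>lborel)"
    using Fubini[of "\<lambda>(x, y). h (x(i := y - (\<Sum>j\<in>J. r j * x j)))"] m2 by simp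
  finally show ?thesis .
qed

definition sqn :: "nat \<Rightarrow> (nat \<Rightarrow> real) \<Rightarrow> real" where
  "sqn m x = (\<Sum>j<m. (x j)\<^sup>2)"

text \<open>
  The inputs that are compatible with given values of linear functionals form such a family. The
  index set is an arbitrary finite set so that single directions can be dropped without renumbering.
\<close>
definition affine_point ::
    "(nat \<Rightarrow> real) \<Rightarrow> (nat \<Rightarrow> nat \<Rightarrow> real) \<Rightarrow> nat set \<Rightarrow> (nat \<Rightarrow> real) \<Rightarrow> nat \<Rightarrow> real" where
  "affine_point a u I c = (\<lambda>l. a l + (\<Sum>i\<in>I. c i * u i l))"

lemma sqn_nonneg [simp]: "sqn m x \<ge> 0" by (simp add: sqn_def sum_nonneg)

text \<open>
  If \<open>r j\<close> is the ratio of the values of a linear functional at \<open>u j\<close> and \<open>u i\<close>, the new directions lie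
  in its kernel: the right-hand side is a level set of the functional.
\<close>
lemma affine_point_slice:
  assumes "finite J" "i \<notin> J"
  shows "affine_point a u (insert i J) (c(i := y - (\<Sum>j\<in>J. r j * c j)))
    = affine_point (\<lambda>l. a l + y * u i l) (\<lambda>j l. u j l - r j * u i l) J c"
proof
  fix l
  have "(\<Sum>j\<in>J. (c(i := z)) j * u j l) = (\<Sum>j\<in>J. c j * u j l)" for z
    using assms by (intro sum.cong) auto
  then show "affine_point a u (insert i J) (c(i := y - (\<Sum>j\<in>J. r j * c j))) l
    = affine_point (\<lambda>l. a l + y * u i l) (\<lambda>j l. u j l - r j * u i l) J c l"
    using assms by (simp add: affine_point_def algebra_simps sum_subtractf sum_distrib_left sum_distrib_right)
qed

lemma affine_point_measurable:
  assumes "h \<in> borel_measurable (leb {..<m})" "\<And>x. h (restrict x {..<m}) = h x"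
  shows "(\<lambda>c. h (affine_point a u I c)) \<in> borel_measurable (leb I)"
proof -
  have "(\<lambda>c. \<lambda>l\<in>{..<m}. affine_point a u I c l) \<in> measurable (leb I) (leb {..<m})"
    unfolding affine_point_def by (intro measurable_restrict) measurable
  from measurable_compose[OF this assms(1)] show ?thesis using assms(2) by simp
qed

text \<open>
  Scaling the coordinates gives \<open>\<integral> exp (-(s + t) Q) = (s / (s + t)) ^ (k / 2) \<integral> exp (-s Q)\<close>, while
  \<open>exp (-t Q) \<ge> 1 - t Q\<close>; the claim is the derivative at \<open>t = 0\<close>. The integral is infinite for linearly
  dependent directions, so its finiteness takes the place of a rank condition.
\<close>
lemma gaussian_second_moment:
  fixes u :: "nat \<Rightarrow> nat \<Rightarrow> real" and m :: nat
  assumes "finite I" "s > 0"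
  defines "Q \<equiv> \<lambda>c. sqn m (\<lambda>l. \<Sum>i\<in>I. c i * u i l)"
  assumes fin: "(\<integral>\<^sup>+c. ennreal (exp (- s * Q c)) \<partial>leb I) < \<infinity>"
  shows "ennreal (card I / (2 * s)) * (\<integral>\<^sup>+c. ennreal (exp (- s * Q c)) \<partial>leb I)
      \<le> (\<integral>\<^sup>+c. ennreal (exp (- s * Q c) * Q c) \<partial>leb I)"
proof -
  define Z where "Z = (\<integral>\<^sup>+c. ennreal (exp (- s * Q c)) \<partial>leb I)"
  define M where "M = (\<integral>\<^sup>+c. ennreal (exp (- s * Q c) * Q c) \<partial>leb I)"
  have Qm[measurable]: "Q \<in> borel_measurable (leb I)" unfolding Q_def sqn_def by measurable
  have Q0: "Q c \<ge> 0" for c by (simp add: Q_def)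
  have step: "Z \<le> ennreal t * M + ennreal ((s / (s + t)) powr (card I / 2)) * Z" if t: "t > 0" for t
  proof -
    \<comment> \<open>The scaling that turns \<open>(s + t) Q\<close> into \<open>s Q\<close>.\<close>
    define \<sigma> where "\<sigma> = sqrt (s / (s + t))"
    have \<sigma>: "\<sigma> > 0" "\<sigma>\<^sup>2 = s / (s + t)" using t assms(2) by (auto simp: \<sigma>_def)
    have Qs: "Q (\<lambda>i\<in>I. 0 + \<sigma> * c i) = \<sigma>\<^sup>2 * Q c" for c
    proof -
      have "(\<Sum>i\<in>I. (\<lambda>i\<in>I. 0 + \<sigma> * c i) i * u i l) = \<sigma> * (\<Sum>i\<in>I. c i * u i l)" for l
        by (simp add: sum_distrib_left[symmetric] mult.assoc)
      then show ?thesis unfolding Q_def sqn_def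
        by (simp only: power_mult_distrib sum_distrib_left[symmetric])
    qed
    have "(\<integral>\<^sup>+c. ennreal (exp (- (s + t) * Q c)) \<partial>leb I)
        = ennreal (\<bar>\<sigma>\<bar> ^ card I) * (\<integral>\<^sup>+c. ennreal (exp (- (s + t) * Q (\<lambda>i\<in>I. 0 + \<sigma> * c i))) \<partial>leb I)"
      using \<sigma> assms(1) by (intro nn_integral_leb_affine) auto
    also have "(\<lambda>c. exp (- (s + t) * Q (\<lambda>i\<in>I. 0 + \<sigma> * c i))) = (\<lambda>c. exp (- s * Q c))"
    proof
      fix c
      have "- (s + t) * Q (\<lambda>i\<in>I. 0 + \<sigma> * c i) = - s * Q c"
        unfolding Qs \<sigma>(2) using t assms(2) by (simp add: field_simps)
      then show "exp (- (s + t) * Q (\<lambda>i\<in>I. 0 + \<sigma> * c i)) = exp (- s * Q c)" by simp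
    qed
    also have "\<bar>\<sigma>\<bar> ^ card I = (s / (s + t)) powr (card I / 2)"
    proof -
      have "\<sigma> ^ card I = \<sigma> powr card I" using \<sigma>(1) by (simp add: powr_realpow)
      also have "\<dots> = (\<sigma> powr 2) powr (card I / 2)" by (simp add: powr_powr)
      also have "\<sigma> powr 2 = s / (s + t)" using \<sigma> by (simp add: powr_numeral)
      finally show ?thesis using \<sigma>(1) by simp
    qed
    finally have sc: "(\<integral>\<^sup>+c. ennreal (exp (- (s + t) * Q c)) \<partial>leb I) = ennreal ((s / (s + t)) powr (card I / 2)) * Z"
      by (simp add: Z_def)
    have "Z \<le> (\<integral>\<^sup>+c. ennreal t * ennreal (exp (- s * Q c) * Q c) + ennreal (exp (- (s + t) * Q c)) \<partial>leb I)"
      unfolding Z_def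
    proof (intro nn_integral_mono)
      fix c
      have "1 + (- t * Q c) \<le> exp (- t * Q c)" by (rule exp_ge_add_one_self)
      then have "exp (- s * Q c) * (1 + (- t * Q c)) \<le> exp (- s * Q c) * exp (- t * Q c)"
        by (intro mult_left_mono) auto
      also have "\<dots> = exp (- (s + t) * Q c)" by (simp add: exp_add[symmetric] algebra_simps)
      finally have "exp (- s * Q c) \<le> t * (exp (- s * Q c) * Q c) + exp (- (s + t) * Q c)"
        by (simp add: algebra_simps)
      then show "ennreal (exp (- s * Q c)) \<le> ennreal t * ennreal (exp (- s * Q c) * Q c) + ennreal (exp (- (s + t) * Q c))"
        using t Q0[of c] by (simp add: ennreal_mult[symmetric] ennreal_plus[symmetric] del: ennreal_plus)
    qed
    also have "\<dots> = ennreal t * M + (\<integral>\<^sup>+c. ennreal (exp (- (s + t) * Q c)) \<partial>leb I)"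
      unfolding M_def by (subst nn_integral_add) (auto simp: nn_integral_cmult)
    finally show ?thesis using sc by simp
  qed
  show ?thesis
  proof (cases "M = \<infinity>")
    case False
    define z where "z = enn2real Z"
    define \<mu> where "\<mu> = enn2real M"
    have Z: "Z = ennreal z" "z \<ge> 0" using fin by (auto simp: z_def Z_def)
    have M: "M = ennreal \<mu>" "\<mu> \<ge> 0" using False by (auto simp: \<mu>_def top.not_eq_extremum)
    have le: "((s / (s + t)) powr (card I / 2) - 1) / t * z \<ge> - \<mu>" if "t > 0" for t
    proof -
      have "ennreal z \<le> ennreal (t * \<mu> + (s / (s + t)) powr (card I / 2) * z)"
        using step[OF that] Z M that by (simp add: ennreal_mult ennreal_plus)
      then have "z \<le> t * \<mu> + (s / (s + t)) powr (card I / 2) * z"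
        using Z M that by (subst (asm) ennreal_le_iff) auto
      then show ?thesis using that by (simp add: field_simps)
    qed
    define \<phi> where "\<phi> = (\<lambda>t. (s / (s + t)) powr (card I / 2))"
    have "(\<phi> has_real_derivative - (card I / (2 * s))) (at 0)"
      unfolding \<phi>_def using assms(2)
      by (auto intro!: derivative_eq_intros simp: field_simps power2_eq_square)
    then have "((\<lambda>t. (\<phi> t - \<phi> 0) / (t - 0)) \<longlongrightarrow> - (card I / (2 * s))) (at 0)"
      by (simp add: has_field_derivative_iff)
    then have "((\<lambda>t. (\<phi> t - \<phi> 0) / (t - 0)) \<longlongrightarrow> - (card I / (2 * s))) (at_right 0)"
      by (rule filterlim_mono[OF _ order_refl]) (simp add: at_le)
    then have "((\<lambda>t. (\<phi> t - \<phi> 0) / (t - 0) * z) \<longlongrightarrow> - (card I / (2 * s)) * z) (at_right 0)"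
      by (intro tendsto_mult_right)
    moreover have "eventually (\<lambda>t. (\<phi> t - \<phi> 0) / (t - 0) * z \<ge> - \<mu>) (at_right 0)"
      using le assms(2) by (auto simp: \<phi>_def eventually_at_right_field intro!: exI[of _ 1])
    ultimately have "- (card I / (2 * s)) * z \<ge> - \<mu>"
      by (intro tendsto_lowerbound) auto
    then have "ennreal (card I / (2 * s) * z) \<le> ennreal \<mu>" by (intro ennreal_leI) simp
    then show ?thesis unfolding Z_def[symmetric] M_def[symmetric]
      using Z M assms(2) by (simp add: ennreal_mult[symmetric])
  next
    case True
    then show ?thesis unfolding M_def[symmetric] by simp
  qed
qed

definition dotm :: "nat \<Rightarrow> (nat \<Rightarrow> real) \<Rightarrow> (nat \<Rightarrow> real) \<Rightarrow> real" where
  "dotm m x y = (\<Sum>l<m. x l * y l)"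

lemma dotm_add: "dotm m (\<lambda>l. x l + t * y l) z = dotm m x z + t * dotm m y z"
  by (simp add: dotm_def sum.distrib sum_distrib_left algebra_simps)

lemma dotm_comm: "dotm m x y = dotm m y x" by (simp add: dotm_def mult.commute)

lemma dotm_sum: "dotm m (\<lambda>l. \<Sum>i\<in>I. c i * u i l) z = (\<Sum>i\<in>I. c i * dotm m (u i) z)"
  unfolding dotm_def sum_distrib_left sum_distrib_right by (subst sum.swap) (simp add: mult.assoc)

lemma dotm_null: "dotm m x x = 0 \<Longrightarrow> dotm m y x = 0"
  by (simp add: dotm_def sum_nonneg_eq_0_iff)

text \<open>
  The foot of the perpendicular from the origin, found by Gram-Schmidt: the vector \<open>w\<close> is \<open>u i\<close>
  made orthogonal to the other directions, and it may vanish.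
\<close>
lemma affine_foot_exists:
  assumes "finite I"
  shows "\<exists>c. \<forall>i\<in>I. dotm m (affine_point a u I c) (u i) = 0"
  using assms
proof (induction I arbitrary: a rule: finite_induct)
  case (insert i I)
  obtain d where d: "\<forall>j\<in>I. dotm m (affine_point (u i) u I d) (u j) = 0" using insert.IH by blast
  obtain c where c: "\<forall>j\<in>I. dotm m (affine_point a u I c) (u j) = 0" using insert.IH by blast
  define w where "w = affine_point (u i) u I d"
  define x where "x = affine_point a u I c"
  define \<beta> where "\<beta> = - dotm m x w / dotm m w w"
  have ui: "u i = (\<lambda>l. w l + (-1) * (\<Sum>j\<in>I. d j * u j l))" by (auto simp: w_def affine_point_def)
  have dui: "dotm m z (u i) = dotm m z w" if "\<forall>j\<in>I. dotm m z (u j) = 0" for z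
  proof -
    have "dotm m z (u i) = dotm m (u i) z" by (rule dotm_comm)
    also have "\<dots> = dotm m w z + (-1) * dotm m (\<lambda>l. \<Sum>j\<in>I. d j * u j l) z"
      by (subst ui) (rule dotm_add)
    also have "\<dots> = dotm m w z" using that by (simp add: dotm_sum dotm_comm[of m _ z])
    finally show ?thesis by (simp add: dotm_comm)
  qed
  define e where "e = (\<lambda>j. if j = i then \<beta> else c j + \<beta> * d j)"
  have "affine_point a u (insert i I) e = (\<lambda>l. x l + \<beta> * w l)"
  proof
    fix l
    have "(\<Sum>j\<in>I. e j * u j l) = (\<Sum>j\<in>I. (c j + \<beta> * d j) * u j l)"
      using insert(2) by (intro sum.cong) (auto simp: e_def)
    then show "affine_point a u (insert i I) e l = x l + \<beta> * w l"
      using insert(1,2) by (simp add: affine_point_def x_def w_def e_def algebra_simps sum.distrib sum_distrib_left)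
  qed
  then have *: "dotm m (affine_point a u (insert i I) e) z = dotm m x z + \<beta> * dotm m w z" for z
    by (simp add: dotm_add)
  have perp: "\<forall>j\<in>I. dotm m (affine_point a u (insert i I) e) (u j) = 0"
    using c d by (simp add: * x_def w_def)
  moreover have "dotm m x w + \<beta> * dotm m w w = 0"
    using dotm_null[of m w x] by (cases "dotm m w w = 0") (auto simp: \<beta>_def)
  then have "dotm m (affine_point a u (insert i I) e) (u i) = 0"
    using dui[OF perp] *[of w] by linarith
  ultimately show ?case by blast
qed auto


lemma sqn_perp:
  assumes "\<forall>i\<in>I. dotm m a (u i) = 0"
  shows "sqn m (\<lambda>l. a l + (\<Sum>i\<in>I. c i * u i l)) = sqn m a + sqn m (\<lambda>l. \<Sum>i\<in>I. c i * u i l)"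
proof -
  have "(\<Sum>l<m. a l * (\<Sum>i\<in>I. c i * u i l)) = 0"
    using assms dotm_sum[of m c u I a] by (simp add: dotm_comm[of m a] dotm_def mult.commute)
  then show ?thesis
    by (simp add: sqn_def power2_sum sum.distrib sum_distrib_left[symmetric] mult.assoc)
qed

lemma sqn_uminus: "sqn m (\<lambda>l. - v l) = sqn m v" by (simp add: sqn_def)

lemma sqn_restrict [simp]: "sqn m (restrict x {..<m}) = sqn m x" by (simp add: sqn_def)

text \<open>
  Error bounds hold for inputs in the unit ball only. Outside of it the cost \<open>E\<close> is replaced by a
  substitute that is large enough for the slice estimates below and that depends on \<open>x\<close> only through
  its norm, so that its Gaussian integral outside of the ball is explicit.
\<close>
definition penalized :: "nat \<Rightarrow> real \<Rightarrow> real \<Rightarrow> real \<Rightarrow> ((nat \<Rightarrow> real) \<Rightarrow> real) \<Rightarrow> (nat \<Rightarrow> real) \<Rightarrow> real" where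
  "penalized m s \<theta> k E x =
     exp (- s * sqn m x) * (if sqn m x \<le> 1 then E x else \<theta> * sqn m x + \<theta> * k / (2 * s))"

lemma penalized_nonneg:
  "E x \<ge> 0 \<Longrightarrow> \<theta> \<ge> 0 \<Longrightarrow> s > 0 \<Longrightarrow> k \<ge> 0 \<Longrightarrow> penalized m s \<theta> k E x \<ge> 0"
  by (simp add: penalized_def)

text \<open>
  On a slice without further information the output is the same for all inputs. Reflection in the foot
  point of the slice preserves the Gaussian weight and the unit ball, and the losses of two reflected
  inputs together dominate the squared distance of the inputs from the foot point, whose weighted
  integral is the second moment above.
\<close>
lemma constant_output_bound:
  fixes u :: "nat \<Rightarrow> nat \<Rightarrow> real" and E :: "(nat \<Rightarrow> real) \<Rightarrow> real"
  assumes I: "finite I" and s: "s > 0" and \<theta>: "\<theta> \<ge> 0"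
    and E: "\<And>x v. 2 * \<theta> * sqn m v \<le> E (\<lambda>l. x l + v l) + E (\<lambda>l. x l - v l)" "\<And>x. E x \<ge> 0"
    and meas: "(\<lambda>c. ennreal (penalized m s \<theta> (card I) E (affine_point a u I c))) \<in> borel_measurable (leb I)"
    and fin: "(\<integral>\<^sup>+c. ennreal (exp (- s * sqn m (affine_point a u I c))) \<partial>leb I) < \<infinity>"
  shows "ennreal (\<theta> * card I / (2 * s)) * (\<integral>\<^sup>+c. ennreal (exp (- s * sqn m (affine_point a u I c))) \<partial>leb I)
     \<le> (\<integral>\<^sup>+c. ennreal (penalized m s \<theta> (card I) E (affine_point a u I c)) \<partial>leb I)"
proof -
  let ?k = "real (card I)"
  define H where "H = (\<lambda>x. ennreal (penalized m s \<theta> ?k E x))"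
  obtain t where t: "\<forall>i\<in>I. dotm m (affine_point a u I t) (u i) = 0"
    using affine_foot_exists[OF I] by blast
  define b where "b = affine_point a u I t"
  define v where "v = (\<lambda>c l. \<Sum>i\<in>I. c i * u i l)"
  define Z where "Z = (\<integral>\<^sup>+c. ennreal (exp (- s * sqn m (v c))) \<partial>leb I)"
  have Hm: "(\<lambda>c. H (affine_point a u I c)) \<in> borel_measurable (leb I)"
    using meas by (simp add: H_def)
  have gm: "(\<lambda>c. ennreal (exp (- s * sqn m (affine_point a u I c)))) \<in> borel_measurable (leb I)"
    unfolding sqn_def affine_point_def by measurable
  have vm[measurable]: "(\<lambda>c. sqn m (v c)) \<in> borel_measurable (leb I)"
    unfolding sqn_def v_def by measurable
  have shift: "affine_point a u I (\<lambda>i\<in>I. t i + \<sigma> * c i) = (\<lambda>l. b l + \<sigma> * v c l)" for \<sigma> c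
    by (simp add: affine_point_def b_def v_def algebra_simps sum.distrib sum_distrib_left)
  have pyth: "sqn m (\<lambda>l. b l + v c l) = sqn m b + sqn m (v c)"
     "sqn m (\<lambda>l. b l - v c l) = sqn m b + sqn m (v c)" for c
    using sqn_perp[of I m b u c] sqn_perp[of I m b u "\<lambda>i. - c i"] t
    by (simp_all add: v_def b_def sum_negf sqn_uminus)
  have G: "(\<integral>\<^sup>+c. ennreal (exp (- s * sqn m (affine_point a u I c))) \<partial>leb I) = ennreal (exp (- s * sqn m b)) * Z"
  proof -
    have "(\<integral>\<^sup>+c. ennreal (exp (- s * sqn m (affine_point a u I c))) \<partial>leb I)
        = (\<integral>\<^sup>+c. ennreal (exp (- s * sqn m b)) * ennreal (exp (- s * sqn m (v c))) \<partial>leb I)"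
      using nn_integral_leb_affine[OF I gm, of 1 t] shift[of 1]
      by (simp add: pyth algebra_simps exp_add[symmetric] ennreal_mult[symmetric])
    then show ?thesis by (simp add: nn_integral_cmult Z_def)
  qed
  have Zfin: "Z < \<infinity>"
  proof (rule ccontr)
    assume "\<not> Z < \<infinity>"
    then have "Z = \<top>" by (simp add: less_top[symmetric])
    then show False using fin unfolding G by (simp add: ennreal_mult_top)
  qed
  have H1: "(\<integral>\<^sup>+c. H (affine_point a u I c) \<partial>leb I) = (\<integral>\<^sup>+c. H (\<lambda>l. b l + v c l) \<partial>leb I)"
    using nn_integral_leb_affine[OF I Hm, of 1 t] shift[of 1] by simp
  have H2: "(\<integral>\<^sup>+c. H (affine_point a u I c) \<partial>leb I) = (\<integral>\<^sup>+c. H (\<lambda>l. b l - v c l) \<partial>leb I)"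
    using nn_integral_leb_affine[OF I Hm, of "-1" t] shift[of "-1"] by simp
  have Hm1: "(\<lambda>c. H (\<lambda>l. b l + v c l)) \<in> borel_measurable (leb I)"
    using measurable_compose[OF _ Hm, of "\<lambda>c. \<lambda>i\<in>I. t i + 1 * c i"] by (simp add: shift[of 1, simplified])
  have Hm2: "(\<lambda>c. H (\<lambda>l. b l - v c l)) \<in> borel_measurable (leb I)"
    using measurable_compose[OF _ Hm, of "\<lambda>c. \<lambda>i\<in>I. t i + (-1) * c i"] by (simp add: shift[of "-1", simplified])
  have eq: "ennreal (2 * \<theta> * exp (- s * sqn m b)) * (ennreal (?k / (2 * s)) * Z)
     = ennreal 2 * (ennreal (\<theta> * ?k / (2 * s)) * (ennreal (exp (- s * sqn m b)) * Z))" (is "?l = ?r")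
  proof -
    have "?l = ennreal (2 * \<theta> * exp (- s * sqn m b) * (?k / (2 * s))) * Z"
      using \<theta> s by (subst ennreal_mult) (auto simp: mult.assoc)
    also have "2 * \<theta> * exp (- s * sqn m b) * (?k / (2 * s)) = 2 * ((\<theta> * ?k / (2 * s)) * exp (- s * sqn m b))"
      by simp
    also have "ennreal \<dots> = ennreal 2 * (ennreal (\<theta> * ?k / (2 * s)) * ennreal (exp (- s * sqn m b)))"
      using \<theta> s by (subst ennreal_mult, simp, simp, subst ennreal_mult) auto
    finally show ?thesis by (simp only: mult.assoc)
  qed
  have "ennreal (2 * \<theta> * exp (- s * sqn m b)) * (ennreal (?k / (2 * s)) * Z)
     \<le> ennreal (2 * \<theta> * exp (- s * sqn m b)) * (\<integral>\<^sup>+c. ennreal (exp (- s * sqn m (v c)) * sqn m (v c)) \<partial>leb I)"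
    using gaussian_second_moment[OF I s, of m u] Zfin unfolding Z_def v_def by (intro mult_left_mono) auto
  also have "\<dots> = (\<integral>\<^sup>+c. ennreal (2 * \<theta> * exp (- s * sqn m b)) * ennreal (exp (- s * sqn m (v c)) * sqn m (v c)) \<partial>leb I)"
    by (simp add: nn_integral_cmult)
  also have "\<dots> \<le> (\<integral>\<^sup>+c. H (\<lambda>l. b l + v c l) + H (\<lambda>l. b l - v c l) \<partial>leb I)"
  proof (intro nn_integral_mono)
    fix c
    define g where "g = exp (- s * (sqn m b + sqn m (v c)))"
    have "2 * \<theta> * exp (- s * sqn m b) * (exp (- s * sqn m (v c)) * sqn m (v c)) = g * (2 * \<theta> * sqn m (v c))"
      by (simp add: g_def exp_add[symmetric] algebra_simps)
    also have "\<dots> \<le> penalized m s \<theta> ?k E (\<lambda>l. b l + v c l) + penalized m s \<theta> ?k E (\<lambda>l. b l - v c l)"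
    proof (cases "sqn m b + sqn m (v c) \<le> 1")
      case True
      then show ?thesis using mult_left_mono[OF E(1)[of "v c" b], of g]
        by (simp add: penalized_def pyth g_def algebra_simps)
    next
      case False
      have "2 * \<theta> * sqn m (v c) \<le> 2 * (\<theta> * (sqn m b + sqn m (v c)) + \<theta> * ?k / (2 * s))"
        using \<theta> s by (simp add: algebra_simps)
      then have "g * (2 * \<theta> * sqn m (v c)) \<le> g * (2 * (\<theta> * (sqn m b + sqn m (v c)) + \<theta> * ?k / (2 * s)))"
        by (intro mult_left_mono) (auto simp: g_def)
      then show ?thesis using False by (simp add: penalized_def pyth g_def algebra_simps)
    qed
    finally show "ennreal (2 * \<theta> * exp (- s * sqn m b)) * ennreal (exp (- s * sqn m (v c)) * sqn m (v c))
      \<le> H (\<lambda>l. b l + v c l) + H (\<lambda>l. b l - v c l)"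
      unfolding H_def using \<theta> s E(2) penalized_nonneg[of E _ \<theta> s ?k m]
      by (simp add: ennreal_mult[symmetric] ennreal_plus[symmetric] del: ennreal_plus)
  qed
  also have "\<dots> = ennreal 2 * (\<integral>\<^sup>+c. H (affine_point a u I c) \<partial>leb I)"
    using H1 H2 by (subst nn_integral_add[OF Hm1 Hm2]) (simp add: mult_2)
  finally have "ennreal 2 * (ennreal (\<theta> * ?k / (2 * s)) * (ennreal (exp (- s * sqn m b)) * Z))
      \<le> ennreal 2 * (\<integral>\<^sup>+c. H (affine_point a u I c) \<partial>leb I)"
    unfolding eq .
  then have "ennreal (\<theta> * ?k / (2 * s)) * (ennreal (exp (- s * sqn m b)) * Z)
      \<le> (\<integral>\<^sup>+c. H (affine_point a u I c) \<partial>leb I)"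
    by (subst (asm) ennreal_mult_le_mult_iff) auto
  then show ?thesis unfolding G by (simp add: H_def)
qed

section \<open>Adaptive information against a Gaussian weight\<close>

definition linear_value :: "nat \<Rightarrow> (nat \<Rightarrow> real) \<Rightarrow> (nat \<Rightarrow> complex) \<Rightarrow> complex" where
  "linear_value m x L = (\<Sum>l<m. of_real (x l) * L l)"

lemma linear_value_affine:
  "linear_value m (affine_point a u I c) L
    = linear_value m a L + (\<Sum>i\<in>I. of_real (c i) * linear_value m (u i) L)"
proof -
  have "(\<Sum>l<m. \<Sum>i\<in>I. of_real (c i) * of_real (u i l) * L l)
      = (\<Sum>i\<in>I. of_real (c i) * linear_value m (u i) L)"
    by (subst sum.swap) (simp add: linear_value_def sum_distrib_left mult.assoc)
  then show ?thesis
    by (simp add: linear_value_def affine_point_def sum.distrib distrib_right sum_distrib_right)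
qed

lemma linear_value_diff:
  "linear_value m (\<lambda>l. v l - r * w l) L = linear_value m v L - of_real r * linear_value m w L"
  by (simp add: linear_value_def sum_subtractf sum_distrib_left left_diff_distrib mult.assoc)

primrec values_at :: "nat \<Rightarrow> (complex list \<Rightarrow> nat \<Rightarrow> complex) \<Rightarrow> (nat \<Rightarrow> real) \<Rightarrow> nat \<Rightarrow> complex list" where
  "values_at m L x 0 = []"
| "values_at m L x (Suc j) = values_at m L x j @ [linear_value m x (L (values_at m L x j))]"

lemma length_values_at [simp]: "length (values_at m L x j) = j"
  by (induction j) auto

lemma values_at_take: "i \<le> j \<Longrightarrow> values_at m L x i = take i (values_at m L x j)"
  by (induction j) (auto simp: le_Suc_eq)

text \<open>
  A deterministic adaptive method in coordinates: \<open>L ys\<close> holds the coefficients of the functional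
  that is evaluated after the values \<open>ys\<close>, and \<open>loss ys x\<close> is the squared error of the output for
  \<open>ys\<close>. The convexity assumption is the parallelogram law in G together with the lower bound \<open>\<theta>\<close> for
  the squared norm of the embedding.
\<close>
locale adaptive_method =
  fixes m :: nat and L :: "complex list \<Rightarrow> nat \<Rightarrow> complex" and stop :: "complex list \<Rightarrow> bool"
    and loss :: "complex list \<Rightarrow> (nat \<Rightarrow> real) \<Rightarrow> real" and \<theta> s :: real
  assumes \<theta>: "\<theta> \<ge> 0" and s: "s > 0"
    and loss_nonneg: "\<And>ys x. loss ys x \<ge> 0"
    and loss_convex: "\<And>ys x v. 2 * \<theta> * sqn m v
        \<le> loss ys (\<lambda>l. x l + v l) + loss ys (\<lambda>l. x l - v l)"
    and loss_local: "\<And>ys x. loss ys (restrict x {..<m}) = loss ys x"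
    and terminates: "\<And>x. \<exists>j. stop (values_at m L x j)"
begin

definition card_at :: "(nat \<Rightarrow> real) \<Rightarrow> nat" where
  "card_at x = (LEAST j. stop (values_at m L x j))"

definition final_loss :: "(nat \<Rightarrow> real) \<Rightarrow> real" where
  "final_loss x = loss (values_at m L x (card_at x)) x"

text \<open>
  A dimension is worth \<open>\<theta> / (2 s)\<close>, the contribution of one direction to the error of guessing. A
  complex functional may remove two real dimensions, hence the price \<open>\<theta> / s\<close> of a query; the first \<open>l\<close>
  queries have been paid before.
\<close>
definition cost :: "nat \<Rightarrow> (nat \<Rightarrow> real) \<Rightarrow> real" where
  "cost l x = final_loss x + \<theta> / s * real (card_at x - l)"

definition slice_cost :: "real \<Rightarrow> nat \<Rightarrow> (nat \<Rightarrow> real) \<Rightarrow> ennreal" where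
  "slice_cost k l x = ennreal (penalized m s \<theta> k (cost l) x)"

definition gauss :: "(nat \<Rightarrow> real) \<Rightarrow> ennreal" where
  "gauss x = ennreal (exp (- s * sqn m x))"

text \<open>
  The average cost on a slice is at least that of guessing with \<open>k\<close> dimensions. The bound is conditional on a
  finite weight because slices of a finite integral have finite weight only almost everywhere.
\<close>
definition slice_bound :: "real \<Rightarrow> nat \<Rightarrow> nat set \<Rightarrow> (nat \<Rightarrow> real) \<Rightarrow> (nat \<Rightarrow> nat \<Rightarrow> real) \<Rightarrow> bool" where
  "slice_bound k l I a u \<longleftrightarrow>
     ((\<integral>\<^sup>+c. gauss (affine_point a u I c) \<partial>leb I) < \<infinity> \<longrightarrow>
      ennreal (\<theta> * k / (2 * s)) * (\<integral>\<^sup>+c. gauss (affine_point a u I c) \<partial>leb I)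
        \<le> (\<integral>\<^sup>+c. slice_cost k l (affine_point a u I c) \<partial>leb I))"

definition leaf :: "complex list \<Rightarrow> nat set \<Rightarrow> (nat \<Rightarrow> real) \<Rightarrow> (nat \<Rightarrow> nat \<Rightarrow> real) \<Rightarrow> bool" where
  "leaf ys I a u \<longleftrightarrow>
     (\<forall>c. values_at m L (affine_point a u I c) (length ys) = ys) \<and>
     (\<forall>j<length ys. \<not> stop (take j ys))"

lemma values_at_local: "values_at m L (restrict x {..<m}) j = values_at m L x j"
  by (induction j) (simp_all add: linear_value_def)

lemma card_at_local: "card_at (restrict x {..<m}) = card_at x"
  by (simp add: card_at_def values_at_local)

lemma cost_local: "cost l (restrict x {..<m}) = cost l x"
  by (simp add: cost_def final_loss_def card_at_local values_at_local loss_local)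

lemma cost_nonneg: "cost l x \<ge> 0"
  using \<theta> s by (simp add: cost_def final_loss_def loss_nonneg)

lemma slice_cost_local: "slice_cost k l (restrict x {..<m}) = slice_cost k l x"
  by (simp add: slice_cost_def penalized_def cost_local)

lemma gauss_local: "gauss (restrict x {..<m}) = gauss x"
  by (simp add: gauss_def)

lemma card_at_ge:
  assumes "leaf ys I a u"
  shows "card_at (affine_point a u I c) \<ge> length ys"
    and "\<not> stop ys \<Longrightarrow> card_at (affine_point a u I c) \<ge> Suc (length ys)"
    and "stop ys \<Longrightarrow> card_at (affine_point a u I c) = length ys"
proof -
  let ?x = "affine_point a u I c"
  have st: "stop (values_at m L ?x (card_at ?x))"
    unfolding card_at_def using terminates by (rule LeastI_ex)
  have no: "\<not> stop (values_at m L ?x j)" if "j < length ys" for j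
    using assms that values_at_take[of j "length ys" m L ?x] by (auto simp: leaf_def)
  show 1: "card_at ?x \<ge> length ys" using st no by (meson not_le)
  show "card_at ?x \<ge> Suc (length ys)" if "\<not> stop ys"
    using 1 st that assms by (auto simp: leaf_def le_less Suc_le_eq)
  show "card_at ?x = length ys" if "stop ys"
  proof (rule antisym[OF _ 1])
    show "card_at ?x \<le> length ys" unfolding card_at_def
      by (rule Least_le) (use that assms in \<open>auto simp: leaf_def\<close>)
  qed
qed

lemma leaf_extend:
  assumes "leaf ys I a u" "\<not> stop ys" "\<forall>i\<in>I. linear_value m (u i) (L ys) = 0"
  shows "leaf (ys @ [linear_value m a (L ys)]) I a u"
  using assms by (auto simp: leaf_def linear_value_affine less_Suc_eq)

lemma leaf_slice:
  assumes "leaf ys (insert i J) a u" "finite J" "i \<notin> J"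
  shows "leaf ys J (\<lambda>l. a l + y * u i l) (\<lambda>j l. u j l - r j * u i l)"
  using assms(1) unfolding leaf_def by (simp add: affine_point_slice[OF assms(2,3), symmetric])

end

text \<open>
  The functionals may depend on earlier values in a non-measurable way. Slices are treated one by one,
  for each value of a functional, and only the final cost is integrated over them.
\<close>
locale measurable_adaptive_method = adaptive_method +
  assumes card_measurable: "card_at \<in> measurable (leb {..<m}) (count_space UNIV)"
    and loss_measurable: "final_loss \<in> borel_measurable (leb {..<m})"
begin

lemma slice_cost_measurable:
  "(\<lambda>c. slice_cost k l (affine_point a u I c)) \<in> borel_measurable (leb I)"
proof (rule affine_point_measurable[where h = "slice_cost k l"])
  note [measurable] = card_measurable loss_measurable
  show "slice_cost k l \<in> borel_measurable (leb {..<m})"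
    unfolding slice_cost_def[abs_def] penalized_def[abs_def] cost_def[abs_def] sqn_def by measurable
qed (rule slice_cost_local)

lemma gauss_measurable: "(\<lambda>c. gauss (affine_point a u I c)) \<in> borel_measurable (leb I)"
proof (rule affine_point_measurable[where h = gauss])
  show "gauss \<in> borel_measurable (leb {..<m})"
    unfolding gauss_def[abs_def] sqn_def by measurable
qed (rule gauss_local)

lemma slice_bound_halted:
  assumes "finite I" "leaf ys I a u" "stop ys"
  shows "slice_bound (card I) (length ys) I a u"
  unfolding slice_bound_def
proof
  assume fin: "(\<integral>\<^sup>+c. gauss (affine_point a u I c) \<partial>leb I) < \<infinity>"
  have eq: "slice_cost k (length ys) (affine_point a u I c)
      = ennreal (penalized m s \<theta> k (loss ys) (affine_point a u I c))" for c k
    using card_at_ge(3)[OF assms(2,3), of c] assms(2)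
    by (simp add: slice_cost_def penalized_def cost_def final_loss_def leaf_def)
  show "ennreal (\<theta> * card I / (2 * s)) * (\<integral>\<^sup>+c. gauss (affine_point a u I c) \<partial>leb I)
        \<le> (\<integral>\<^sup>+c. slice_cost (card I) (length ys) (affine_point a u I c) \<partial>leb I)"
    using constant_output_bound[where E = "loss ys" and a = a and u = u, OF assms(1) s \<theta> loss_convex loss_nonneg]
      slice_cost_measurable[of "card I" "length ys" a u I] fin
    unfolding eq gauss_def by simp
qed

text \<open>
  The price of a query covers the loss of up to two real dimensions.
\<close>
lemma slice_bound_query:
  assumes "finite I" "leaf ys I a u" "\<not> stop ys" "slice_bound k (Suc (length ys)) I a u"
    and r: "0 \<le> r" "r \<le> 2" and k: "k \<ge> 0"
  shows "slice_bound (k + r) (length ys) I a u"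
  unfolding slice_bound_def
proof
  assume fin: "(\<integral>\<^sup>+c. gauss (affine_point a u I c) \<partial>leb I) < \<infinity>"
  have pw: "slice_cost k (Suc (length ys)) x + ennreal (\<theta> * r / (2 * s)) * gauss x
     \<le> slice_cost (k + r) (length ys) x" if x: "x = affine_point a u I c" for x c
  proof -
    define g where "g = exp (- s * sqn m x)"
    have c: "real (card_at x - length ys) = real (card_at x - Suc (length ys)) + 1"
      using card_at_ge(2)[OF assms(2,3), of c] x by simp
    have "\<theta> * r / (2 * s) \<le> \<theta> / s"
      using \<theta> s r by (simp add: field_simps mult_left_mono)
    then have "cost (Suc (length ys)) x + \<theta> * r / (2 * s) \<le> cost (length ys) x"
      unfolding cost_def c by (simp add: algebra_simps)
    then have "penalized m s \<theta> k (cost (Suc (length ys))) x + \<theta> * r / (2 * s) * g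
       \<le> penalized m s \<theta> (k + r) (cost (length ys)) x"
      unfolding penalized_def g_def[symmetric]
      using mult_left_mono[of "cost (Suc (length ys)) x + \<theta> * r / (2 * s)" "cost (length ys) x" g]
      by (auto simp: g_def algebra_simps add_divide_distrib)
    then show ?thesis
      using \<theta> s r k penalized_nonneg[of "cost (Suc (length ys))" x \<theta> s k m] cost_nonneg
      unfolding slice_cost_def gauss_def g_def
      by (simp add: ennreal_mult[symmetric] ennreal_plus[symmetric] ennreal_leI del: ennreal_plus)
  qed
  let ?G = "\<integral>\<^sup>+c. gauss (affine_point a u I c) \<partial>leb I"
  have "ennreal (\<theta> * (k + r) / (2 * s)) * ?G = ennreal (\<theta> * k / (2 * s)) * ?G + ennreal (\<theta> * r / (2 * s)) * ?G"
    using \<theta> s r k by (simp add: distrib_right[symmetric] ennreal_plus[symmetric] add_divide_distrib algebra_simps del: ennreal_plus)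
  also have "\<dots> \<le> (\<integral>\<^sup>+c. slice_cost k (Suc (length ys)) (affine_point a u I c) \<partial>leb I)
     + ennreal (\<theta> * r / (2 * s)) * ?G"
    using assms(4) fin by (intro add_mono) (auto simp: slice_bound_def)
  also have "\<dots> = (\<integral>\<^sup>+c. slice_cost k (Suc (length ys)) (affine_point a u I c)
       + ennreal (\<theta> * r / (2 * s)) * gauss (affine_point a u I c) \<partial>leb I)"
    using slice_cost_measurable gauss_measurable
    by (subst nn_integral_add) (auto simp: nn_integral_cmult)
  also have "\<dots> \<le> (\<integral>\<^sup>+c. slice_cost (k + r) (length ys) (affine_point a u I c) \<partial>leb I)"
    by (rule nn_integral_mono) (rule pw[OF refl])
  finally show "ennreal (\<theta> * (k + r) / (2 * s)) * ?G
     \<le> (\<integral>\<^sup>+c. slice_cost (k + r) (length ys) (affine_point a u I c) \<partial>leb I)" .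
qed

lemma slice_bound_slice:
  assumes J: "finite J" "i \<notin> J"
    and slices: "\<And>y. slice_bound k l J (\<lambda>l. a l + y * u i l) (\<lambda>j l. u j l - r j * u i l)"
  shows "slice_bound k l (insert i J) a u"
  unfolding slice_bound_def
proof
  let ?x = "\<lambda>y. affine_point (\<lambda>l. a l + y * u i l) (\<lambda>j l. u j l - r j * u i l) J"
  interpret J: finite_product_sigma_finite "\<lambda>_ :: nat. lborel :: real measure" J
    by standard (use assms in auto)
  have G: "(\<integral>\<^sup>+c. gauss (affine_point a u (insert i J) c) \<partial>leb (insert i J))
      = (\<integral>\<^sup>+y. \<integral>\<^sup>+c. gauss (?x y c) \<partial>leb J \<partial>lborel)"
    using nn_integral_leb_slice[OF J gauss_measurable[of a u "insert i J"], of r]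
    by (simp add: affine_point_slice[OF J])
  have H: "(\<integral>\<^sup>+c. slice_cost k l (affine_point a u (insert i J) c) \<partial>leb (insert i J))
      = (\<integral>\<^sup>+y. \<integral>\<^sup>+c. slice_cost k l (?x y c) \<partial>leb J \<partial>lborel)"
    using nn_integral_leb_slice[OF J slice_cost_measurable[of k l a u "insert i J"], of r]
    by (simp add: affine_point_slice[OF J])
  assume fin: "(\<integral>\<^sup>+c. gauss (affine_point a u (insert i J) c) \<partial>leb (insert i J)) < \<infinity>"
  have "(\<lambda>p. \<lambda>l\<in>{..<m}. ?x (fst p) (snd p) l) \<in> measurable (lborel \<Otimes>\<^sub>M leb J) (leb {..<m})"
    unfolding affine_point_def by (intro measurable_restrict) measurable
  moreover have "gauss \<in> borel_measurable (leb {..<m})"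
    unfolding gauss_def[abs_def] sqn_def by measurable
  ultimately have "(\<lambda>p. gauss (restrict (?x (fst p) (snd p)) {..<m})) \<in> borel_measurable (lborel \<Otimes>\<^sub>M leb J)"
    by (rule measurable_compose)
  then have "(\<lambda>p. gauss (?x (fst p) (snd p))) \<in> borel_measurable (lborel \<Otimes>\<^sub>M leb J)"
    by (simp only: gauss_local)
  then have inner[measurable]: "(\<lambda>y. \<integral>\<^sup>+c. gauss (?x y c) \<partial>leb J) \<in> borel_measurable lborel"
    by (intro J.borel_measurable_nn_integral) (simp add: case_prod_unfold)
  have ae: "AE y in lborel. (\<integral>\<^sup>+c. gauss (?x y c) \<partial>leb J) \<noteq> \<infinity>"
    using fin unfolding G by (intro nn_integral_PInf_AE) auto
  have "ennreal (\<theta> * k / (2 * s)) * (\<integral>\<^sup>+y. \<integral>\<^sup>+c. gauss (?x y c) \<partial>leb J \<partial>lborel)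
     = (\<integral>\<^sup>+y. ennreal (\<theta> * k / (2 * s)) * (\<integral>\<^sup>+c. gauss (?x y c) \<partial>leb J) \<partial>lborel)"
    by (rule nn_integral_cmult[symmetric]) measurable
  also have "\<dots> \<le> (\<integral>\<^sup>+y. \<integral>\<^sup>+c. slice_cost k l (?x y c) \<partial>leb J \<partial>lborel)"
    using ae by (intro nn_integral_mono_AE, elim AE_mp)
      (use slices in \<open>auto simp: slice_bound_def less_top[symmetric]\<close>)
  finally show "ennreal (\<theta> * k / (2 * s)) * (\<integral>\<^sup>+c. gauss (affine_point a u (insert i J) c) \<partial>leb (insert i J))
     \<le> (\<integral>\<^sup>+c. slice_cost k l (affine_point a u (insert i J) c) \<partial>leb (insert i J))"
    unfolding G H .
qed

text \<open>
  Induction on the dimension, and for fixed dimension on the number of remaining queries of the base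
  point. A functional that is constant on the slice only uses up a query. Otherwise the slice is cut
  into level sets of its real or imaginary part, and again by the other part if that is not constant
  yet; then the functional is constant on slices that have lost at most two dimensions.
\<close>
lemma slice_bound_leaf:
  assumes "finite I" "leaf ys I a u"
  shows "slice_bound (card I) (length ys) I a u"
  using assms
proof (induction "card I" arbitrary: I a u ys rule: less_induct)
  case less
  note IH = less.hyps
  have q: "slice_bound (real (card I') + r) (length ys) I' a' u'"
    if "finite I'" "leaf ys I' a' u'" "\<not> stop ys" "\<forall>i\<in>I'. linear_value m (u' i) (L ys) = 0"
       "card I' < card I" "0 \<le> r" "r \<le> 2" for I' a' u' ys r
    using IH[OF that(5,1) leaf_extend[OF that(2-4)]] that by (intro slice_bound_query) auto
  show ?case
    using less.prems
  proof (induction "card_at a - length ys" arbitrary: ys rule: less_induct)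
    case less
    note I = less.prems(1) and leaf = less.prems(2)
    have aff0: "affine_point a u I (\<lambda>_. 0) = a" by (simp add: affine_point_def)
    show ?case
    proof (cases "stop ys")
      case True
      then show ?thesis using slice_bound_halted[OF I leaf] by simp
    next
      case ns: False
      show ?thesis
      proof (cases "\<forall>i\<in>I. linear_value m (u i) (L ys) = 0")
        case True
        have "card_at a \<ge> Suc (length ys)" using card_at_ge(2)[OF leaf ns, of "\<lambda>_. 0"] aff0 by simp
        then have "slice_bound (card I) (length (ys @ [linear_value m a (L ys)])) I a u"
          by (intro less.hyps I leaf_extend leaf ns True) auto
        then show ?thesis using slice_bound_query[OF I leaf ns, of "card I" 0] by simp
      next
        case False
        define part where "part = (\<lambda>b :: bool. if b then Re else Im)"
        have part: "part b (z - of_real r * w) = part b z - r * part b w" for b z r w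
          by (simp add: part_def)
        have part0: "z = 0 \<longleftrightarrow> part b z = 0 \<and> part (\<not> b) z = 0" for b z
          by (cases b) (auto simp: part_def complex_eq_iff)
        from False obtain i b where i: "i \<in> I" "part b (linear_value m (u i) (L ys)) \<noteq> 0"
          unfolding part0[of _ True] by blast
        define J where "J = I - {i}"
        have J: "finite J" "i \<notin> J" "I = insert i J" "card I = Suc (card J)"
          using card.remove[OF I i(1)] I insert_Diff[OF i(1)] unfolding J_def by (simp_all only:) simp_all
        define r where "r = (\<lambda>j. part b (linear_value m (u j) (L ys)) / part b (linear_value m (u i) (L ys)))"
        define u' where "u' = (\<lambda>j l. u j l - r j * u i l)"
        have u': "part b (linear_value m (u' j) (L ys)) = 0" for j
          using i(2) unfolding u'_def linear_value_diff part r_def by simp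
        have "slice_bound (card I) (length ys) J (\<lambda>l. a l + y * u i l) u'" for y
        proof -
          define a' where "a' = (\<lambda>l. a l + y * u i l)"
          have leaf': "leaf ys J a' u'"
            unfolding a'_def u'_def using leaf J by (intro leaf_slice) auto
          show "slice_bound (card I) (length ys) J a' u'"
          proof (cases "\<forall>j\<in>J. linear_value m (u' j) (L ys) = 0")
            case True
            then show ?thesis using q[OF J(1) leaf' ns True, of 1] J by (simp add: add.commute)
          next
            case False
            then obtain i' where i': "i' \<in> J" "part (\<not> b) (linear_value m (u' i') (L ys)) \<noteq> 0"
              using u' unfolding part0[of _ b] by blast
            define J' where "J' = J - {i'}"
            have J': "finite J'" "i' \<notin> J'" "J = insert i' J'" "card J = Suc (card J')"
              using card.remove[OF J(1) i'(1)] J(1) insert_Diff[OF i'(1)] unfolding J'_def by (simp_all only:) simp_all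
            define r' where "r' = (\<lambda>j. part (\<not> b) (linear_value m (u' j) (L ys))
                 / part (\<not> b) (linear_value m (u' i') (L ys)))"
            define u'' where "u'' = (\<lambda>j l. u' j l - r' j * u' i' l)"
            have "linear_value m (u'' j) (L ys) = 0" for j
              unfolding part0[of _ b] using i'(2) u' unfolding u''_def linear_value_diff part r'_def by simp
            moreover have "leaf ys J' (\<lambda>l. a' l + y * u' i' l) u''" for y
              unfolding u''_def using leaf' J' by (intro leaf_slice) auto
            ultimately have "slice_bound (real (card J') + 2) (length ys) J' (\<lambda>l. a' l + y * u' i' l) u''" for y
              using J' J by (intro q ns) auto
            then have "slice_bound (card I) (length ys) J' (\<lambda>l. a' l + y * u' i' l) u''" for y
              using J J' by (simp add: add.commute)
            then show ?thesis unfolding J'(3) u''_def by (intro slice_bound_slice J')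
          qed
        qed
        then show ?thesis unfolding J(3) u'_def using J by (intro slice_bound_slice[of J i _ _ a u r]) auto
      qed
    qed
  qed
qed

lemma gauss_average:
  assumes "(\<integral>\<^sup>+x. gauss x \<partial>leb {..<m}) < \<infinity>"
  shows "ennreal (\<theta> * m / (2 * s)) * (\<integral>\<^sup>+x. gauss x \<partial>leb {..<m})
     \<le> (\<integral>\<^sup>+x. slice_cost m 0 x \<partial>leb {..<m})"
proof -
  define u :: "nat \<Rightarrow> nat \<Rightarrow> real" where "u = (\<lambda>i l. if l = i then 1 else 0)"
  have r: "restrict (affine_point (\<lambda>_. 0) u {..<m} x) {..<m} = restrict x {..<m}" for x
    by (auto simp: affine_point_def u_def fun_eq_iff if_distrib cong: if_cong)
  have G: "gauss (affine_point (\<lambda>_. 0) u {..<m} x) = gauss x" for x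
    using gauss_local r by metis
  have H: "slice_cost k l (affine_point (\<lambda>_. 0) u {..<m} x) = slice_cost k l x" for x k l
    using slice_cost_local r by metis
  have "slice_bound (card {..<m}) (length ([] :: complex list)) {..<m} (\<lambda>_. 0) u"
    by (intro slice_bound_leaf) (auto simp: leaf_def)
  then show ?thesis using assms by (simp add: slice_bound_def G H)
qed

end

section \<open>Semi-inner products and the spaces F and G\<close>

lemma scalar_closed:
  assumes "K = \<real> \<or> K = (UNIV :: complex set)"
  shows "of_real r \<in> K" "0 \<in> K" "1 \<in> K"
    "a \<in> K \<Longrightarrow> b \<in> K \<Longrightarrow> a + b \<in> K" "a \<in> K \<Longrightarrow> b \<in> K \<Longrightarrow> a - b \<in> K"
    "a \<in> K \<Longrightarrow> - a \<in> K" "a \<in> K \<Longrightarrow> cnj a \<in> K"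
    "a \<in> K \<Longrightarrow> b \<in> K \<Longrightarrow> a * b \<in> K" "a \<in> K \<Longrightarrow> b \<in> K \<Longrightarrow> a / b \<in> K"
    "(\<And>i. i \<in> I \<Longrightarrow> h i \<in> K) \<Longrightarrow> (\<Sum>i\<in>I. h i) \<in> K"
    "(\<And>i. i \<in> I \<Longrightarrow> h i \<in> K) \<Longrightarrow> (\<Prod>i\<in>I. h i) \<in> K"
  using assms by (auto simp: complex_is_Real_iff Reals_cnj_iff)

lemma borel_measurable_cnj [measurable (raw)]:
  "f \<in> borel_measurable M \<Longrightarrow> (\<lambda>x. cnj (f x)) \<in> borel_measurable M"
  by (rule borel_measurable_continuous_on[OF continuous_on_cnj[OF continuous_on_id]])

text \<open>
  The form is only semidefinite: functions that agree almost everywhere are identified, and besides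
  the inner products of F and G the form \<open>s \<langle>\<cdot>, \<cdot>\<rangle>\<^sub>F - \<langle>\<cdot>, \<cdot>\<rangle>\<^sub>G\<close> on a subspace is an instance below.
\<close>
locale semi_inner_space =
  fixes K :: "complex set" and V :: "func set" and B :: "func \<Rightarrow> func \<Rightarrow> complex"
  assumes scalars: "K = \<real> \<or> K = UNIV"
    and space: "linear_space K V"
    and form_scalar: "f \<in> V \<Longrightarrow> g \<in> V \<Longrightarrow> B f g \<in> K"
    and hermitian: "f \<in> V \<Longrightarrow> g \<in> V \<Longrightarrow> B g f = cnj (B f g)"
    and form_add: "f \<in> V \<Longrightarrow> g \<in> V \<Longrightarrow> h \<in> V \<Longrightarrow> B (\<lambda>x. f x + g x) h = B f h + B g h"
    and form_scale: "c \<in> K \<Longrightarrow> f \<in> V \<Longrightarrow> h \<in> V \<Longrightarrow> B (\<lambda>x. c * f x) h = c * B f h"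
    and form_nonneg: "f \<in> V \<Longrightarrow> Re (B f f) \<ge> 0"
begin

definition sq :: "func \<Rightarrow> real" where "sq f = Re (B f f)"

lemma zero_in: "(\<lambda>x. 0) \<in> V" using space by (simp add: linear_space_def)
lemma add_in: "f \<in> V \<Longrightarrow> g \<in> V \<Longrightarrow> (\<lambda>x. f x + g x) \<in> V" using space by (simp add: linear_space_def)
lemma scale_in: "c \<in> K \<Longrightarrow> f \<in> V \<Longrightarrow> (\<lambda>x. c * f x) \<in> V" using space by (simp add: linear_space_def)
lemma diff_in: "f \<in> V \<Longrightarrow> g \<in> V \<Longrightarrow> (\<lambda>x. f x - g x) \<in> V"
  using add_in[OF _ scale_in, of f "-1" g] scalar_closed[OF scalars] by simp

lemma lin_comb_in:
  assumes "\<And>i. i < m \<Longrightarrow> f i \<in> V" "\<And>i. i < m \<Longrightarrow> c i \<in> K"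
  shows "lin_comb m f c \<in> V"
  using assms
proof (induction m)
  case (Suc m)
  then have "(\<lambda>x. lin_comb m f c x + c m * f m x) \<in> V" by (intro add_in scale_in) auto
  then show ?case by (simp add: lin_comb_def)
qed (simp add: lin_comb_def zero_in)

lemma form_self: "f \<in> V \<Longrightarrow> B f f = of_real (sq f)"
  using hermitian[of f f] by (simp add: sq_def complex_eq_iff)

lemma sq_nonneg: "f \<in> V \<Longrightarrow> sq f \<ge> 0" by (simp add: sq_def form_nonneg)

lemma form_zero: "h \<in> V \<Longrightarrow> B (\<lambda>x. 0) h = 0"
  using form_scale[of 0 "\<lambda>x. 0" h] zero_in scalar_closed[OF scalars] by simp

lemma form_add_right: "f \<in> V \<Longrightarrow> g \<in> V \<Longrightarrow> h \<in> V \<Longrightarrow> B h (\<lambda>x. f x + g x) = B h f + B h g"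
  using hermitian[of "\<lambda>x. f x + g x" h] hermitian[of f h] hermitian[of g h]
  by (simp add: form_add add_in)

lemma form_scale_right: "c \<in> K \<Longrightarrow> f \<in> V \<Longrightarrow> h \<in> V \<Longrightarrow> B h (\<lambda>x. c * f x) = cnj c * B h f"
  using hermitian[of "\<lambda>x. c * f x" h] hermitian[of f h] by (simp add: form_scale scale_in)

lemma form_diff: "f \<in> V \<Longrightarrow> g \<in> V \<Longrightarrow> h \<in> V \<Longrightarrow> B (\<lambda>x. f x - g x) h = B f h - B g h"
  using form_add[of f "\<lambda>x. -1 * g x" h] form_scale[of "-1" g h] scalar_closed[OF scalars]
    scale_in[of "-1" g] by simp

lemma form_lin_comb:
  assumes "\<And>i. i < m \<Longrightarrow> f i \<in> V" "\<And>i. i < m \<Longrightarrow> c i \<in> K" "h \<in> V"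
  shows "B (lin_comb m f c) h = (\<Sum>i<m. c i * B (f i) h)"
  using assms
proof (induction m)
  case (Suc m)
  have "lin_comb (Suc m) f c = (\<lambda>x. lin_comb m f c x + c m * f m x)" by (simp add: lin_comb_def)
  then show ?case using Suc by (simp add: form_add form_scale lin_comb_in scale_in)
qed (simp add: lin_comb_def form_zero)

lemma sq_scale: "c \<in> K \<Longrightarrow> f \<in> V \<Longrightarrow> sq (\<lambda>x. c * f x) = (cmod c)\<^sup>2 * sq f"
  unfolding sq_def by (simp add: form_scale form_scale_right scale_in mult.assoc[symmetric]
      complex_norm_square[symmetric])

lemma sq_add: "f \<in> V \<Longrightarrow> g \<in> V \<Longrightarrow> sq (\<lambda>x. f x + g x) = sq f + sq g + 2 * Re (B f g)"
  using hermitian[of f g] by (simp add: sq_def form_add form_add_right add_in)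

lemma sq_diff: "f \<in> V \<Longrightarrow> g \<in> V \<Longrightarrow> sq (\<lambda>x. f x - g x) = sq f + sq g - 2 * Re (B f g)"
  using sq_add[of f "\<lambda>x. -1 * g x"] sq_scale[of "-1" g] form_scale_right[of "-1" g f]
    scalar_closed[OF scalars] scale_in[of "-1" g] by simp

lemma parallelogram: "f \<in> V \<Longrightarrow> g \<in> V \<Longrightarrow>
    sq (\<lambda>x. f x + g x) + sq (\<lambda>x. f x - g x) = 2 * sq f + 2 * sq g"
  by (simp add: sq_add sq_diff)

text \<open>
  The squared norm of \<open>f - t \<langle>f, g\<rangle> g\<close> is nonnegative; optimizing over \<open>t\<close> yields the
  Cauchy-Schwarz inequality, also for null vectors \<open>g\<close>.
\<close>
lemma sq_sub_multiple:
  assumes "f \<in> V" "g \<in> V"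
  shows "sq f - 2 * t * (cmod (B f g))\<^sup>2 + t\<^sup>2 * (cmod (B f g))\<^sup>2 * sq g \<ge> 0"
proof -
  let ?c = "- (of_real t * B f g)"
  have c: "?c \<in> K" using scalar_closed[OF scalars] form_scalar[OF assms] by auto
  have "sq (\<lambda>x. f x + ?c * g x) = sq f + (cmod ?c)\<^sup>2 * sq g + 2 * Re (cnj ?c * B f g)"
    using assms c by (simp only: sq_add sq_scale scale_in form_scale_right)
  moreover have "Re (cnj ?c * B f g) = - t * (cmod (B f g))\<^sup>2"
    unfolding cmod_power2 by (simp add: power2_eq_square algebra_simps)
  moreover have "(cmod ?c)\<^sup>2 = t\<^sup>2 * (cmod (B f g))\<^sup>2"
    by (simp add: norm_mult power_mult_distrib)
  ultimately show ?thesis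
    using sq_nonneg[OF add_in[OF assms(1) scale_in[OF c assms(2)]]] by (simp add: algebra_simps)
qed

lemma form_null:
  assumes "f \<in> V" "g \<in> V" "sq g = 0"
  shows "B f g = 0"
proof (rule ccontr)
  assume "B f g \<noteq> 0"
  then have p: "(cmod (B f g))\<^sup>2 > 0" by simp
  define t where "t = (sq f + 1) / (cmod (B f g))\<^sup>2"
  have "t * (cmod (B f g))\<^sup>2 = sq f + 1" using p by (simp add: t_def)
  then show False
    using sq_sub_multiple[OF assms(1,2), of t] assms(3) sq_nonneg[OF assms(1)] by (simp add: mult.assoc)
qed

lemma Cauchy_Schwarz:
  assumes "f \<in> V" "g \<in> V"
  shows "(cmod (B f g))\<^sup>2 \<le> sq f * sq g"
proof (cases "sq g = 0")
  case False
  then have p: "sq g > 0" using sq_nonneg[OF assms(2)] by simp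
  have "0 \<le> sq f - (cmod (B f g))\<^sup>2 / sq g"
    using sq_sub_multiple[OF assms, of "1 / sq g"] p by (simp add: field_simps power2_eq_square)
  then show ?thesis using p by (simp add: field_simps)
qed (use form_null[OF assms] in simp)

lemma norm_triangle:
  assumes "f \<in> V" "g \<in> V"
  shows "sqrt (sq (\<lambda>x. f x + g x)) \<le> sqrt (sq f) + sqrt (sq g)"
proof (rule real_le_lsqrt)
  have "Re (B f g) \<le> sqrt (sq f * sq g)"
    using Cauchy_Schwarz[OF assms] complex_Re_le_cmod[of "B f g"]
    by (meson order_trans real_le_rsqrt)
  then show "sq (\<lambda>x. f x + g x) \<le> (sqrt (sq f) + sqrt (sq g))\<^sup>2"
    using assms by (simp add: sq_add power2_sum sq_nonneg real_sqrt_mult)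
qed (use assms in \<open>simp_all add: sq_nonneg add_in\<close>)

lemma norm_triangle_diff:
  assumes "f \<in> V" "g \<in> V"
  shows "\<bar>sqrt (sq f) - sqrt (sq g)\<bar> \<le> sqrt (sq (\<lambda>x. f x - g x))"
proof -
  have "sq (\<lambda>x. g x - f x) = sq (\<lambda>x. f x - g x)"
    using assms hermitian[of f g] by (simp add: sq_diff)
  then show ?thesis
    using norm_triangle[OF diff_in[OF assms] assms(2)] norm_triangle[OF diff_in[OF assms(2,1)] assms(1)]
    by simp
qed

lemma sq_lin_comb_orthogonal:
  assumes e: "\<And>i. i < m \<Longrightarrow> e i \<in> V" and c: "\<And>i. i < m \<Longrightarrow> c i \<in> K"
    and orth: "\<And>i j. i < m \<Longrightarrow> j < m \<Longrightarrow> i \<noteq> j \<Longrightarrow> B (e i) (e j) = 0"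
  shows "sq (lin_comb m e c) = (\<Sum>i<m. (cmod (c i))\<^sup>2 * sq (e i))"
  using assms
proof (induction m)
  case (Suc m)
  have eq: "lin_comb (Suc m) e c = (\<lambda>x. lin_comb m e c x + c m * e m x)" by (simp add: lin_comb_def)
  have in1: "lin_comb m e c \<in> V" "(\<lambda>x. c m * e m x) \<in> V"
    using Suc.prems by (auto intro!: lin_comb_in scale_in)
  have "B (lin_comb m e c) (\<lambda>x. c m * e m x) = cnj (c m) * B (lin_comb m e c) (e m)"
    using Suc.prems in1 by (intro form_scale_right) auto
  also have "\<dots> = 0" using Suc.prems by (subst form_lin_comb) auto
  finally show ?case using Suc in1 by (simp add: eq sq_add sq_scale)
qed (simp add: lin_comb_def sq_def form_zero[OF zero_in])

lemma sq_add_perp: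
  assumes "\<And>i. i < m \<Longrightarrow> e i \<in> V" "\<And>i. i < m \<Longrightarrow> c i \<in> K" "g \<in> V"
    and perp: "\<And>i. i < m \<Longrightarrow> B (e i) g = 0"
  shows "sq (\<lambda>x. g x + lin_comb m e c x) = sq g + sq (lin_comb m e c)"
proof -
  have "B (lin_comb m e c) g = 0" using assms by (subst form_lin_comb) auto
  then have "B g (lin_comb m e c) = 0"
    using hermitian[of "lin_comb m e c" g] assms by (simp add: lin_comb_in)
  then show ?thesis using assms by (simp add: sq_add lin_comb_in)
qed

end

definition innerG :: "nat \<Rightarrow> approx_problem \<Rightarrow> func \<Rightarrow> func \<Rightarrow> complex" where
  "innerG d P f g = (\<integral>x. f x * cnj (g x) \<partial>weighted_measure d P)"

lemma space_weighted_measure: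
  assumes "admissible_domain d P"
  shows "space (weighted_measure d P) = domain P"
proof -
  have "domain P \<subseteq> space (lebesgue_d d)"
    using assms by (auto simp: admissible_domain_def dest: sets.sets_into_space)
  then show ?thesis by (auto simp: weighted_measure_def space_restrict_space)
qed

lemma prob_space_weighted_measure:
  assumes "admissible_domain d P" "probability_density d P"
  shows "prob_space (weighted_measure d P)"
proof
  let ?R = "restrict_space (lebesgue_d d) (domain P)"
  have [measurable]: "weight P \<in> borel_measurable ?R" using assms by (simp add: probability_density_def)
  have "emeasure (weighted_measure d P) (space (weighted_measure d P))
      = (\<integral>\<^sup>+x. ennreal (weight P x) * indicator (space ?R) x \<partial>?R)"
    unfolding weighted_measure_def by (subst emeasure_density) auto
  also have "\<dots> = (\<integral>\<^sup>+x. ennreal (weight P x) \<partial>?R)"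
    by (intro nn_integral_cong) auto
  finally show "emeasure (weighted_measure d P) (space (weighted_measure d P)) = 1"
    using assms by (simp add: probability_density_def)
qed

lemma integrable_product_spaceG:
  assumes "f \<in> spaceG K d P" "g \<in> spaceG K d P"
  shows "integrable (weighted_measure d P) (\<lambda>x. f x * cnj (g x))"
proof (rule Bochner_Integration.integrable_bound)
  show "integrable (weighted_measure d P) (\<lambda>x. (cmod (f x))\<^sup>2 + (cmod (g x))\<^sup>2)"
    using assms by (auto simp: spaceG_def)
  have "cmod (f x * cnj (g x)) \<le> (cmod (f x))\<^sup>2 + (cmod (g x))\<^sup>2" for x
  proof -
    have "2 * (cmod (f x) * cmod (g x)) \<le> (cmod (f x))\<^sup>2 + (cmod (g x))\<^sup>2"
      using sum_squares_bound[of "cmod (f x)" "cmod (g x)"] by simp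
    moreover have "0 \<le> cmod (f x) * cmod (g x)" by simp
    ultimately show ?thesis unfolding norm_mult complex_mod_cnj by linarith
  qed
  then show "AE x in weighted_measure d P. norm (f x * cnj (g x)) \<le> norm ((cmod (f x))\<^sup>2 + (cmod (g x))\<^sup>2)"
    by auto
qed (use assms in \<open>auto simp: spaceG_def\<close>)

lemma linear_spaceG:
  assumes "K = \<real> \<or> K = UNIV"
  shows "linear_space K (spaceG K d P)"
  unfolding linear_space_def
proof (intro conjI ballI)
  fix f g assume fg: "f \<in> spaceG K d P" "g \<in> spaceG K d P"
  have "integrable (weighted_measure d P) (\<lambda>x. (cmod (f x))\<^sup>2 + (cmod (g x))\<^sup>2 + 2 * Re (f x * cnj (g x)))"
    using fg integrable_product_spaceG[OF fg, THEN integrable_Re]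
    by (intro Bochner_Integration.integrable_add integrable_mult_right) (simp_all only: spaceG_def mem_Collect_eq)
  moreover have "(cmod (f x))\<^sup>2 + (cmod (g x))\<^sup>2 + 2 * Re (f x * cnj (g x)) = (cmod (f x + g x))\<^sup>2" for x
    unfolding cmod_power2 by (simp add: power2_sum)
  ultimately show "(\<lambda>x. f x + g x) \<in> spaceG K d P"
    using fg scalar_closed[OF assms] by (auto simp: spaceG_def)
next
  fix c f assume "c \<in> K" "f \<in> spaceG K d P"
  then show "(\<lambda>x. c * f x) \<in> spaceG K d P"
    using scalar_closed[OF assms] by (auto simp: spaceG_def norm_mult power_mult_distrib)
qed (use scalar_closed[OF assms] in \<open>auto simp: spaceG_def\<close>)

lemma semi_inner_spaceG:
  assumes K: "K = \<real> \<or> K = UNIV"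
  shows "semi_inner_space K (spaceG K d P) (innerG d P)"
proof
  show "K = \<real> \<or> K = UNIV" "linear_space K (spaceG K d P)" using K linear_spaceG by auto
next
  fix f g assume fg: "f \<in> spaceG K d P" "g \<in> spaceG K d P"
  show herm: "innerG d P g f = cnj (innerG d P f g)"
    unfolding innerG_def by (subst Bochner_Integration.integral_cnj[symmetric]) (simp add: mult.commute)
  show "innerG d P f g \<in> K"
  proof (cases "K = UNIV")
    case False
    with K have "K = \<real>" by simp
    then have "f x * cnj (g x) = cnj (f x * cnj (g x))" for x
      using fg by (auto simp: spaceG_def Reals_cnj_iff)
    then have "innerG d P f g = cnj (innerG d P f g)"
      unfolding innerG_def by (subst Bochner_Integration.integral_cnj[symmetric]) simp
    then show ?thesis using \<open>K = \<real>\<close> by (simp add: Reals_cnj_iff)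
  qed simp
  fix h assume h: "h \<in> spaceG K d P"
  show "innerG d P (\<lambda>x. f x + g x) h = innerG d P f h + innerG d P g h"
    unfolding innerG_def using integrable_product_spaceG[OF fg(1) h] integrable_product_spaceG[OF fg(2) h]
    by (simp add: distrib_right)
next
  fix c f h assume "c \<in> K" "f \<in> spaceG K d P" "h \<in> spaceG K d P"
  show "innerG d P (\<lambda>x. c * f x) h = c * innerG d P f h"
    unfolding innerG_def by (simp add: mult.assoc)
next
  fix f assume "f \<in> spaceG K d P"
  have "innerG d P f f = (\<integral>x. of_real ((cmod (f x))\<^sup>2) \<partial>weighted_measure d P)"
    unfolding innerG_def complex_norm_square by simp
  then show "Re (innerG d P f f) \<ge> 0" by (simp add: of_real_power[symmetric] del: of_real_power)
qed

lemma normG_square: "(normG d P f)\<^sup>2 = Re (innerG d P f f)"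
proof -
  have "innerG d P f f = (\<integral>x. of_real ((cmod (f x))\<^sup>2) \<partial>weighted_measure d P)"
    unfolding innerG_def complex_norm_square by simp
  then show ?thesis by (simp add: normG_def of_real_power[symmetric] del: of_real_power)
qed

lemma normG_nonneg: "normG d P f \<ge> 0" by (simp add: normG_def)

lemma semi_inner_spaceF:
  assumes "K = \<real> \<or> K = UNIV" "inner_product_space K d P"
  shows "semi_inner_space K (spaceF P) (innerF P)"
proof -
  note H = assms(2)[unfolded inner_product_space_def]
  show ?thesis
  proof
    show "K = \<real> \<or> K = UNIV" by fact
    show "linear_space K (spaceF P)" using H by (elim conjE)
  qed (use H in \<open>(elim conjE, blast)+\<close>)
qed

section \<open>A lower bound for randomized algorithms with arbitrary functionals\<close>

abbreviation real_comb :: "nat \<Rightarrow> (nat \<Rightarrow> func) \<Rightarrow> (nat \<Rightarrow> real) \<Rightarrow> func" where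
  "real_comb m f x \<equiv> lin_comb m f (\<lambda>l. of_real (x l))"

lemma gaussian_integral:
  assumes "s > 0"
  shows "(\<integral>\<^sup>+x. ennreal (exp (- s * sqn m x)) \<partial>leb {..<m}) = ennreal (sqrt (pi / s) ^ m)"
proof -
  have one: "(\<integral>\<^sup>+x. ennreal (exp (- s * x\<^sup>2)) \<partial>lborel) = ennreal (sqrt (pi / s))"
  proof -
    define \<sigma> where "\<sigma> = sqrt (1 / (2 * s))"
    have \<sigma>: "\<sigma> > 0" "\<sigma>\<^sup>2 = 1 / (2 * s)" using assms by (auto simp: \<sigma>_def)
    interpret prob_space "density lborel (normal_density 0 \<sigma>)"
      using \<sigma>(1) by (rule prob_space_normal_density)
    have "1 = emeasure (density lborel (normal_density 0 \<sigma>)) UNIV" using emeasure_space_1 by simp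
    also have "\<dots> = (\<integral>\<^sup>+x. ennreal (normal_density 0 \<sigma> x) \<partial>lborel)" by (simp add: emeasure_density)
    finally have n1: "(\<integral>\<^sup>+x. ennreal (normal_density 0 \<sigma> x) \<partial>lborel) = 1" by simp
    have "exp (- s * x\<^sup>2) = sqrt (pi / s) * normal_density 0 \<sigma> x" for x
      unfolding normal_density_def \<sigma>(2) using assms by (simp add: field_simps)
    then have "(\<integral>\<^sup>+x. ennreal (exp (- s * x\<^sup>2)) \<partial>lborel)
        = (\<integral>\<^sup>+x. ennreal (sqrt (pi / s)) * ennreal (normal_density 0 \<sigma> x) \<partial>lborel)"
      using assms by (simp add: ennreal_mult[symmetric])
    then show ?thesis using n1 by (simp add: nn_integral_cmult)
  qed
  have "(\<integral>\<^sup>+x. ennreal (exp (- s * sqn m x)) \<partial>leb {..<m})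
      = (\<integral>\<^sup>+x. (\<Prod>i<m. ennreal (exp (- s * (x i)\<^sup>2))) \<partial>leb {..<m})"
    by (simp add: prod_ennreal exp_sum[symmetric] sqn_def sum_distrib_left)
  also have "\<dots> = (\<Prod>i<m. \<integral>\<^sup>+x. ennreal (exp (- s * x\<^sup>2)) \<partial>lborel)"
    by (rule lborel_product.product_nn_integral_prod) auto
  also have "\<dots> = ennreal (sqrt (pi / s) ^ m)"
    unfolding one using assms by (simp add: ennreal_power)
  finally show ?thesis .
qed

text \<open>
  The Chernoff bound: \<open>q + 1 \<le> 2 exp (r (q - 1))\<close> for \<open>q \<ge> 1\<close>.
\<close>
lemma gaussian_tail:
  assumes "1 \<le> r" "r < s"
  shows "(\<integral>\<^sup>+x. ennreal (if sqn m x \<le> 1 then 0 else exp (- s * sqn m x) * (sqn m x + 1)) \<partial>leb {..<m})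
     \<le> ennreal (2 * exp (- r) * sqrt (pi / (s - r)) ^ m)"
proof -
  have [measurable]: "sqn m \<in> borel_measurable (leb {..<m})" unfolding sqn_def[abs_def] by measurable
  have "(\<integral>\<^sup>+x. ennreal (if sqn m x \<le> 1 then 0 else exp (- s * sqn m x) * (sqn m x + 1)) \<partial>leb {..<m})
     \<le> (\<integral>\<^sup>+x. ennreal (2 * exp (- r)) * ennreal (exp (- (s - r) * sqn m x)) \<partial>leb {..<m})"
  proof (rule nn_integral_mono)
    fix x
    have "exp (- s * q) * (q + 1) \<le> 2 * exp (- r) * exp (- (s - r) * q)" if q: "q > 1" for q :: real
    proof -
      have "q + 1 \<le> 2 * (1 + (q - 1))" using q by simp
      also have "\<dots> \<le> 2 * exp (q - 1)" using exp_ge_add_one_self[of "q - 1"] by simp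
      also have "\<dots> \<le> 2 * exp (r * (q - 1))"
        using mult_right_mono[OF assms(1), of "q - 1"] q by simp
      finally have "exp (- s * q) * (q + 1) \<le> exp (- s * q) * (2 * exp (r * (q - 1)))" by simp
      also have "\<dots> = 2 * exp (- r) * exp (- (s - r) * q)"
        by (simp add: exp_add[symmetric] algebra_simps)
      finally show ?thesis .
    qed
    then show "ennreal (if sqn m x \<le> 1 then 0 else exp (- s * sqn m x) * (sqn m x + 1))
      \<le> ennreal (2 * exp (- r)) * ennreal (exp (- (s - r) * sqn m x))"
      by (auto simp: ennreal_mult[symmetric] intro!: ennreal_leI simp del: mult_minus_left)
  qed
  also have "\<dots> = ennreal (2 * exp (- r) * sqrt (pi / (s - r)) ^ m)"
    using assms gaussian_integral[of "s - r" m]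
    by (subst nn_integral_cmult) (auto simp: ennreal_mult[symmetric])
  finally show ?thesis .
qed

lemma functional_lin_comb:
  assumes K: "K = \<real> \<or> K = UNIV" and F: "linear_space K (spaceF P)" and L: "L \<in> functionals K P Info_all"
    and "\<And>i. i < m \<Longrightarrow> f i \<in> spaceF P" "\<And>i. i < m \<Longrightarrow> c i \<in> K"
  shows "lin_comb m f c \<in> spaceF P \<and> L (lin_comb m f c) = (\<Sum>i<m. c i * L (f i))"
  using assms(4,5)
proof (induction m)
  case 0
  have "(\<lambda>x. 0) \<in> spaceF P" using F by (simp add: linear_space_def)
  moreover have "\<forall>c\<in>K. \<forall>f\<in>spaceF P. L (\<lambda>x. c * f x) = c * L f" using L by simp
  ultimately have "L (\<lambda>x. 0 * (\<lambda>x. 0) x) = 0 * L (\<lambda>x. 0)"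
    using scalar_closed(2)[OF K] by (elim ballE) auto
  with \<open>(\<lambda>x. 0) \<in> spaceF P\<close> show ?case by (simp add: lin_comb_def)
next
  case (Suc m)
  have eq: "lin_comb (Suc m) f c = (\<lambda>x. lin_comb m f c x + c m * f m x)" by (simp add: lin_comb_def)
  have "(\<lambda>x. c m * f m x) \<in> spaceF P" using F Suc.prems by (simp add: linear_space_def)
  then show ?case using Suc F L unfolding eq by (simp add: linear_space_def)
qed

context
  fixes K :: "complex set" and d :: nat and P :: approx_problem and A :: "'w ran_alg"
    and m :: nat and f :: "nat \<Rightarrow> func" and \<theta> s :: real
  assumes K: "K = \<real> \<or> K = UNIV" and P: "is_approx_problem K d P"
    and A: "randomized_algorithm K d P Info_all A"
    and f: "\<And>i. i < m \<Longrightarrow> f i \<in> spaceF P"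
    and \<theta>: "\<theta> \<ge> 0" and s: "s > 0"
    and expand: "\<And>x. \<theta> * sqn m x \<le> (normG d P (real_comb m f x))\<^sup>2"
begin

private lemma linF: "linear_space K (spaceF P)"
  using P by (simp add: is_approx_problem_def separable_hilbert_space_def inner_product_space_def)

private lemma FG: "spaceF P \<subseteq> spaceG K d P"
  using P by (simp add: is_approx_problem_def compactly_embedded_def)

private lemma real_comb_in: "real_comb m f x \<in> spaceF P"
  by (rule functional_lin_comb[where L = "\<lambda>_. 0", OF K linF, THEN conjunct1])
     (use f scalar_closed[OF K] in auto)

private lemma real_comb_restrict: "real_comb m f (restrict x {..<m}) = real_comb m f x"
  by (simp add: lin_comb_def)

private abbreviation L where "L w \<equiv> \<lambda>ys l. query A w ys (f l)"
private abbreviation loss where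
  "loss w \<equiv> \<lambda>ys x. (normG d P (\<lambda>t. real_comb m f x t - outcome A w ys t))\<^sup>2"

private lemma info_values_eq:
  assumes "w \<in> space (prob_space_of A)"
  shows "info_values A w (real_comb m f x) j = values_at m (L w) x j"
proof (induction j)
  case (Suc j)
  have q: "query A w ys \<in> functionals K P Info_all" for ys
    using A assms by (simp add: randomized_algorithm_def)
  have "query A w ys (real_comb m f x) = linear_value m x (L w ys)" for ys
    using functional_lin_comb[where f = f and m = m and c = "\<lambda>l. of_real (x l)", OF K linF q f] scalar_closed(1)[OF K]
    by (auto simp: linear_value_def)
  then show ?case using Suc by simp
qed simp

private lemma embed_measurable:
  "(\<lambda>x. \<lambda>l\<in>{..<m}. complex_of_real (x l)) \<in> measurable (leb {..<m}) (scalar_vectors K m)"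
  unfolding scalar_vectors_def using scalar_closed(1)[OF K]
  by (intro measurable_restrict measurable_restrict_space2) auto

private lemma joint_measurable:
  shows "(\<lambda>p. cardinality A (real_comb m f (fst p)) (snd p))
           \<in> measurable (leb {..<m} \<Otimes>\<^sub>M prob_space_of A) (count_space UNIV)" (is ?card)
    and "(\<lambda>p. event_error d P A (real_comb m f (fst p)) (snd p))
           \<in> borel_measurable (leb {..<m} \<Otimes>\<^sub>M prob_space_of A)" (is ?error)
proof -
  have emb: "(\<lambda>p. (\<lambda>l\<in>{..<m}. complex_of_real (fst p l), snd p))
     \<in> measurable (leb {..<m} \<Otimes>\<^sub>M prob_space_of A) (scalar_vectors K m \<Otimes>\<^sub>M prob_space_of A)"
    using embed_measurable by measurable
  have r: "lin_comb m f (\<lambda>l\<in>{..<m}. c l) = lin_comb m f c" for c by (simp add: lin_comb_def)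
  have J: "jointly_measurable K d P A" using A by (simp add: randomized_algorithm_def)
  have "(\<lambda>p. cardinality A (lin_comb m f (fst p)) (snd p))
          \<in> measurable (scalar_vectors K m \<Otimes>\<^sub>M prob_space_of A) (count_space UNIV)"
      "(\<lambda>p. event_error d P A (lin_comb m f (fst p)) (snd p))
          \<in> borel_measurable (scalar_vectors K m \<Otimes>\<^sub>M prob_space_of A)"
    using f J[unfolded jointly_measurable_def, THEN spec[where x = m], THEN spec[where x = f]]
    by (auto simp: case_prod_unfold)
  from this[THEN measurable_compose[OF emb]] show ?card ?error by (simp_all add: r)
qed

private lemma adaptive:
  assumes w: "w \<in> space (prob_space_of A)"
  shows "measurable_adaptive_method m (L w) (halts A w) (loss w) \<theta> s"
    and "adaptive_method.card_at m (L w) (halts A w) x = cardinality A (real_comb m f x) w"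
    and "adaptive_method.final_loss m (L w) (halts A w) (loss w) x = (event_error d P A (real_comb m f x) w)\<^sup>2"
proof -
  interpret G: semi_inner_space K "spaceG K d P" "innerG d P" by (rule semi_inner_spaceG[OF K])
  interpret adaptive_method m "L w" "halts A w" "loss w" \<theta> s
  proof
    fix ys x v
    have out: "outcome A w ys \<in> spaceG K d P" using A w by (simp add: randomized_algorithm_def)
    have "real_comb m f x \<in> spaceG K d P" "real_comb m f v \<in> spaceG K d P"
      using real_comb_in FG by auto
    moreover have "(\<lambda>t. real_comb m f (\<lambda>l. x l + v l) t - outcome A w ys t)
       = (\<lambda>t. (real_comb m f x t - outcome A w ys t) + real_comb m f v t)"
      "(\<lambda>t. real_comb m f (\<lambda>l. x l - v l) t - outcome A w ys t)
       = (\<lambda>t. (real_comb m f x t - outcome A w ys t) - real_comb m f v t)"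
      by (auto simp: lin_comb_def algebra_simps sum.distrib sum_subtractf)
    ultimately have "loss w ys (\<lambda>l. x l + v l) + loss w ys (\<lambda>l. x l - v l)
       = 2 * loss w ys x + 2 * (normG d P (real_comb m f v))\<^sup>2"
      using G.parallelogram[of "\<lambda>t. real_comb m f x t - outcome A w ys t" "real_comb m f v"]
        G.diff_in[OF _ out, of "real_comb m f x"]
      by (simp add: normG_square G.sq_def)
    then show "2 * \<theta> * sqn m v \<le> loss w ys (\<lambda>l. x l + v l) + loss w ys (\<lambda>l. x l - v l)"
      using expand[of v] zero_le_power2[of "normG d P (\<lambda>t. real_comb m f x t - outcome A w ys t)"]
      by linarith
  next
    fix x
    show "\<exists>j. halts A w (values_at m (L w) x j)"
      unfolding info_values_eq[OF w, symmetric]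
      using A w real_comb_in[of x] unfolding randomized_algorithm_def by blast
  qed (use \<theta> s real_comb_restrict in simp_all)
  show card: "card_at x = cardinality A (real_comb m f x) w" for x
    by (simp add: card_at_def cardinality_def info_values_eq[OF w])
  show loss: "final_loss x = (event_error d P A (real_comb m f x) w)\<^sup>2" for x
    by (simp add: final_loss_def event_error_def run_def card[symmetric] info_values_eq[OF w])
  have sec: "(\<lambda>x. (x, w)) \<in> measurable (leb {..<m}) (leb {..<m} \<Otimes>\<^sub>M prob_space_of A)"
    using w by (rule measurable_Pair2')
  show "measurable_adaptive_method m (L w) (halts A w) (loss w) \<theta> s"
  proof
    show "card_at \<in> measurable (leb {..<m}) (count_space UNIV)"
      using measurable_compose[OF sec joint_measurable(1)] by (simp add: card[abs_def, symmetric])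
    show "final_loss \<in> borel_measurable (leb {..<m})"
      using measurable_compose[OF sec joint_measurable(2)]
      by (simp add: loss cong: measurable_cong)
  qed
qed

text \<open>
  For each elementary event the slice estimate bounds the Gaussian average of the cost of a
  deterministic method from below. After exchanging the two integrals, error and cardinality of the
  randomized algorithm bound the inner integral from above for inputs in the unit ball.
\<close>
lemma average_cost_bound:
  assumes orth: "\<And>x. normF P (real_comb m f x) = sqrt (sqn m x)"
    and card: "ran_card P A \<le> of_nat n" and err: "ran_error d P A \<le> ennreal e" and e: "e \<ge> 0"
    and r: "1 \<le> r" "r < s" and ms: "m / (2 * s) \<le> 1"
  shows "\<theta> * (m / (2 * s)) \<le> e\<^sup>2 + \<theta> / s * n + \<theta> * (2 * exp (- r) * sqrt (s / (s - r)) ^ m)"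
proof -
  let ?M = "prob_space_of A"
  let ?f = "real_comb m f"
  interpret M: prob_space ?M using A by (simp add: randomized_algorithm_def)
  interpret I: finite_product_sigma_finite "\<lambda>_ :: nat. lborel :: real measure" "{..<m}"
    by standard auto
  interpret pair_sigma_finite "leb {..<m}" ?M by standard
  note [measurable] = joint_measurable
  have [measurable]: "sqn m \<in> borel_measurable (leb {..<m})" unfolding sqn_def[abs_def] by measurable
  define g where "g = (\<lambda>x. exp (- s * sqn m x))"
  have [measurable]: "g \<in> borel_measurable (leb {..<m})" unfolding g_def by measurable
  have g0: "g x > 0" for x by (simp add: g_def)
  define z where "z = sqrt (pi / s) ^ m"
  have z0: "z > 0" using s by (simp add: z_def)
  have Z: "(\<integral>\<^sup>+x. ennreal (g x) \<partial>leb {..<m}) = ennreal z"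
    using gaussian_integral[OF s, of m] by (simp add: g_def z_def)
  define h where "h = (\<lambda>x w. ennreal (g x * (if sqn m x \<le> 1
      then (event_error d P A (?f x) w)\<^sup>2 + \<theta> / s * real (cardinality A (?f x) w)
      else \<theta> * sqn m x + \<theta> * m / (2 * s))))"
  have hm[measurable]: "(\<lambda>p. h (fst p) (snd p)) \<in> borel_measurable (leb {..<m} \<Otimes>\<^sub>M ?M)"
    unfolding h_def by measurable
  have each: "ennreal (\<theta> * m / (2 * s)) * ennreal z \<le> (\<integral>\<^sup>+x. h x w \<partial>leb {..<m})" if w: "w \<in> space ?M" for w
  proof -
    interpret w: measurable_adaptive_method m "L w" "halts A w" "loss w" \<theta> s
      by (rule adaptive(1)[OF w])
    have "w.slice_cost m 0 x = h x w" for x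
      by (simp add: w.slice_cost_def penalized_def w.cost_def adaptive[OF w] h_def g_def)
    moreover have "w.gauss x = ennreal (g x)" for x by (simp add: w.gauss_def g_def)
    ultimately show ?thesis using w.gauss_average by (simp add: Z)
  qed
  have ball: "?f x \<in> unit_ballF P" if "sqn m x \<le> 1" for x
    using that orth[of x] real_comb_in[of x] by (simp add: unit_ballF_def)
  have inner: "(\<integral>\<^sup>+w. h x w \<partial>?M) \<le> ennreal (e\<^sup>2 + \<theta> / s * n) * ennreal (g x)
      + ennreal \<theta> * ennreal (if sqn m x \<le> 1 then 0 else g x * (sqn m x + 1))"
    if x: "x \<in> space (leb {..<m})" for x
  proof (cases "sqn m x \<le> 1")
    case True
    note b = ball[OF True]
    have [measurable]: "(\<lambda>w. event_error d P A (?f x) w) \<in> borel_measurable ?M"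
      using measurable_compose[OF measurable_Pair1'[OF x] joint_measurable(2)] by simp
    have [measurable]: "(\<lambda>w. cardinality A (?f x) w) \<in> measurable ?M (count_space UNIV)"
      using measurable_compose[OF measurable_Pair1'[OF x] joint_measurable(1)] by simp
    have c: "(\<integral>\<^sup>+w. of_nat (cardinality A (?f x) w) \<partial>?M) \<le> of_nat n"
      using card[unfolded ran_card_def SUP_le_iff] b by (rule bspec)
    define X where "X = (\<integral>\<^sup>+w. ennreal ((event_error d P A (?f x) w)\<^sup>2) \<partial>?M)"
    have "ennreal_sqrt X \<le> ennreal e"
      using err[unfolded ran_error_def SUP_le_iff] b unfolding X_def by (rule bspec)
    then have "X \<le> ennreal (e\<^sup>2)"
    proof (cases X)
      case (real r)
      then have "sqrt r \<le> e" using \<open>ennreal_sqrt X \<le> ennreal e\<close> e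
        by (simp add: ennreal_sqrt_def)
      then have "r \<le> e\<^sup>2" using real by (metis real_sqrt_le_iff real_sqrt_abs abs_of_nonneg e)
      then show ?thesis using real by (simp add: ennreal_leI)
    qed (simp add: ennreal_sqrt_def top_unique)
    have tc: "ennreal (\<theta> / s * real k) = ennreal (\<theta> / s) * of_nat k" for k
      using \<theta> s by (subst ennreal_mult) (auto simp: ennreal_of_nat_eq_real_of_nat)
    have "(\<integral>\<^sup>+w. h x w \<partial>?M) = (\<integral>\<^sup>+w. ennreal (g x) * (ennreal ((event_error d P A (?f x) w)\<^sup>2)
        + ennreal (\<theta> / s) * of_nat (cardinality A (?f x) w)) \<partial>?M)"
      using True g0[of x] \<theta> s
      by (intro nn_integral_cong) (simp add: h_def ennreal_mult tc del: times_divide_eq_left)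
    also have "\<dots> = ennreal (g x) * (X + ennreal (\<theta> / s) * (\<integral>\<^sup>+w. of_nat (cardinality A (?f x) w) \<partial>?M))"
      by (simp add: nn_integral_cmult nn_integral_add X_def)
    also have "\<dots> \<le> ennreal (g x) * (ennreal (e\<^sup>2) + ennreal (\<theta> / s) * of_nat n)"
      by (intro mult_left_mono add_mono c \<open>X \<le> _\<close>) auto
    also have "\<dots> = ennreal (e\<^sup>2 + \<theta> / s * n) * ennreal (g x)"
    proof -
      have "ennreal (e\<^sup>2 + \<theta> / s * n) = ennreal (e\<^sup>2) + ennreal (\<theta> / s) * of_nat n"
        unfolding tc[symmetric] using \<theta> s by (intro ennreal_plus) auto
      then show ?thesis by (simp only: mult.commute)
    qed
    finally show ?thesis using True by simp
  next
    case False
    have "(\<integral>\<^sup>+w. h x w \<partial>?M) = ennreal (g x * (\<theta> * sqn m x + \<theta> * m / (2 * s)))"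
      using False by (simp add: h_def M.emeasure_space_1)
    also have "\<dots> \<le> ennreal (\<theta> * (g x * (sqn m x + 1)))"
    proof (intro ennreal_leI)
      have "\<theta> * (m / (2 * s)) \<le> \<theta> * 1" using ms \<theta> by (intro mult_left_mono)
      then have "g x * (\<theta> * sqn m x + \<theta> * m / (2 * s)) \<le> g x * (\<theta> * sqn m x + \<theta>)"
        using g0[of x] by (intro mult_left_mono) auto
      then show "g x * (\<theta> * sqn m x + \<theta> * m / (2 * s)) \<le> \<theta> * (g x * (sqn m x + 1))"
        by (simp add: algebra_simps)
    qed
    also have "\<dots> = ennreal \<theta> * ennreal (if sqn m x \<le> 1 then 0 else g x * (sqn m x + 1))"
      using False \<theta> g0[of x] by (simp add: ennreal_mult)
    finally show ?thesis by (rule order_trans) simp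
  qed
  have l1: "ennreal (\<theta> * m / (2 * s) * z) = ennreal (\<theta> * m / (2 * s)) * ennreal z"
    using \<theta> s z0 by (intro ennreal_mult) auto
  have l2: "ennreal ((e\<^sup>2 + \<theta> / s * n) * z + \<theta> * (2 * exp (- r) * sqrt (pi / (s - r)) ^ m))
      = ennreal (e\<^sup>2 + \<theta> / s * n) * ennreal z + ennreal \<theta> * ennreal (2 * exp (- r) * sqrt (pi / (s - r)) ^ m)"
  proof -
    have 1: "0 \<le> e\<^sup>2 + \<theta> / s * n" using \<theta> s by simp
    have 2: "0 \<le> 2 * exp (- r) * sqrt (pi / (s - r)) ^ m" using r by simp
    show ?thesis
      using ennreal_plus[OF mult_nonneg_nonneg[OF 1 less_imp_le[OF z0]] mult_nonneg_nonneg[OF \<theta> 2]]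
      unfolding ennreal_mult[OF 1 less_imp_le[OF z0]] ennreal_mult[OF \<theta> 2] .
  qed
  have "ennreal (\<theta> * m / (2 * s)) * ennreal z = (\<integral>\<^sup>+w. ennreal (\<theta> * m / (2 * s)) * ennreal z \<partial>?M)"
    by (simp add: M.emeasure_space_1)
  also have "\<dots> \<le> (\<integral>\<^sup>+w. \<integral>\<^sup>+x. h x w \<partial>leb {..<m} \<partial>?M)"
    by (rule nn_integral_mono) (rule each)
  also have "\<dots> = (\<integral>\<^sup>+x. \<integral>\<^sup>+w. h x w \<partial>?M \<partial>leb {..<m})"
    using Fubini[OF hm] by simp
  also have "\<dots> \<le> (\<integral>\<^sup>+x. ennreal (e\<^sup>2 + \<theta> / s * n) * ennreal (g x)
      + ennreal \<theta> * ennreal (if sqn m x \<le> 1 then 0 else g x * (sqn m x + 1)) \<partial>leb {..<m})"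
    by (rule nn_integral_mono) (rule inner)
  also have "\<dots> = ennreal (e\<^sup>2 + \<theta> / s * n) * ennreal z
      + ennreal \<theta> * (\<integral>\<^sup>+x. ennreal (if sqn m x \<le> 1 then 0 else g x * (sqn m x + 1)) \<partial>leb {..<m})"
    by (subst nn_integral_add) (auto simp: nn_integral_cmult Z)
  also have "\<dots> \<le> ennreal (e\<^sup>2 + \<theta> / s * n) * ennreal z
      + ennreal \<theta> * ennreal (2 * exp (- r) * sqrt (pi / (s - r)) ^ m)"
    unfolding g_def by (intro add_left_mono mult_left_mono gaussian_tail[OF r]) simp
  finally have "ennreal (\<theta> * m / (2 * s) * z)
      \<le> ennreal ((e\<^sup>2 + \<theta> / s * n) * z + \<theta> * (2 * exp (- r) * sqrt (pi / (s - r)) ^ m))"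
    unfolding l1 l2 .
  then have "\<theta> * m / (2 * s) * z \<le> (e\<^sup>2 + \<theta> / s * n) * z + \<theta> * (2 * exp (- r) * sqrt (pi / (s - r)) ^ m)"
    using \<theta> s z0 r by (subst (asm) ennreal_le_iff) auto
  also have "sqrt (pi / (s - r)) ^ m = sqrt (s / (s - r)) ^ m * z"
    using s unfolding z_def power_mult_distrib[symmetric] real_sqrt_mult[symmetric] by simp
  finally have "\<theta> * (m / (2 * s)) * z \<le> (e\<^sup>2 + \<theta> / s * n + \<theta> * (2 * exp (- r) * sqrt (s / (s - r)) ^ m)) * z"
    by (simp add: algebra_simps)
  then show ?thesis using z0 by (rule mult_right_le_imp_le)
qed

end

definition expansive :: "nat \<Rightarrow> approx_problem \<Rightarrow> real \<Rightarrow> nat \<Rightarrow> (nat \<Rightarrow> func) \<Rightarrow> bool" where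
  "expansive d P \<theta> m f \<longleftrightarrow> (\<forall>i<m. f i \<in> spaceF P) \<and>
     (\<forall>x. normF P (real_comb m f x) = sqrt (sqn m x)) \<and>
     (\<forall>x. \<theta> * sqn m x \<le> (normG d P (real_comb m f x))\<^sup>2)"

text \<open>
  With \<open>m\<close> directions of variance \<open>(1 - \<eta>) / m\<close> each, guessing costs \<open>(1 - \<eta>) \<theta>\<close>. This exceeds the
  squared error by at most the price \<open>\<le> \<eta> \<theta>\<close> of \<open>n\<close> queries, when \<open>m\<close> is a large multiple of \<open>n\<close>, and
  the tail outside of the unit ball, which decays like \<open>b ^ m\<close> with \<open>b < 1\<close>.
\<close>
lemma randomized_lower_bound:
  assumes \<kappa>: "0 < \<kappa>" "\<kappa> < (1 :: real)"
  shows "\<exists>C\<ge>1. \<forall>K d P (A :: 'w ran_alg) m n f \<theta> e.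
     (K = \<real> \<or> K = UNIV) \<longrightarrow> is_approx_problem K d P \<longrightarrow> randomized_algorithm K d P Info_all A \<longrightarrow>
     expansive d P \<theta> m f \<longrightarrow> \<theta> \<ge> 0 \<longrightarrow> ran_card P A \<le> of_nat n \<longrightarrow> ran_error d P A \<le> ennreal e \<longrightarrow>
     e \<ge> 0 \<longrightarrow> n \<ge> 1 \<longrightarrow> m \<ge> C * n \<longrightarrow> \<kappa> * \<theta> \<le> e\<^sup>2"
proof -
  define \<eta> where "\<eta> = (1 - \<kappa>) / 3"
  have \<eta>: "0 < \<eta>" "\<eta> < 1" using \<kappa> by (auto simp: \<eta>_def)
  \<comment> \<open>With \<open>r = \<eta> m / 2\<close> the tail bound is \<open>2 b ^ m\<close>; \<open>b < 1\<close> since \<open>exp \<eta> (1 - \<eta> + \<eta>\<^sup>2) \<ge> 1 + \<eta>\<^sup>3\<close>.\<close>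
  define b where "b = exp (- \<eta> / 2) * sqrt (1 / (1 - \<eta> + \<eta>\<^sup>2))"
  have den: "1 - \<eta> + \<eta>\<^sup>2 > 0" using \<eta> by (simp add: add_pos_pos)
  have b0: "b \<ge> 0" using den by (simp add: b_def)
  have "b\<^sup>2 = exp (- \<eta>) * (1 / (1 - \<eta> + \<eta>\<^sup>2))"
    using den by (simp add: b_def power_mult_distrib exp_double[symmetric])
  also have "\<dots> = 1 / (exp \<eta> * (1 - \<eta> + \<eta>\<^sup>2))" by (simp add: exp_minus field_simps)
  also have "\<dots> < 1"
  proof -
    have "1 < 1 + \<eta> ^ 3" using \<eta> by simp
    also have "\<dots> = (1 + \<eta>) * (1 - \<eta> + \<eta>\<^sup>2)" by (simp add: algebra_simps power2_eq_square power3_eq_cube)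
    also have "\<dots> \<le> exp \<eta> * (1 - \<eta> + \<eta>\<^sup>2)" using den by (intro mult_right_mono exp_ge_add_one_self) auto
    finally show ?thesis by simp
  qed
  finally have "b < 1" using b0 by (simp add: power_less_one_iff)
  then have "(\<lambda>m. b ^ m) \<longlonglongrightarrow> 0" using b0 by (intro LIMSEQ_realpow_zero)
  then have "eventually (\<lambda>m. b ^ m < \<eta> / 2) sequentially"
    using \<eta> by (intro order_tendstoD(2)) auto
  then obtain m0 where m0: "\<And>m. m \<ge> m0 \<Longrightarrow> b ^ m < \<eta> / 2" by (auto simp: eventually_sequentially)
  define C where "C = max (max 1 m0) (nat \<lceil>2 / \<eta>\<rceil>)"
  have C: "C \<ge> 1" "C \<ge> m0" "real C \<ge> 2 / \<eta>" by (auto simp: C_def) linarith+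
  show ?thesis
  proof (intro exI[of _ C] conjI allI impI C(1))
    fix K d P and A :: "'w ran_alg" and m n f \<theta> e
    assume H: "K = \<real> \<or> K = UNIV" "is_approx_problem K d P" "randomized_algorithm K d P Info_all A"
      and ex: "expansive d P \<theta> m f" and \<theta>: "\<theta> \<ge> 0"
      and H2: "ran_card P A \<le> of_nat n" "ran_error d P A \<le> ennreal e" "e \<ge> 0"
      and n: "n \<ge> 1" "m \<ge> C * n"
    have f: "f i \<in> spaceF P" if "i < m" for i using ex that by (simp add: expansive_def)
    have orth: "normF P (real_comb m f x) = sqrt (sqn m x)" for x using ex by (simp add: expansive_def)
    have expand: "\<theta> * sqn m x \<le> (normG d P (real_comb m f x))\<^sup>2" for x using ex by (simp add: expansive_def)
    have mC: "m \<ge> C" using n by (metis mult.right_neutral mult_le_mono2 order_trans)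
    then have m: "m \<ge> 1" "m \<ge> m0" "real m \<ge> 2 / \<eta>" using C by auto
    have mn: "real m \<ge> 2 / \<eta> * n"
    proof -
      have "2 / \<eta> * n \<le> real C * n" using C(3) by (intro mult_right_mono) auto
      also have "\<dots> \<le> real m" using n(2) by (metis of_nat_mult of_nat_le_iff)
      finally show ?thesis .
    qed
    define s where "s = m / (2 * (1 - \<eta>))"
    define r where "r = \<eta> * m / 2"
    have s: "s > 0" using m \<eta> by (simp add: s_def)
    have r1: "1 \<le> r" using m(3) \<eta> by (simp add: r_def field_simps)
    have sr: "s - r = s * (1 - \<eta> + \<eta>\<^sup>2)"
      using \<eta> by (simp add: s_def r_def field_simps power2_eq_square)
    have rs: "r < s" using sr s den by (metis diff_gt_0_iff_gt mult_pos_pos)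
    have ms: "m / (2 * s) = 1 - \<eta>" using m \<eta> by (simp add: s_def field_simps)
    have tail: "exp (- r) * sqrt (s / (s - r)) ^ m = b ^ m"
    proof -
      have "exp (- r) = exp (- \<eta> / 2) ^ m" by (simp add: r_def exp_of_nat_mult[symmetric] algebra_simps)
      moreover have "s / (s - r) = 1 / (1 - \<eta> + \<eta>\<^sup>2)" using s den by (simp add: sr)
      ultimately show ?thesis by (simp add: b_def power_mult_distrib)
    qed
    have "\<theta> * (m / (2 * s)) \<le> e\<^sup>2 + \<theta> / s * n + \<theta> * (2 * exp (- r) * sqrt (s / (s - r)) ^ m)"
      by (rule average_cost_bound[OF H f \<theta> s expand orth H2 r1 rs]) (use ms \<eta> in auto)
    also have "2 * exp (- r) * sqrt (s / (s - r)) ^ m = 2 * b ^ m" using tail by simp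
    finally have 1: "\<theta> * (1 - \<eta>) \<le> e\<^sup>2 + \<theta> * (n / s) + \<theta> * (2 * b ^ m)" by (simp add: ms)
    have "n / s = 2 * (1 - \<eta>) * (n / m)" using m \<eta> by (simp add: s_def)
    also have "\<dots> \<le> 2 * 1 * (\<eta> / 2)" using mn m \<eta> by (intro mult_mono) (auto simp: field_simps)
    finally have "\<theta> * (n / s) \<le> \<theta> * \<eta>" using \<theta> by (intro mult_left_mono) auto
    moreover have "\<theta> * (2 * b ^ m) \<le> \<theta> * \<eta>" using m0[OF m(2)] \<theta> by (intro mult_left_mono) auto
    ultimately have "\<theta> * (1 - \<eta>) \<le> e\<^sup>2 + \<theta> * \<eta> + \<theta> * \<eta>" using 1 by linarith
    moreover have "\<kappa> * \<theta> = \<theta> * (1 - \<eta>) - \<theta> * \<eta> - \<theta> * \<eta>" by (simp add: \<eta>_def field_simps)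
    ultimately show "\<kappa> * \<theta> \<le> e\<^sup>2" by simp
  qed
qed

section \<open>Singular systems of the embedding\<close>

text \<open>
  Singular vectors of the embedding, characterized without its adjoint: the last condition says that
  the F-orthogonal complement of the system is also G-orthogonal to it.
\<close>
definition singular_system :: "nat \<Rightarrow> approx_problem \<Rightarrow> (nat \<Rightarrow> func) \<Rightarrow> nat \<Rightarrow> bool" where
  "singular_system d P f k \<longleftrightarrow>
     (\<forall>i<k. f i \<in> spaceF P) \<and>
     (\<forall>i<k. \<forall>j<k. innerF P (f i) (f j) = (if i = j then 1 else 0)) \<and>
     (\<forall>i<k. \<forall>j<k. i \<noteq> j \<longrightarrow> innerG d P (f i) (f j) = 0) \<and>
     (\<forall>h\<in>spaceF P. (\<forall>j<k. innerF P h (f j) = 0) \<longrightarrow> (\<forall>i<k. innerG d P h (f i) = 0))"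

locale problem =
  fixes K :: "complex set" and d :: nat and P :: approx_problem
  assumes field: "K = \<real> \<or> K = UNIV" and is_problem: "is_approx_problem K d P"
begin

sublocale F: semi_inner_space K "spaceF P" "innerF P"
  using is_problem by (intro semi_inner_spaceF[OF field])
    (auto simp: is_approx_problem_def separable_hilbert_space_def)

sublocale G: semi_inner_space K "spaceG K d P" "innerG d P"
  by (rule semi_inner_spaceG[OF field])

lemma embedded: "f \<in> spaceF P \<Longrightarrow> f \<in> spaceG K d P"
  using is_problem by (auto simp: is_approx_problem_def compactly_embedded_def)

lemma normF_eq: "normF P f = sqrt (F.sq f)" by (simp add: normF_def F.sq_def)

lemma normG_eq: "normG d P f = sqrt (G.sq f)"
  using normG_square[of d P f] normG_nonneg[of d P f] by (simp add: G.sq_def real_sqrt_unique[symmetric])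

lemma compactness:
  assumes "\<And>n. u n \<in> unit_ballF P"
  obtains g and r :: "nat \<Rightarrow> nat" where "g \<in> spaceG K d P" "strict_mono r" "(\<lambda>n. normG d P (\<lambda>x. u (r n) x - g x)) \<longlonglongrightarrow> 0"
proof -
  have "\<exists>g\<in>spaceG K d P. \<exists>r :: nat \<Rightarrow> nat. strict_mono r \<and>
      (\<lambda>n. normG d P (\<lambda>x. u (r n) x - g x)) \<longlonglongrightarrow> 0"
    using assms is_problem by (simp add: is_approx_problem_def compactly_embedded_def)
  then show thesis using that by blast
qed

lemma completeness:
  fixes u :: "nat \<Rightarrow> func"
  assumes "\<And>n. u n \<in> spaceF P"
    and "\<And>e. e > 0 \<Longrightarrow> \<exists>N. \<forall>m\<ge>N. \<forall>n\<ge>N. normF P (\<lambda>x. u m x - u n x) < e"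
  obtains f where "f \<in> spaceF P" "(\<lambda>n. normF P (\<lambda>x. u n x - f x)) \<longlonglongrightarrow> 0"
proof -
  have "\<exists>f\<in>spaceF P. (\<lambda>n. normF P (\<lambda>x. u n x - f x)) \<longlonglongrightarrow> 0"
    using assms is_problem
    by (simp add: is_approx_problem_def separable_hilbert_space_def completeF_def)
  then show thesis using that by blast
qed

lemma unit_ball_iff: "f \<in> unit_ballF P \<longleftrightarrow> f \<in> spaceF P \<and> F.sq f \<le> 1"
  by (simp add: unit_ballF_def normF_eq)

lemma null_embedding:
  assumes "f \<in> spaceF P" "F.sq f = 0"
  shows "G.sq f = 0"
proof -
  have "innerF P f f = 0" using F.form_self[OF assms(1)] assms(2) by simp
  then have "AE x in weighted_measure d P. f x = 0"
    using is_problem assms(1)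
    unfolding is_approx_problem_def separable_hilbert_space_def inner_product_space_def by blast
  then have "innerG d P f f = 0" unfolding innerG_def by (intro integral_eq_zero_AE) auto
  then show ?thesis by (simp add: G.sq_def)
qed

lemma bound_by_homogeneity:
  assumes W: "W \<subseteq> spaceF P" "linear_space K W"
    and ball: "\<And>f. f \<in> W \<Longrightarrow> F.sq f \<le> 1 \<Longrightarrow> G.sq f \<le> s" and f: "f \<in> W"
  shows "G.sq f \<le> s * F.sq f"
proof (cases "F.sq f = 0")
  case True
  then show ?thesis using null_embedding[of f] f W by auto
next
  case False
  have fF: "f \<in> spaceF P" using f W by auto
  with False have p: "F.sq f > 0" using F.sq_nonneg[of f] by simp
  define c where "c = complex_of_real (1 / sqrt (F.sq f))"
  have c: "c \<in> K" "(cmod c)\<^sup>2 = 1 / F.sq f"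
    using scalar_closed(1)[OF field, of "1 / sqrt (F.sq f)"] p
    by (simp_all only: c_def norm_of_real) (simp add: power_divide)
  have "(\<lambda>x. c * f x) \<in> W" using W(2) c f by (simp add: linear_space_def)
  then have "G.sq (\<lambda>x. c * f x) \<le> s"
    using p by (intro ball) (auto simp: F.sq_scale[OF c(1) fF] c(2))
  then show ?thesis using p by (simp add: G.sq_scale[OF c(1) embedded[OF fF]] c(2) field_simps)
qed

lemma embedding_bounded: "\<exists>C\<ge>0. \<forall>f\<in>spaceF P. G.sq f \<le> C * F.sq f"
proof -
  have "\<exists>C. \<forall>f\<in>unit_ballF P. normG d P f \<le> C"
  proof (rule ccontr)
    assume "\<not> ?thesis"
    then have "\<forall>n. \<exists>f\<in>unit_ballF P. normG d P f > real n" by (meson not_le)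
    then obtain u where u: "\<And>n. u n \<in> unit_ballF P" "\<And>n. normG d P (u n) > real n" by metis
    from compactness[OF u(1)] obtain g r where
      gr: "g \<in> spaceG K d P" "strict_mono r" "(\<lambda>n. normG d P (\<lambda>x. u (r n) x - g x)) \<longlonglongrightarrow> 0" .
    have "eventually (\<lambda>n. normG d P (\<lambda>x. u (r n) x - g x) < 1) sequentially"
      using gr(3) by (intro order_tendstoD(2)) auto
    then obtain N where N: "\<And>n. n \<ge> N \<Longrightarrow> normG d P (\<lambda>x. u (r n) x - g x) < 1"
      by (auto simp: eventually_sequentially)
    define n where "n = max N (nat \<lceil>1 + normG d P g\<rceil>)"
    have "real n \<ge> 1 + normG d P g" by (auto simp: n_def) linarith
    have "u (r n) \<in> spaceG K d P" using u(1) unit_ball_iff embedded by auto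
    moreover have "normG d P (\<lambda>x. u (r n) x - g x) < 1" by (rule N) (simp add: n_def)
    ultimately have "normG d P (u (r n)) \<le> normG d P g + 1"
      using G.norm_triangle_diff[of "u (r n)" g] gr(1) unfolding normG_eq by linarith
    also have "\<dots> \<le> real n" using \<open>real n \<ge> 1 + normG d P g\<close> by linarith
    also have "real n \<le> real (r n)" using seq_suble[OF gr(2)] by simp
    finally show False using u(2)[of "r n"] by simp
  qed
  then obtain C where C: "\<And>f. f \<in> unit_ballF P \<Longrightarrow> normG d P f \<le> C" by blast
  have "G.sq f \<le> C\<^sup>2 * F.sq f" if "f \<in> spaceF P" for f
  proof (rule bound_by_homogeneity[OF subset_refl F.space _ that])
    fix f assume "f \<in> spaceF P" "F.sq f \<le> 1"
    then have "normG d P f \<le> C" by (intro C) (simp add: unit_ball_iff)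
    then have "(normG d P f)\<^sup>2 \<le> C\<^sup>2" by (intro power_mono normG_nonneg)
    then show "G.sq f \<le> C\<^sup>2" by (simp add: normG_square G.sq_def)
  qed
  then show ?thesis by (intro exI[of _ "C\<^sup>2"]) auto
qed

text \<open>
  A maximizing sequence has a subsequence that converges in G by compactness. The parallelogram law
  in G shows that the midpoints are almost maximizing as well, hence have F-norm close to 1, and then
  the parallelogram law in F shows that the subsequence is Cauchy in F.
\<close>
lemma maximizer_exists:
  assumes W: "W \<subseteq> spaceF P" "linear_space K W"
    and closed: "\<forall>u f. (\<forall>n. u n \<in> W) \<longrightarrow> f \<in> spaceF P \<longrightarrow>
      (\<lambda>n. normF P (\<lambda>x. u n x - f x)) \<longlonglongrightarrow> 0 \<longrightarrow> f \<in> W"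
  obtains s where "\<And>h. h \<in> W \<Longrightarrow> G.sq h \<le> s * F.sq h"
    "s \<le> 0 \<or> (\<exists>f\<in>W. F.sq f = 1 \<and> G.sq f = s)"
proof -
  obtain C where C: "C \<ge> 0" "\<And>f. f \<in> spaceF P \<Longrightarrow> G.sq f \<le> C * F.sq f"
    using embedding_bounded by blast
  define S where "S = {G.sq f |f. f \<in> W \<and> F.sq f \<le> 1}"
  define s where "s = Sup S"
  have "(\<lambda>x. 0) \<in> W" using W by (simp add: linear_space_def)
  moreover have "F.sq (\<lambda>x. 0) \<le> 1" by (simp add: F.sq_def F.form_zero[OF F.zero_in])
  ultimately have ne: "S \<noteq> {}" by (auto simp: S_def)
  have bdd: "bdd_above S"
  proof (rule bdd_aboveI)
    fix t assume "t \<in> S"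
    then obtain f where "t = G.sq f" "f \<in> W" "F.sq f \<le> 1" by (auto simp: S_def)
    then show "t \<le> C" using C(2)[of f] W mult_left_mono[of "F.sq f" 1 C] C(1) by auto
  qed
  have up: "G.sq f \<le> s" if "f \<in> W" "F.sq f \<le> 1" for f
    unfolding s_def using that by (intro cSup_upper bdd) (auto simp: S_def)
  have hom: "G.sq h \<le> s * F.sq h" if "h \<in> W" for h
    using bound_by_homogeneity[OF W up that] by blast
  show ?thesis
  proof (rule that[OF hom])
    show "s \<le> 0 \<or> (\<exists>f\<in>W. F.sq f = 1 \<and> G.sq f = s)"
    unfolding disj_imp
    proof (rule impI)
      assume "\<not> s \<le> 0"
      then have s: "s > 0" by simp
      have "\<exists>f\<in>W. F.sq f \<le> 1 \<and> s - inverse (real (Suc n)) < G.sq f" for n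
      proof -
        have "s - inverse (real (Suc n)) < Sup S" by (simp add: s_def)
        then show ?thesis using less_cSup_iff[OF ne bdd] by (auto simp: S_def)
      qed
      then obtain u where u: "\<And>n. u n \<in> W" "\<And>n. F.sq (u n) \<le> 1"
        "\<And>n. s - inverse (real (Suc n)) < G.sq (u n)" by metis
      have uF: "u n \<in> spaceF P" for n using u(1) W by auto
      have "u n \<in> unit_ballF P" for n using uF u(2) by (simp add: unit_ball_iff)
      from compactness[OF this] obtain g r where gr: "g \<in> spaceG K d P" "strict_mono r"
        "(\<lambda>n. normG d P (\<lambda>x. u (r n) x - g x)) \<longlonglongrightarrow> 0" .
      define v where "v = u \<circ> r"
      have v: "\<And>n. v n \<in> W" "\<And>n. F.sq (v n) \<le> 1" "\<And>n. v n \<in> spaceF P" "\<And>n. v n \<in> spaceG K d P"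
        using u uF embedded by (auto simp: v_def)
      have "(\<lambda>n. G.sq (u n)) \<longlonglongrightarrow> s"
      proof (rule tendsto_sandwich)
        show "eventually (\<lambda>n. s - inverse (real (Suc n)) \<le> G.sq (u n)) sequentially"
          using u(3) by (intro always_eventually allI less_imp_le)
        show "eventually (\<lambda>n. G.sq (u n) \<le> s) sequentially"
          using up u by (intro always_eventually) auto
        show "(\<lambda>n. s - inverse (real (Suc n))) \<longlonglongrightarrow> s"
          using tendsto_diff[OF tendsto_const LIMSEQ_inverse_real_of_nat, of s] by simp
      qed simp
      then have Gs: "(\<lambda>n. G.sq (v n)) \<longlonglongrightarrow> s"
        using LIMSEQ_subseq_LIMSEQ[OF _ gr(2)] by (fastforce simp: v_def comp_def)
      define \<delta> where "\<delta> = (\<lambda>n. normG d P (\<lambda>x. v n x - g x))"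
      have \<delta>: "\<delta> \<longlonglongrightarrow> 0" using gr(3) by (simp add: \<delta>_def v_def)
      have \<delta>2: "G.sq (\<lambda>x. v n x - g x) = (\<delta> n)\<^sup>2" for n by (simp add: \<delta>_def normG_square G.sq_def)
      \<comment> \<open>A null sequence that dominates the Cauchy differences in F.\<close>
      define b where "b = (\<lambda>n. (2 * (s - G.sq (v n)) + 2 * (\<delta> n)\<^sup>2) / s)"
      have "b \<longlonglongrightarrow> (2 * (s - s) + 2 * 0\<^sup>2) / s"
        unfolding b_def using s by (intro tendsto_intros Gs \<delta>) auto
      then have b: "b \<longlonglongrightarrow> 0" by simp
      have gap: "F.sq (\<lambda>x. v n x - v k x) \<le> b n + b k" for n k
      proof -
        have "(\<lambda>x. v n x + v k x) \<in> W" using W(2) v by (simp add: linear_space_def)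
        from hom[OF this] have 1: "G.sq (\<lambda>x. v n x + v k x) / s \<le> F.sq (\<lambda>x. v n x + v k x)"
          using s by (simp add: field_simps)
        have "G.sq (\<lambda>x. v n x - v k x) + G.sq (\<lambda>x. (v n x - g x) + (v k x - g x))
            = 2 * (\<delta> n)\<^sup>2 + 2 * (\<delta> k)\<^sup>2"
          using G.parallelogram[of "\<lambda>x. v n x - g x" "\<lambda>x. v k x - g x"] v gr(1)
          by (simp add: G.diff_in \<delta>2)
        moreover have "G.sq (\<lambda>x. (v n x - g x) + (v k x - g x)) \<ge> 0"
          using v gr(1) by (intro G.sq_nonneg G.add_in G.diff_in)
        ultimately have "G.sq (\<lambda>x. v n x - v k x) \<le> 2 * (\<delta> n)\<^sup>2 + 2 * (\<delta> k)\<^sup>2" by linarith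
        then have "2 * G.sq (v n) + 2 * G.sq (v k) - 2 * (\<delta> n)\<^sup>2 - 2 * (\<delta> k)\<^sup>2 \<le> G.sq (\<lambda>x. v n x + v k x)"
          using G.parallelogram[of "v n" "v k"] v by simp
        then have "(2 * G.sq (v n) + 2 * G.sq (v k) - 2 * (\<delta> n)\<^sup>2 - 2 * (\<delta> k)\<^sup>2) / s \<le> F.sq (\<lambda>x. v n x + v k x)"
          using 1 s by (meson divide_right_mono less_imp_le order_trans)
        moreover have "(2 * G.sq (v n) + 2 * G.sq (v k) - 2 * (\<delta> n)\<^sup>2 - 2 * (\<delta> k)\<^sup>2) / s = 4 - b n - b k"
          using s by (simp add: b_def field_simps)
        ultimately show ?thesis
          using F.parallelogram[OF v(3)[of n] v(3)[of k]] v(2)[of n] v(2)[of k] by linarith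
      qed
      have "\<exists>N. \<forall>m\<ge>N. \<forall>n\<ge>N. normF P (\<lambda>x. v m x - v n x) < e" if e: "e > 0" for e
      proof -
        have "eventually (\<lambda>n. b n < e\<^sup>2 / 2) sequentially"
          using b e by (intro order_tendstoD(2)) auto
        then obtain N where N: "\<And>n. n \<ge> N \<Longrightarrow> b n < e\<^sup>2 / 2" by (auto simp: eventually_sequentially)
        have "normF P (\<lambda>x. v m x - v n x) < e" if "m \<ge> N" "n \<ge> N" for m n
        proof -
          have "F.sq (\<lambda>x. v m x - v n x) < e\<^sup>2" using gap[of m n] N[OF that(1)] N[OF that(2)] by linarith
          then show ?thesis using e by (simp add: normF_eq real_less_lsqrt)
        qed
        then show ?thesis by blast
      qed
      from completeness[OF v(3) this] obtain f where
        f: "f \<in> spaceF P" "(\<lambda>n. normF P (\<lambda>x. v n x - f x)) \<longlonglongrightarrow> 0" .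
      have fW: "f \<in> W" using closed v(1) f by blast
      have "(\<lambda>n. normF P (v n) - normF P f) \<longlonglongrightarrow> 0"
        by (rule tendsto_rabs_zero_cancel[OF tendsto_sandwich[OF _ _ tendsto_const f(2)]])
          (use F.norm_triangle_diff[OF v(3) f(1)] in \<open>auto simp: normF_eq\<close>)
      then have "(\<lambda>n. normF P (v n)) \<longlonglongrightarrow> normF P f" by (simp add: LIM_zero_iff)
      then have "normF P f \<le> 1"
        by (rule tendsto_upperbound) (use v(2) in \<open>auto simp: normF_eq\<close>)
      then have f1: "F.sq f \<le> 1" by (simp add: normF_eq)
      have "(\<lambda>n. sqrt C * normF P (\<lambda>x. v n x - f x)) \<longlonglongrightarrow> sqrt C * 0"
        by (intro tendsto_mult_left f(2))
      then have dom: "(\<lambda>n. sqrt C * normF P (\<lambda>x. v n x - f x)) \<longlonglongrightarrow> 0" by simp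
      have "(\<lambda>n. normG d P (v n) - normG d P f) \<longlonglongrightarrow> 0"
      proof (rule tendsto_rabs_zero_cancel[OF tendsto_sandwich[OF _ _ tendsto_const dom]])
        have "\<bar>normG d P (v n) - normG d P f\<bar> \<le> sqrt C * normF P (\<lambda>x. v n x - f x)" for n
        proof -
          have "\<bar>normG d P (v n) - normG d P f\<bar> \<le> sqrt (G.sq (\<lambda>x. v n x - f x))"
            using G.norm_triangle_diff[OF v(4) embedded[OF f(1)]] by (simp add: normG_eq)
          also have "\<dots> \<le> sqrt (C * F.sq (\<lambda>x. v n x - f x))"
            using C(2)[OF F.diff_in[OF v(3) f(1)]] by simp
          finally show ?thesis by (simp add: normF_eq real_sqrt_mult)
        qed
        then show "eventually (\<lambda>n. \<bar>normG d P (v n) - normG d P f\<bar> \<le> sqrt C * normF P (\<lambda>x. v n x - f x)) sequentially"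
          by simp
      qed simp
      then have "(\<lambda>n. normG d P (v n)) \<longlonglongrightarrow> normG d P f" by (simp add: LIM_zero_iff)
      then have "(\<lambda>n. (normG d P (v n))\<^sup>2) \<longlonglongrightarrow> (normG d P f)\<^sup>2" by (rule tendsto_power)
      then have "(\<lambda>n. G.sq (v n)) \<longlonglongrightarrow> G.sq f" by (simp add: normG_square G.sq_def)
      then have fs: "G.sq f = s" using LIMSEQ_unique Gs by blast
      then have "F.sq f \<ge> 1" using hom[OF fW] s by simp
      then show "\<exists>f\<in>W. F.sq f = 1 \<and> G.sq f = s" using f1 fs fW by force
    qed
  qed
qed

text \<open>
  A unit vector \<open>g\<close> that maximizes the G-norm over the complement \<open>W\<close> is a null vector of the
  semidefinite form \<open>s \<langle>\<cdot>, \<cdot>\<rangle>\<^sub>F - \<langle>\<cdot>, \<cdot>\<rangle>\<^sub>G\<close> on \<open>W\<close>, so this form vanishes on all pairs with \<open>g\<close>: what is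
  F-orthogonal to \<open>g\<close> in \<open>W\<close> is also G-orthogonal to \<open>g\<close>.
\<close>
lemma singular_system_extend:
  assumes sys: "singular_system d P f k" and \<theta>: "\<theta> \<ge> 0"
  obtains (exhausted) "\<And>h. h \<in> spaceF P \<Longrightarrow> (\<forall>j<k. innerF P h (f j) = 0) \<Longrightarrow> G.sq h \<le> \<theta> * F.sq h"
    | (extend) g where "singular_system d P (f(k := g)) (Suc k)" "G.sq g > \<theta>"
proof -
  define W where "W = {h \<in> spaceF P. \<forall>j<k. innerF P h (f j) = 0}"
  have fF: "\<And>i. i < k \<Longrightarrow> f i \<in> spaceF P" using sys by (simp add: singular_system_def)
  have W: "W \<subseteq> spaceF P" "linear_space K W"
    unfolding linear_space_def W_def using fF
    by (auto simp: F.zero_in F.form_zero F.add_in F.form_add F.scale_in F.form_scale)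
  have closed: "h \<in> W" if u: "\<forall>n. u n \<in> W" and h: "h \<in> spaceF P"
    and lim: "(\<lambda>n. normF P (\<lambda>x. u n x - h x)) \<longlonglongrightarrow> 0" for u h
  proof -
    have "innerF P h (f j) = 0" if j: "j < k" for j
    proof -
      have "cmod (innerF P h (f j)) \<le> normF P (\<lambda>x. u n x - h x) * normF P (f j)" for n
      proof -
        have uF: "u n \<in> spaceF P" "innerF P (u n) (f j) = 0" using u j by (auto simp: W_def)
        have "cmod (innerF P h (f j)) = cmod (innerF P (\<lambda>x. u n x - h x) (f j))"
          using uF h fF[OF j] by (simp add: F.form_diff)
        also have "\<dots> \<le> sqrt (F.sq (\<lambda>x. u n x - h x) * F.sq (f j))"
          using F.Cauchy_Schwarz[OF F.diff_in[OF uF(1) h] fF[OF j]] by (rule real_le_rsqrt)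
        finally show ?thesis by (simp add: normF_eq real_sqrt_mult)
      qed
      moreover have "(\<lambda>n. normF P (\<lambda>x. u n x - h x) * normF P (f j)) \<longlonglongrightarrow> 0 * normF P (f j)"
        by (intro tendsto_mult_right lim)
      ultimately have "cmod (innerF P h (f j)) \<le> 0 * normF P (f j)"
        by (intro tendsto_lowerbound) auto
      then show ?thesis by simp
    qed
    then show ?thesis using h by (simp add: W_def)
  qed
  obtain s where s: "\<And>h. h \<in> W \<Longrightarrow> G.sq h \<le> s * F.sq h"
    "s \<le> 0 \<or> (\<exists>g\<in>W. F.sq g = 1 \<and> G.sq g = s)"
    by (rule maximizer_exists[OF W]) (use closed in blast, blast)
  show ?thesis
  proof (cases "s \<le> \<theta>")
    case True
    have "G.sq h \<le> \<theta> * F.sq h" if "h \<in> spaceF P" "\<forall>j<k. innerF P h (f j) = 0" for h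
      using s(1)[of h] mult_right_mono[OF True F.sq_nonneg[OF that(1)]] that by (auto simp: W_def)
    then show ?thesis by (rule exhausted)
  next
    case False
    with s(2) \<theta> obtain g where g: "g \<in> W" "F.sq g = 1" "G.sq g = s" by auto
    have gF: "g \<in> spaceF P" "\<And>j. j < k \<Longrightarrow> innerF P g (f j) = 0" using g by (auto simp: W_def)
    have gG: "\<And>i. i < k \<Longrightarrow> innerG d P g (f i) = 0"
      using sys gF by (simp add: singular_system_def)
    interpret D: semi_inner_space K W "\<lambda>a b. of_real s * innerF P a b - innerG d P a b"
    proof
      show "K = \<real> \<or> K = UNIV" by (rule field)
      show "linear_space K W" by (rule W)
    next
      fix a b assume "a \<in> W" "b \<in> W"
      then have ab: "a \<in> spaceF P" "b \<in> spaceF P" using W by auto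
      note abG = ab[THEN embedded]
      show "of_real s * innerF P a b - innerG d P a b \<in> K"
        using scalar_closed[OF field] F.form_scalar[OF ab] G.form_scalar[OF abG] by auto
      show "of_real s * innerF P b a - innerG d P b a = cnj (of_real s * innerF P a b - innerG d P a b)"
        using F.hermitian[OF ab] G.hermitian[OF abG] by simp
      fix c assume "c \<in> W"
      then have c: "c \<in> spaceF P" using W by auto
      show "of_real s * innerF P (\<lambda>x. a x + b x) c - innerG d P (\<lambda>x. a x + b x) c =
        of_real s * innerF P a c - innerG d P a c + (of_real s * innerF P b c - innerG d P b c)"
        using ab abG c embedded[OF c] by (simp add: F.form_add G.form_add algebra_simps)
    next
      fix r a c assume r: "r \<in> K" and "a \<in> W" "c \<in> W"
      then have ac: "a \<in> spaceF P" "c \<in> spaceF P" using W by auto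
      show "of_real s * innerF P (\<lambda>x. r * a x) c - innerG d P (\<lambda>x. r * a x) c =
        r * (of_real s * innerF P a c - innerG d P a c)"
        using r ac ac[THEN embedded] by (simp add: F.form_scale G.form_scale algebra_simps)
    next
      fix a assume "a \<in> W"
      then show "0 \<le> Re (of_real s * innerF P a a - innerG d P a a)"
        using s(1)[of a] by (simp add: F.sq_def G.sq_def)
    qed
    have D0: "D.sq g = 0" using g by (simp add: D.sq_def F.sq_def[symmetric] G.sq_def[symmetric])
    have perp: "innerG d P h g = 0" if "h \<in> W" "innerF P h g = 0" for h
      using D.form_null[OF that(1) g(1) D0] that(2) by simp
    have gg: "innerF P g g = 1" using F.form_self[OF gF(1)] g(2) by simp
    have fg: "innerF P (f j) g = 0" "innerG d P (f j) g = 0" if "j < k" for j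
      using F.hermitian[OF gF(1) fF[OF that]] G.hermitian[OF gF(1)[THEN embedded] fF[OF that, THEN embedded]]
        gF(2)[OF that] gG[OF that] by simp_all
    have "singular_system d P (f(k := g)) (Suc k)"
      unfolding singular_system_def
    proof (intro conjI allI impI ballI)
      fix h i assume h: "h \<in> spaceF P" "\<forall>j<Suc k. innerF P h ((f(k := g)) j) = 0" and i: "i < Suc k"
      have a: "innerF P h (f j) = 0" if "j < k" for j using h(2)[rule_format, of j] that by simp
      have b: "innerF P h g = 0" using h(2)[rule_format, of k] by simp
      show "innerG d P h ((f(k := g)) i) = 0"
        using sys perp[of h] a b h(1) i by (cases "i = k") (auto simp: singular_system_def W_def)
    qed (use sys gF gG gg fg in \<open>auto simp: singular_system_def less_Suc_eq\<close>)
    then show ?thesis using False g(3) by (intro extend) auto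
  qed
qed

lemma singular_value_dichotomy:
  assumes \<theta>: "\<theta> \<ge> 0"
  obtains (large) f where "singular_system d P f m" "\<And>i. i < m \<Longrightarrow> G.sq (f i) > \<theta>"
    | (small) f k where "k < m" "singular_system d P f k" "\<And>i. i < k \<Longrightarrow> G.sq (f i) > \<theta>"
      "\<And>h. h \<in> spaceF P \<Longrightarrow> (\<forall>j<k. innerF P h (f j) = 0) \<Longrightarrow> G.sq h \<le> \<theta> * F.sq h"
proof -
  have "(\<exists>f. singular_system d P f m \<and> (\<forall>i<m. G.sq (f i) > \<theta>)) \<or>
    (\<exists>f k. k < m \<and> singular_system d P f k \<and> (\<forall>i<k. G.sq (f i) > \<theta>) \<and>
      (\<forall>h\<in>spaceF P. (\<forall>j<k. innerF P h (f j) = 0) \<longrightarrow> G.sq h \<le> \<theta> * F.sq h))"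
  proof (induction m)
    case 0
    then show ?case by (simp add: singular_system_def)
  next
    case (Suc m)
    then show ?case
    proof (elim disjE exE conjE)
      fix f assume f: "singular_system d P f m" "\<forall>i<m. G.sq (f i) > \<theta>"
      from f(1) \<theta> show ?thesis
      proof (cases rule: singular_system_extend)
        case exhausted
        then show ?thesis using f by blast
      next
        case (extend g)
        then have "\<forall>i<Suc m. G.sq ((f(m := g)) i) > \<theta>" using f(2) by (auto simp: less_Suc_eq)
        then show ?thesis using extend(1) by blast
      qed
    next
      fix f k assume "k < m" and "singular_system d P f k" and "\<forall>i<k. G.sq (f i) > \<theta>"
        and "\<forall>h\<in>spaceF P. (\<forall>j<k. innerF P h (f j) = 0) \<longrightarrow> G.sq h \<le> \<theta> * F.sq h"
      moreover from \<open>k < m\<close> have "k < Suc m" by simp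
      ultimately show ?thesis by blast
    qed
  qed
  then show thesis using large small by blast
qed

end

section \<open>Random interpolation and stochastic correction of coefficients\<close>

text \<open>
  The determinant of the matrix \<open>(z j i)\<close> by the Leibniz formula; \<open>z j i\<close> will be the value of the \<open>j\<close>-th
  function at the \<open>i\<close>-th point.
\<close>
definition alternant :: "nat \<Rightarrow> (nat \<Rightarrow> nat \<Rightarrow> complex) \<Rightarrow> complex" where
  "alternant m z = (\<Sum>\<pi> | \<pi> permutes {..<m}. of_int (sign \<pi>) * (\<Prod>i<m. z (\<pi> i) i))"

lemma finite_perms: "finite {\<pi>. \<pi> permutes {..<m :: nat}}"
  by (rule finite_permutations) simp

lemma alternant_cofactors:
  assumes "j < m"
  obtains C where "\<And>y. alternant m (z(j := y)) = (\<Sum>i<m. C i * y i)"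
proof -
  define A where "A = (\<lambda>\<pi>. of_int (sign \<pi>) * (\<Prod>i\<in>{..<m} - {inv \<pi> j}. z (\<pi> i) i))"
  define C where "C = (\<lambda>i. \<Sum>\<pi> | \<pi> permutes {..<m} \<and> inv \<pi> j = i. A \<pi>)"
  have "alternant m (z(j := y)) = (\<Sum>i<m. C i * y i)" for y
  proof -
    have t: "of_int (sign \<pi>) * (\<Prod>i<m. (z(j := y)) (\<pi> i) i) = A \<pi> * y (inv \<pi> j)" if p: "\<pi> permutes {..<m}" for \<pi>
    proof -
      have k: "inv \<pi> j \<in> {..<m}" using p assms permutes_in_image[OF permutes_inv[OF p], of j] by simp
      have pk: "\<pi> (inv \<pi> j) = j" using p by (simp add: permutes_inverses)
      have "(\<Prod>i\<in>{..<m} - {inv \<pi> j}. (z(j := y)) (\<pi> i) i) = (\<Prod>i\<in>{..<m} - {inv \<pi> j}. z (\<pi> i) i)"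
        using permutes_inverses(2)[OF p] by (intro prod.cong) auto
      then show ?thesis
        using prod.remove[OF _ k, of "\<lambda>i. (z(j := y)) (\<pi> i) i"] pk by (simp add: A_def)
    qed
    have "alternant m (z(j := y)) = (\<Sum>\<pi> | \<pi> permutes {..<m}. A \<pi> * y (inv \<pi> j))"
      unfolding alternant_def by (intro sum.cong refl) (use t in simp)
    also have "\<dots> = (\<Sum>i<m. \<Sum>\<pi> | \<pi> permutes {..<m} \<and> inv \<pi> j = i. A \<pi> * y (inv \<pi> j))"
    proof -
      have "(\<lambda>\<pi>. inv \<pi> j) ` {\<pi>. \<pi> permutes {..<m}} \<subseteq> {..<m}"
        using permutes_in_image[OF permutes_inv, of _ "{..<m}" j] assms by auto
      from sum.group[OF finite_perms _ this, of "\<lambda>\<pi>. A \<pi> * y (inv \<pi> j)"] show ?thesis by simp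
    qed
    also have "\<dots> = (\<Sum>i<m. C i * y i)"
      unfolding C_def sum_distrib_right by (intro sum.cong refl) auto
    finally show ?thesis .
  qed
  then show ?thesis by (rule that)
qed

lemma alternant_repeated:
  assumes "j < m" "l < m" "j \<noteq> l" "z j = z l"
  shows "alternant m z = 0"
proof -
  let ?\<tau> = "Transposition.transpose j l"
  have \<tau>: "?\<tau> permutes {..<m}" using assms by (intro permutes_swap_id) auto
  have "z (?\<tau> a) i = z a i" for a i using assms(4) by (auto simp: Transposition.transpose_def)
  moreover have "sign (?\<tau> \<circ> \<pi>) = - sign \<pi>" if "\<pi> permutes {..<m}" for \<pi>
    using that \<tau> assms(3) by (subst sign_compose) (auto simp: sign_swap_id intro: permutation_permutes[THEN iffD2])
  ultimately have "alternant m z = - alternant m z"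
    unfolding alternant_def by (subst setum_permutations_compose_left[OF \<tau>]) (simp add: sum_negf)
  then show ?thesis by simp
qed

text \<open>
  Cramer's rule: if data \<open>y\<close> are a combination of the rows plus a perturbation \<open>g\<close>, replacing the
  \<open>j\<close>-th row by \<open>y\<close> recovers the \<open>j\<close>-th coefficient up to the determinant with \<open>g\<close> in that row.
\<close>
lemma alternant_expand:
  assumes "j < m"
  shows "alternant m (z(j := \<lambda>i. (\<Sum>l<m. b l * z l i) + g i)) = b j * alternant m z + alternant m (z(j := g))"
proof -
  obtain C where C: "\<And>y. alternant m (z(j := y)) = (\<Sum>i<m. C i * y i)"
    using alternant_cofactors[OF assms] by blast
  have l: "alternant m (z(j := z l)) = (if l = j then alternant m z else 0)" if "l < m" for l
    using alternant_repeated[of j m l "z(j := z l)"] assms that by auto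
  have "alternant m (z(j := \<lambda>i. (\<Sum>l<m. b l * z l i) + g i))
      = (\<Sum>i<m. \<Sum>l<m. b l * (C i * z l i)) + (\<Sum>i<m. C i * g i)"
    unfolding C by (simp add: distrib_left sum.distrib sum_distrib_left ac_simps)
  also have "(\<Sum>i<m. \<Sum>l<m. b l * (C i * z l i)) = (\<Sum>l<m. b l * alternant m (z(j := z l)))"
    unfolding C by (subst sum.swap) (simp add: sum_distrib_left)
  also have "\<dots> = (\<Sum>l<m. b l * (if l = j then alternant m z else 0))"
    using l by (intro sum.cong refl) auto
  also have "\<dots> = b j * alternant m z"
    using assms by (simp add: if_distrib cong: if_cong)
  finally show ?thesis unfolding C .
qed

lemma alternant_scalar:
  assumes "K = \<real> \<or> K = UNIV" "\<And>j i. j < m \<Longrightarrow> i < m \<Longrightarrow> z j i \<in> K"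
  shows "alternant m z \<in> K"
proof -
  have "of_int k \<in> K" for k using scalar_closed(1)[OF assms(1), of "of_int k"] by simp
  then show ?thesis unfolding alternant_def
    by (intro scalar_closed(8,10,11)[OF assms(1)] assms(2))
      (auto simp: permutes_in_image[of _ "{..<m}", unfolded lessThan_iff])
qed

lemma alternant_measurable [measurable (raw)]:
  assumes "\<And>j i. j < m \<Longrightarrow> i < m \<Longrightarrow> (\<lambda>w. z w j i) \<in> borel_measurable N"
  shows "(\<lambda>w. alternant m (z w)) \<in> borel_measurable N"
  unfolding alternant_def
  by (intro borel_measurable_sum borel_measurable_times borel_measurable_prod assms measurable_const)
     (auto simp: permutes_in_image[of _ "{..<m}", unfolded lessThan_iff])

lemma alternant_cong:
  "(\<And>j i. j < m \<Longrightarrow> i < m \<Longrightarrow> z j i = z' j i) \<Longrightarrow> alternant m z = alternant m z'"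
  unfolding alternant_def
  by (intro sum.cong refl arg_cong2[where f = "(*)"] prod.cong)
     (auto simp: permutes_in_image[of _ "{..<m}", unfolded lessThan_iff])

context problem
begin

abbreviation \<mu> where "\<mu> \<equiv> weighted_measure d P"

sublocale M: prob_space \<mu>
  using is_problem by (intro prob_space_weighted_measure) (auto simp: is_approx_problem_def)

sublocale MP: product_sigma_finite "\<lambda>_ :: nat. \<mu>" by standard

lemma space_\<mu>: "space \<mu> = domain P"
  using is_problem by (intro space_weighted_measure) (auto simp: is_approx_problem_def)

lemma spaceG_measurable: "f \<in> spaceG K d P \<Longrightarrow> f \<in> borel_measurable \<mu>"
  by (simp add: spaceG_def)

lemma spaceG_scalar: "f \<in> spaceG K d P \<Longrightarrow> f x \<in> K"
  by (simp add: spaceG_def)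

lemma nn_integral_square:
  assumes "f \<in> spaceG K d P"
  shows "(\<integral>\<^sup>+x. ennreal ((cmod (f x))\<^sup>2) \<partial>\<mu>) = ennreal (G.sq f)"
proof -
  have "(\<integral>\<^sup>+x. ennreal ((cmod (f x))\<^sup>2) \<partial>\<mu>) = ennreal (\<integral>x. (cmod (f x))\<^sup>2 \<partial>\<mu>)"
    using assms by (intro nn_integral_eq_integral) (auto simp: spaceG_def)
  also have "(\<integral>x. (cmod (f x))\<^sup>2 \<partial>\<mu>) = (normG d P f)\<^sup>2" by (simp add: normG_def)
  finally show ?thesis by (simp add: normG_square G.sq_def)
qed

text \<open>
  The squared determinant is a double sum over permutations. By independence of the points the
  integral of each term is a product of inner products, which vanishes unless the two permutations
  agree; \<open>m!\<close> equal terms remain.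
\<close>
lemma alternant_second_moment:
  assumes h: "\<And>j. j < m \<Longrightarrow> h j \<in> spaceG K d P"
    and orth: "\<And>i j. i < m \<Longrightarrow> j < m \<Longrightarrow> i \<noteq> j \<Longrightarrow> innerG d P (h i) (h j) = 0"
  shows "(\<integral>\<^sup>+x. ennreal ((cmod (alternant m (\<lambda>j i. h j (x i))))\<^sup>2) \<partial>(\<Pi>\<^sub>M i\<in>{..<m}. \<mu>))
    = ennreal (fact m * (\<Prod>j<m. G.sq (h j)))"
proof -
  let ?S = "{\<pi>. \<pi> permutes {..<m}}"
  let ?N = "\<Pi>\<^sub>M i\<in>{..<m}. \<mu>"
  define t where "t = (\<lambda>\<pi> \<sigma> x. \<Prod>i<m. h (\<pi> i) (x i) * cnj (h (\<sigma> i) (x i)))"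
  have hp: "h (\<pi> i) \<in> spaceG K d P" if "\<pi> \<in> ?S" "i < m" for \<pi> i
    using that h[of "\<pi> i"] permutes_in_image[of \<pi> "{..<m}" i] by auto
  have t_int: "integrable ?N (t \<pi> \<sigma>)" if "\<pi> \<in> ?S" "\<sigma> \<in> ?S" for \<pi> \<sigma>
    unfolding t_def using that
    by (intro MP.product_integrable_prod[where f = "\<lambda>i y. h (\<pi> i) y * cnj (h (\<sigma> i) y)"]
        integrable_product_spaceG[where K = K] hp) auto
  have t_val: "(\<integral>x. t \<pi> \<sigma> x \<partial>?N) = (if \<pi> = \<sigma> then of_real (\<Prod>j<m. G.sq (h j)) else 0)"
    if \<pi>: "\<pi> \<in> ?S" and \<sigma>: "\<sigma> \<in> ?S" for \<pi> \<sigma>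
  proof -
    have "(\<integral>x. t \<pi> \<sigma> x \<partial>?N) = (\<Prod>i<m. innerG d P (h (\<pi> i)) (h (\<sigma> i)))"
      unfolding t_def innerG_def using that
      by (intro MP.product_integral_prod[where f = "\<lambda>i y. h (\<pi> i) y * cnj (h (\<sigma> i) y)"]
          integrable_product_spaceG[where K = K] hp) auto
    also have "\<dots> = (if \<pi> = \<sigma> then of_real (\<Prod>j<m. G.sq (h j)) else 0)"
    proof (cases "\<pi> = \<sigma>")
      case True
      have "(\<Prod>i<m. innerG d P (h (\<pi> i)) (h (\<pi> i))) = (\<Prod>i<m. of_real (G.sq (h (\<pi> i))))"
        using hp[OF \<pi>] by (intro prod.cong refl) (simp add: G.form_self)
      also have "\<dots> = (\<Prod>j<m. of_real (G.sq (h j)))"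
        using prod.permute[of \<pi> "{..<m}" "\<lambda>j. complex_of_real (G.sq (h j))"] \<pi> by (simp add: comp_def)
      finally show ?thesis using True by simp
    next
      case False
      then obtain i where i: "\<pi> i \<noteq> \<sigma> i" by blast
      then have "i < m" using \<pi> \<sigma> by (metis mem_Collect_eq permutes_not_in lessThan_iff)
      moreover have "\<pi> i < m" "\<sigma> i < m"
        using \<open>i < m\<close> \<pi> \<sigma> permutes_in_image[of \<pi> "{..<m}" i] permutes_in_image[of \<sigma> "{..<m}" i]
        by simp_all
      ultimately show ?thesis using False i orth by (intro trans[OF prod_zero]) auto
    qed
    finally show ?thesis .
  qed
  have sq: "of_real ((cmod (alternant m (\<lambda>j i. h j (x i))))\<^sup>2)
     = (\<Sum>\<pi>\<in>?S. \<Sum>\<sigma>\<in>?S. of_int (sign \<pi>) * of_int (sign \<sigma>) * t \<pi> \<sigma> x)" for x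
    unfolding complex_norm_square alternant_def cnj_sum sum_product
    by (intro sum.cong refl) (simp add: t_def prod.distrib ac_simps)
  have "integrable ?N (\<lambda>x. complex_of_real ((cmod (alternant m (\<lambda>j i. h j (x i))))\<^sup>2))"
    unfolding sq using t_int by (intro Bochner_Integration.integrable_sum integrable_mult_right) auto
  then have int: "integrable ?N (\<lambda>x. (cmod (alternant m (\<lambda>j i. h j (x i))))\<^sup>2)"
    by (simp only: complex_of_real_integrable_eq)
  have "complex_of_real (\<integral>x. (cmod (alternant m (\<lambda>j i. h j (x i))))\<^sup>2 \<partial>?N)
     = (\<integral>x. (\<Sum>\<pi>\<in>?S. \<Sum>\<sigma>\<in>?S. of_int (sign \<pi>) * of_int (sign \<sigma>) * t \<pi> \<sigma> x) \<partial>?N)"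
    unfolding sq[symmetric] by (rule integral_complex_of_real[symmetric])
  also have "\<dots> = (\<Sum>\<pi>\<in>?S. \<integral>x. (\<Sum>\<sigma>\<in>?S. of_int (sign \<pi>) * of_int (sign \<sigma>) * t \<pi> \<sigma> x) \<partial>?N)"
    by (rule Bochner_Integration.integral_sum)
      (intro Bochner_Integration.integrable_sum integrable_mult_right t_int)
  also have "\<dots> = (\<Sum>\<pi>\<in>?S. \<Sum>\<sigma>\<in>?S. \<integral>x. of_int (sign \<pi>) * of_int (sign \<sigma>) * t \<pi> \<sigma> x \<partial>?N)"
    by (intro sum.cong refl Bochner_Integration.integral_sum integrable_mult_right t_int)
  also have "\<dots> = (\<Sum>\<pi>\<in>?S. \<Sum>\<sigma>\<in>?S. of_int (sign \<pi>) * of_int (sign \<sigma>) * (\<integral>x. t \<pi> \<sigma> x \<partial>?N))"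
    by (simp only: integral_mult_right_zero)
  also have "\<dots> = (\<Sum>\<pi>\<in>?S. \<Sum>\<sigma>\<in>?S. if \<pi> = \<sigma> then of_real (\<Prod>j<m. G.sq (h j)) else 0)"
  proof (intro sum.cong refl)
    fix \<pi> \<sigma> assume "\<pi> \<in> ?S" "\<sigma> \<in> ?S"
    moreover have "of_int (sign \<pi>) * of_int (sign \<pi>) = (1 :: complex)"
      by (simp flip: of_int_mult)
    ultimately show "of_int (sign \<pi>) * of_int (sign \<sigma>) * (\<integral>x. t \<pi> \<sigma> x \<partial>?N)
       = (if \<pi> = \<sigma> then of_real (\<Prod>j<m. G.sq (h j)) else 0)"
      by (cases "\<pi> = \<sigma>") (simp_all add: t_val)
  qed
  also have "\<dots> = of_nat (card ?S) * of_real (\<Prod>j<m. G.sq (h j))"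
    using finite_perms by simp
  also have "card ?S = fact m" by (intro card_permutations) auto
  finally have "complex_of_real (\<integral>x. (cmod (alternant m (\<lambda>j i. h j (x i))))\<^sup>2 \<partial>?N)
     = complex_of_real (fact m * (\<Prod>j<m. G.sq (h j)))" by simp
  then have "(\<integral>x. (cmod (alternant m (\<lambda>j i. h j (x i))))\<^sup>2 \<partial>?N) = fact m * (\<Prod>j<m. G.sq (h j))"
    by (simp only: of_real_eq_iff)
  then show ?thesis using int by (subst nn_integral_eq_integral) auto
qed

end

locale sampling = problem +
  fixes e :: "nat \<Rightarrow> func" and m :: nat and \<gamma> :: real
  assumes m: "m \<ge> 1"
    and e_in: "j < m \<Longrightarrow> e j \<in> spaceG K d P"
    and e_orth: "i < m \<Longrightarrow> j < m \<Longrightarrow> innerG d P (e i) (e j) = (if i = j then 1 else 0)"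
begin

definition leverage :: "point \<Rightarrow> real" where
  "leverage x = (\<Sum>j<m. (cmod (e j x))\<^sup>2) / m"

definition basis_det :: "(nat \<Rightarrow> point) \<Rightarrow> complex" where
  "basis_det x = alternant m (\<lambda>l i. e l (x i))"

text \<open>
  Step 0 interpolates the values \<open>y\<close> at the first \<open>m\<close> points by Cramer's rule. Step \<open>t\<close> uses the value
  at the \<open>(m + t)\<close>-th point for a gradient step of size \<open>\<gamma>\<close>; division by the sampling density makes the
  step an unbiased estimate of \<open>\<gamma>\<close> times the coefficient error.
\<close>
primrec coeffs :: "(nat \<Rightarrow> point) \<Rightarrow> (nat \<Rightarrow> complex) \<Rightarrow> nat \<Rightarrow> nat \<Rightarrow> complex" where
  "coeffs x y 0 = (\<lambda>j. alternant m ((\<lambda>l i. e l (x i))(j := y)) / basis_det x)"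
| "coeffs x y (Suc t) = (\<lambda>j. coeffs x y t j
     + of_real \<gamma> * (y (m + t) - lin_comb m e (coeffs x y t) (x (m + t)))
         * cnj (e j (x (m + t))) / of_real (leverage (x (m + t))))"

text \<open>
  The density of the sample points: determinantal for the first \<open>m\<close> points, independent
  with density \<open>leverage\<close> for the others.
\<close>
definition sample_density :: "nat \<Rightarrow> (nat \<Rightarrow> point) \<Rightarrow> real" where
  "sample_density t x = (cmod (basis_det x))\<^sup>2 / fact m * (\<Prod>i<t. leverage (x (m + i)))"

abbreviation points :: "nat \<Rightarrow> (nat \<Rightarrow> point) measure" where
  "points n \<equiv> \<Pi>\<^sub>M i\<in>{..<n}. \<mu>"

lemma sq_e: "j < m \<Longrightarrow> G.sq (e j) = 1"
  by (simp add: G.sq_def e_orth)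

lemma leverage_nonneg: "leverage x \<ge> 0"
  by (simp add: leverage_def sum_nonneg)

lemma e_measurable: "j < m \<Longrightarrow> e j \<in> borel_measurable \<mu>"
  by (intro spaceG_measurable e_in)

lemma leverage_measurable [measurable]: "leverage \<in> borel_measurable \<mu>"
  unfolding leverage_def[abs_def]
  by (intro borel_measurable_divide borel_measurable_sum borel_measurable_power
      measurable_const measurable_compose[OF e_measurable borel_measurable_norm]) auto

lemma leverage_integral: "(\<integral>\<^sup>+x. ennreal (leverage x) \<partial>\<mu>) = 1"
proof -
  have sq_meas: "(\<lambda>x. ennreal ((cmod (e j x))\<^sup>2)) \<in> borel_measurable \<mu>" if "j \<in> {..<m}" for j
    using e_measurable[of j] that by simp
  have "(\<integral>\<^sup>+x. ennreal (leverage x) \<partial>\<mu>)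
      = (\<integral>\<^sup>+x. ennreal (1 / m) * (\<Sum>j<m. ennreal ((cmod (e j x))\<^sup>2)) \<partial>\<mu>)"
    by (simp add: leverage_def ennreal_mult[symmetric] sum_nonneg)
  also have "\<dots> = ennreal (1 / m) * (\<integral>\<^sup>+x. (\<Sum>j<m. ennreal ((cmod (e j x))\<^sup>2)) \<partial>\<mu>)"
    by (intro nn_integral_cmult borel_measurable_sum sq_meas)
  also have "\<dots> = ennreal (1 / m) * (\<Sum>j<m. \<integral>\<^sup>+x. ennreal ((cmod (e j x))\<^sup>2) \<partial>\<mu>)"
    by (subst nn_integral_sum[OF sq_meas]) auto
  also have "\<dots> = ennreal (1 / m) * ennreal m"
    using e_in sq_e by (simp add: nn_integral_square ennreal_of_nat_eq_real_of_nat)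
  also have "\<dots> = 1" using m by (simp add: ennreal_mult[symmetric])
  finally show ?thesis .
qed

lemma coeffs_scalar:
  assumes "\<And>i. i < m + t \<Longrightarrow> y i \<in> K" "j < m"
  shows "coeffs x y t j \<in> K"
  using assms
proof (induction t arbitrary: j)
  case 0
  have e: "e l z \<in> K" if "l < m" for l z using that by (intro spaceG_scalar e_in)
  show ?case unfolding coeffs.simps basis_det_def
    by (intro scalar_closed(9)[OF field] alternant_scalar[OF field]) (use 0 e in auto)
next
  case (Suc t)
  have e: "e l z \<in> K" if "l < m" for l z using that by (intro spaceG_scalar e_in)
  have c: "coeffs x y t l \<in> K" if "l < m" for l using Suc that by simp
  have l: "lin_comb m e (coeffs x y t) z \<in> K" for z
    unfolding lin_comb_def by (intro scalar_closed(8,10)[OF field] c e) auto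
  show ?case unfolding coeffs.simps
    by (intro scalar_closed(4,5,7,8,9)[OF field] scalar_closed(1)[OF field] c e l Suc.prems) auto
qed


lemma leverage_null:
  assumes "leverage x = 0" "j < m"
  shows "e j x = 0"
  using assms m by (simp add: leverage_def sum_nonneg_eq_0_iff)

lemma coeffs_local:
  assumes "\<And>i. i < m + t \<Longrightarrow> x i = x' i" "\<And>i. i < m + t \<Longrightarrow> y i = y' i" "j < m"
  shows "coeffs x y t j = coeffs x' y' t j"
  using assms
proof (induction t arbitrary: j)
  case 0
  then show ?case unfolding coeffs.simps basis_det_def
    by (intro arg_cong2[where f = "(/)"] alternant_cong) auto
next
  case (Suc t)
  have "coeffs x y t l = coeffs x' y' t l" if "l < m" for l using Suc that by simp
  then have "lin_comb m e (coeffs x y t) = lin_comb m e (coeffs x' y' t)" "coeffs x y t j = coeffs x' y' t j"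
    using Suc.prems(3) by (auto simp: lin_comb_def)
  then show ?case using Suc.prems by simp
qed

lemma coeffs_measurable:
  assumes X: "\<And>i. i < m + t \<Longrightarrow> X i \<in> measurable N \<mu>"
    and Y: "\<And>i. i < m + t \<Longrightarrow> Y i \<in> borel_measurable N" and "j < m"
  shows "(\<lambda>w. coeffs (\<lambda>i. X i w) (\<lambda>i. Y i w) t j) \<in> borel_measurable N"
  using assms
proof (induction t arbitrary: j)
  case 0
  have e: "(\<lambda>w. e l (X i w)) \<in> borel_measurable N" if "l < m" "i < m" for l i
    using that 0 by (intro measurable_compose[OF _ e_measurable]) auto
  have z: "(\<lambda>w. ((\<lambda>l i. e l (X i w))(j := \<lambda>i. Y i w)) l i) \<in> borel_measurable N" if "l < m" "i < m" for l i
    using e[OF that] 0(2)[of i] that by (cases "l = j") auto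
  show ?case unfolding coeffs.simps basis_det_def
    by (intro borel_measurable_divide alternant_measurable z e)
next
  case (Suc t)
  have X: "X (m + t) \<in> measurable N \<mu>" using Suc.prems by simp
  have e: "(\<lambda>w. e l (X (m + t) w)) \<in> borel_measurable N" if "l < m" for l
    by (rule measurable_compose[OF X e_measurable[OF that]])
  have c: "(\<lambda>w. coeffs (\<lambda>i. X i w) (\<lambda>i. Y i w) t l) \<in> borel_measurable N" if "l < m" for l
    using Suc that by simp
  have u: "(\<lambda>w. leverage (X (m + t) w)) \<in> borel_measurable N"
    by (rule measurable_compose[OF X leverage_measurable])
  have uc: "(\<lambda>w. complex_of_real (leverage (X (m + t) w))) \<in> borel_measurable N"
    using u by measurable
  have l: "(\<lambda>w. lin_comb m e (coeffs (\<lambda>i. X i w) (\<lambda>i. Y i w) t) (X (m + t) w)) \<in> borel_measurable N"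
    unfolding lin_comb_def by (intro borel_measurable_sum borel_measurable_times c e) auto
  show ?case unfolding coeffs.simps
    by (intro borel_measurable_add borel_measurable_divide borel_measurable_times borel_measurable_diff
        borel_measurable_cnj measurable_const uc l e c Suc.prems) auto
qed

lemma basis_det_measurable:
  assumes "\<And>i. i < m \<Longrightarrow> X i \<in> measurable N \<mu>"
  shows "(\<lambda>w. basis_det (\<lambda>i. X i w)) \<in> borel_measurable N"
  unfolding basis_det_def
  by (intro alternant_measurable measurable_compose[OF assms e_measurable])

lemma sample_density_measurable:
  assumes "\<And>i. i < m + t \<Longrightarrow> X i \<in> measurable N \<mu>"
  shows "(\<lambda>w. sample_density t (\<lambda>i. X i w)) \<in> borel_measurable N"
  unfolding sample_density_def
  by (intro borel_measurable_times borel_measurable_divide borel_measurable_power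
      borel_measurable_prod measurable_const measurable_compose[OF basis_det_measurable borel_measurable_norm]
      measurable_compose[OF assms leverage_measurable] assms) auto

lemma component_measurable: "i < n \<Longrightarrow> (\<lambda>x. x i) \<in> measurable (points n) \<mu>"
  by (rule measurable_component_singleton) simp

lemma sample_density_nonneg: "sample_density t x \<ge> 0"
  by (simp add: sample_density_def leverage_nonneg prod_nonneg)

lemma sample_density_Suc: "sample_density (Suc t) x = sample_density t x * leverage (x (m + t))"
  by (simp add: sample_density_def)

lemma basis_det_local: "(\<And>i. i < m \<Longrightarrow> x i = x' i) \<Longrightarrow> basis_det x = basis_det x'"
  unfolding basis_det_def by (intro alternant_cong) auto

lemma sample_density_local:
  assumes "\<And>i. i < m + t \<Longrightarrow> x i = x' i"
  shows "sample_density t x = sample_density t x'"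
  using assms basis_det_local[of x x'] by (simp add: sample_density_def)

lemma nn_integral_points_Suc:
  assumes "h \<in> borel_measurable (points (m + Suc t))"
  shows "(\<integral>\<^sup>+x. h x \<partial>points (m + Suc t)) = (\<integral>\<^sup>+x. \<integral>\<^sup>+z. h (x(m + t := z)) \<partial>\<mu> \<partial>points (m + t))"
proof -
  have i: "{..<m + Suc t} = insert (m + t) {..<m + t}" by auto
  show ?thesis using assms unfolding i by (intro MP.product_nn_integral_insert) auto
qed

lemma sample_density_integral: "(\<integral>\<^sup>+x. ennreal (sample_density t x) \<partial>points (m + t)) = 1"
proof (induction t)
  case 0
  have "(\<integral>\<^sup>+x. ennreal (sample_density 0 x) \<partial>points m)
      = (\<integral>\<^sup>+x. ennreal (1 / fact m) * ennreal ((cmod (basis_det x))\<^sup>2) \<partial>points m)"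
    by (simp add: sample_density_def ennreal_mult[symmetric])
  also have "\<dots> = ennreal (1 / fact m) * (\<integral>\<^sup>+x. ennreal ((cmod (basis_det x))\<^sup>2) \<partial>points m)"
    by (intro nn_integral_cmult measurable_compose[OF _ measurable_ennreal] borel_measurable_power
        measurable_compose[OF basis_det_measurable borel_measurable_norm] component_measurable) auto
  also have "\<dots> = ennreal (1 / fact m) * ennreal (fact m)"
    unfolding basis_det_def by (subst alternant_second_moment) (use e_in e_orth sq_e in auto)
  also have "\<dots> = 1" by (simp add: ennreal_mult[symmetric])
  finally show ?case by simp
next
  case (Suc t)
  have "(\<integral>\<^sup>+x. ennreal (sample_density (Suc t) x) \<partial>points (m + Suc t))
      = (\<integral>\<^sup>+x. \<integral>\<^sup>+z. ennreal (sample_density (Suc t) (x(m + t := z))) \<partial>\<mu> \<partial>points (m + t))"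
    by (intro nn_integral_points_Suc measurable_compose[OF _ measurable_ennreal]
        sample_density_measurable component_measurable) auto
  also have "\<dots> = (\<integral>\<^sup>+x. ennreal (sample_density t x) * (\<integral>\<^sup>+z. ennreal (leverage z) \<partial>\<mu>) \<partial>points (m + t))"
  proof (rule nn_integral_cong)
    fix x
    have "sample_density t (x(m + t := z)) = sample_density t x" for z
      by (rule sample_density_local) auto
    then show "(\<integral>\<^sup>+z. ennreal (sample_density (Suc t) (x(m + t := z))) \<partial>\<mu>)
        = ennreal (sample_density t x) * (\<integral>\<^sup>+z. ennreal (leverage z) \<partial>\<mu>)"
      by (simp add: sample_density_Suc ennreal_mult sample_density_nonneg leverage_nonneg nn_integral_cmult)
  qed
  also have "\<dots> = 1" using Suc by (simp add: leverage_integral)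
  finally show ?case .
qed

text \<open>
  Let \<open>b\<close> be the current error of the coefficients. Where the leverage \<open>u\<close> does not vanish, expanding
  the square turns the integrand into
  \<open>q = u \<beta> - 2 \<gamma> Re (r w\<^sup>*) + \<gamma>\<^sup>2 m \<bar>r\<bar>\<^sup>2\<close> with \<open>w\<close> the combination of the \<open>e j\<close> with coefficients \<open>b\<close>,
  because \<open>\<Sum> \<bar>e_j\<bar>\<^sup>2 = m u\<close>; where it vanishes, all \<open>e j\<close> vanish. Orthogonality of \<open>g\<close> gives
  \<open>\<integral> r w\<^sup>* = \<beta>\<close> and \<open>\<integral> \<bar>r\<bar>\<^sup>2 = \<beta> + \<parallel>g\<parallel>\<^sup>2\<close>.
\<close>
lemma expected_update:
  assumes g: "g \<in> spaceG K d P" "\<And>j. j < m \<Longrightarrow> innerG d P (e j) g = 0"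
    and b: "\<And>j. j < m \<Longrightarrow> b j \<in> K" and \<gamma>: "\<gamma> \<ge> 0"
  defines "r \<equiv> \<lambda>z. g z + lin_comb m e b z" and "\<beta> \<equiv> \<Sum>j<m. (cmod (b j))\<^sup>2"
  shows "(\<integral>\<^sup>+z. ennreal (leverage z * (\<Sum>j<m. (cmod (b j - of_real \<gamma> * r z * cnj (e j z) / of_real (leverage z)))\<^sup>2)) \<partial>\<mu>)
      \<le> ennreal ((1 - 2 * \<gamma> + \<gamma>\<^sup>2 * m) * \<beta> + \<gamma>\<^sup>2 * m * G.sq g)"
proof -
  define w where "w = lin_comb m e b"
  have wG: "w \<in> spaceG K d P" unfolding w_def using e_in b by (intro G.lin_comb_in)
  have rG: "r \<in> spaceG K d P" unfolding r_def w_def[symmetric] using g(1) wG by (intro G.add_in)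
  have sqw: "G.sq w = \<beta>"
    unfolding w_def \<beta>_def using e_in b e_orth by (subst G.sq_lin_comb_orthogonal) (auto simp: sq_e)
  have sqr: "G.sq r = G.sq g + \<beta>"
    unfolding r_def sqw[symmetric] w_def using e_in b g by (intro G.sq_add_perp)
  have "innerG d P w g = 0" unfolding w_def using e_in b g by (subst G.form_lin_comb) auto
  then have "innerG d P g w = 0" using G.hermitian[OF wG g(1)] by simp
  then have rw: "Re (innerG d P r w) = \<beta>"
    using G.form_add[OF g(1) wG wG] by (simp add: r_def w_def[symmetric] G.sq_def[symmetric] sqw)
  define q where "q = (\<lambda>z. leverage z * \<beta> - 2 * \<gamma> * Re (r z * cnj (w z)) + \<gamma>\<^sup>2 * m * (cmod (r z))\<^sup>2)"
  have le: "leverage z * (\<Sum>j<m. (cmod (b j - of_real \<gamma> * r z * cnj (e j z) / of_real (leverage z)))\<^sup>2) \<le> q z"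
    and q0: "q z \<ge> 0" for z
  proof -
    have sume: "(\<Sum>j<m. (cmod (e j z))\<^sup>2) = m * leverage z" using m by (simp add: leverage_def)
    have eq: "leverage z * (\<Sum>j<m. (cmod (b j - of_real \<gamma> * r z * cnj (e j z) / of_real (leverage z)))\<^sup>2) = q z"
      if u: "leverage z \<noteq> 0"
    proof -
      have one: "leverage z * (cmod (b j - of_real \<gamma> * r z * cnj (e j z) / of_real (leverage z)))\<^sup>2
         = leverage z * (cmod (b j))\<^sup>2 - 2 * \<gamma> * Re (r z * cnj (b j * e j z))
           + \<gamma>\<^sup>2 * (cmod (r z))\<^sup>2 * (cmod (e j z))\<^sup>2 / leverage z" for j
      proof -
        define c where "c = r z * cnj (e j z)"
        have "(cmod (b j - of_real (\<gamma> / leverage z) * c))\<^sup>2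
            = (cmod (b j))\<^sup>2 - 2 * (\<gamma> / leverage z) * Re (c * cnj (b j)) + (\<gamma> / leverage z)\<^sup>2 * (cmod c)\<^sup>2"
          unfolding cmod_power2 by (simp add: power2_eq_square algebra_simps add_divide_distrib)
        then have F: "leverage z * (cmod (b j - of_real (\<gamma> / leverage z) * c))\<^sup>2
            = leverage z * (cmod (b j))\<^sup>2 - 2 * \<gamma> * Re (c * cnj (b j)) + \<gamma>\<^sup>2 * (cmod c)\<^sup>2 / leverage z"
          using u by (simp add: field_simps power2_eq_square)
        have "(cmod c)\<^sup>2 = (cmod (r z))\<^sup>2 * (cmod (e j z))\<^sup>2"
          by (simp add: c_def norm_mult power_mult_distrib)
        moreover have "c * cnj (b j) = r z * cnj (b j * e j z)" by (simp add: c_def)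
        moreover have "of_real \<gamma> * r z * cnj (e j z) / of_real (leverage z) = of_real (\<gamma> / leverage z) * c"
          by (simp add: c_def)
        ultimately show ?thesis using F by (simp only: mult.assoc)
      qed
      have "leverage z * (\<Sum>j<m. (cmod (b j - of_real \<gamma> * r z * cnj (e j z) / of_real (leverage z)))\<^sup>2)
         = leverage z * \<beta> - 2 * \<gamma> * (\<Sum>j<m. Re (r z * cnj (b j * e j z)))
           + \<gamma>\<^sup>2 * (cmod (r z))\<^sup>2 * (\<Sum>j<m. (cmod (e j z))\<^sup>2) / leverage z"
        unfolding sum_distrib_left one \<beta>_def
        by (simp add: sum.distrib sum_subtractf sum_distrib_left sum_divide_distrib)
      also have "(\<Sum>j<m. Re (r z * cnj (b j * e j z))) = Re (r z * cnj (w z))"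
        by (simp only: w_def lin_comb_def cnj_sum sum_distrib_left Re_sum)
      also have "\<gamma>\<^sup>2 * (cmod (r z))\<^sup>2 * (\<Sum>j<m. (cmod (e j z))\<^sup>2) / leverage z = \<gamma>\<^sup>2 * m * (cmod (r z))\<^sup>2"
        unfolding sume using u by simp
      finally show ?thesis by (simp add: q_def)
    qed
    have z: "q z = \<gamma>\<^sup>2 * m * (cmod (r z))\<^sup>2" if "leverage z = 0"
      using leverage_null[OF that] that by (simp add: q_def w_def lin_comb_def)
    show "leverage z * (\<Sum>j<m. (cmod (b j - of_real \<gamma> * r z * cnj (e j z) / of_real (leverage z)))\<^sup>2) \<le> q z"
      using eq z by (cases "leverage z = 0") auto
    moreover have "0 \<le> leverage z * (\<Sum>j<m. (cmod (b j - of_real \<gamma> * r z * cnj (e j z) / of_real (leverage z)))\<^sup>2)"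
      by (intro mult_nonneg_nonneg leverage_nonneg sum_nonneg) simp
    ultimately show "q z \<ge> 0" by simp
  qed
  have il: "integrable \<mu> leverage" "integral\<^sup>L \<mu> leverage = 1"
  proof -
    show "integrable \<mu> leverage"
      by (rule integrableI_nonneg) (auto simp: leverage_nonneg leverage_integral)
    show "integral\<^sup>L \<mu> leverage = 1"
      by (rule integral_eq_nn_integral[THEN trans]) (auto simp: leverage_nonneg leverage_integral)
  qed
  have irw: "integrable \<mu> (\<lambda>z. Re (r z * cnj (w z)))"
    using integrable_product_spaceG[OF rG wG] by (rule integrable_Re)
  have irr: "integrable \<mu> (\<lambda>z. (cmod (r z))\<^sup>2)" using rG by (simp add: spaceG_def)
  have iq: "integrable \<mu> q"
    unfolding q_def using il irw irr by auto
  have "(\<integral>z. (cmod (r z))\<^sup>2 \<partial>\<mu>) = G.sq r"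
    using normG_square[of d P r] by (simp add: normG_def G.sq_def)
  moreover have "(\<integral>z. Re (r z * cnj (w z)) \<partial>\<mu>) = \<beta>"
    using integral_Re[OF integrable_product_spaceG[OF rG wG]] rw by (simp add: innerG_def)
  ultimately have "integral\<^sup>L \<mu> q = 1 * \<beta> - 2 * \<gamma> * \<beta> + \<gamma>\<^sup>2 * m * G.sq r"
    unfolding q_def using il irw irr by simp
  also have "\<dots> = (1 - 2 * \<gamma> + \<gamma>\<^sup>2 * m) * \<beta> + \<gamma>\<^sup>2 * m * G.sq g"
    unfolding sqr by (simp add: algebra_simps)
  finally have q_val: "(\<integral>\<^sup>+z. ennreal (q z) \<partial>\<mu>) = ennreal ((1 - 2 * \<gamma> + \<gamma>\<^sup>2 * m) * \<beta> + \<gamma>\<^sup>2 * m * G.sq g)"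
    using nn_integral_eq_integral[OF iq] q0 by simp
  show ?thesis unfolding q_val[symmetric] by (intro nn_integral_mono ennreal_leI le)
qed

end

section \<open>Expected error of the corrected interpolation\<close>

text \<open>
  The input \<open>f\<close> is split into its part in the span of the \<open>e j\<close> and a rest \<open>g\<close> orthogonal to it; the
  method recovers \<open>\<beta>\<close> approximately.
\<close>
locale sampling_target = sampling +
  fixes f g :: func and \<beta> :: "nat \<Rightarrow> complex"
  assumes f_in: "f \<in> spaceG K d P"
    and g_in: "g \<in> spaceG K d P" and g_perp: "\<And>j. j < m \<Longrightarrow> innerG d P (e j) g = 0"
    and \<beta>_in: "\<And>j. j < m \<Longrightarrow> \<beta> j \<in> K"
    and f_eq: "\<And>x. f x = g x + lin_comb m e \<beta> x"
begin

definition residual :: "nat \<Rightarrow> (nat \<Rightarrow> point) \<Rightarrow> nat \<Rightarrow> complex" where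
  "residual t x j = \<beta> j - coeffs x (\<lambda>i. f (x i)) t j"

definition squared_residual :: "nat \<Rightarrow> (nat \<Rightarrow> point) \<Rightarrow> real" where
  "squared_residual t x = (\<Sum>j<m. (cmod (residual t x j))\<^sup>2)"

definition expected_residual :: "nat \<Rightarrow> ennreal" where
  "expected_residual t =
     (\<integral>\<^sup>+x. ennreal (sample_density t x * squared_residual t x) \<partial>points (m + t))"

lemma residual_scalar: "j < m \<Longrightarrow> residual t x j \<in> K"
  unfolding residual_def by (intro scalar_closed(5)[OF field] \<beta>_in coeffs_scalar spaceG_scalar[OF f_in])

lemma squared_residual_nonneg: "squared_residual t x \<ge> 0"
  by (simp add: squared_residual_def sum_nonneg)

lemma squared_residual_measurable:
  "squared_residual t \<in> borel_measurable (points (m + t))"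
  unfolding squared_residual_def[abs_def] residual_def
  by (intro borel_measurable_sum borel_measurable_power measurable_compose[OF _ borel_measurable_norm]
      borel_measurable_diff measurable_const coeffs_measurable component_measurable
      measurable_compose[OF component_measurable spaceG_measurable[OF f_in]]) auto

lemma weighted_residual_measurable:
  "(\<lambda>x. ennreal (sample_density t x * squared_residual t x)) \<in> borel_measurable (points (m + t))"
  by (intro measurable_compose[OF _ measurable_ennreal] borel_measurable_times
      squared_residual_measurable sample_density_measurable component_measurable)

text \<open>
  By Cramer's rule the coefficient errors of interpolation are quotients of two determinants, and the
  denominator cancels against the density. Each of the \<open>m\<close> numerators has second moment
  \<open>m! \<parallel>g\<parallel>\<^sup>2\<close>.
\<close>
lemma expected_residual_0: "expected_residual 0 \<le> ennreal (m * G.sq g)"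
proof -
  define D where "D = (\<lambda>j x. alternant m (\<lambda>l i. (e(j := g)) l (x i)))"
  have D: "D j x = alternant m ((\<lambda>l i. e l (x i))(j := \<lambda>i. g (x i)))" for j x
    unfolding D_def by (intro arg_cong[where f = "alternant m"]) auto
  have Dm: "(\<lambda>x. ennreal ((cmod (D j x))\<^sup>2)) \<in> borel_measurable (points m)" if "j \<in> {..<m}" for j
  proof -
    have "(e(j := g)) l \<in> borel_measurable \<mu>" if "l < m" for l
      using e_measurable[OF that] spaceG_measurable[OF g_in] by auto
    then have "D j \<in> borel_measurable (points m)"
      unfolding D_def by (intro alternant_measurable measurable_compose[OF component_measurable]) auto
    then show ?thesis by measurable
  qed
  have DI: "(\<integral>\<^sup>+x. ennreal ((cmod (D j x))\<^sup>2) \<partial>points m) = ennreal (fact m * G.sq g)" if j: "j < m" for j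
  proof -
    have perp: "innerG d P g (e i) = 0" if "i < m" for i
      using G.hermitian[OF e_in[OF that] g_in] g_perp[OF that] by simp
    have "(\<Prod>l<m. G.sq ((e(j := g)) l)) = G.sq g"
      using prod.remove[of "{..<m}" j "\<lambda>l. G.sq ((e(j := g)) l)"] j sq_e by simp
    moreover have "(\<integral>\<^sup>+x. ennreal ((cmod (D j x))\<^sup>2) \<partial>points m)
       = ennreal (fact m * (\<Prod>l<m. G.sq ((e(j := g)) l)))"
      unfolding D_def by (rule alternant_second_moment) (use e_in e_orth g_in g_perp perp in auto)
    ultimately show ?thesis by simp
  qed
  have "expected_residual 0 \<le> (\<integral>\<^sup>+x. ennreal (1 / fact m) * (\<Sum>j<m. ennreal ((cmod (D j x))\<^sup>2)) \<partial>points m)"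
    unfolding expected_residual_def add_0_right
  proof (rule nn_integral_mono)
    fix x
    have "sample_density 0 x * squared_residual 0 x \<le> 1 / fact m * (\<Sum>j<m. (cmod (D j x))\<^sup>2)"
    proof (cases "basis_det x = 0")
      case True
      then show ?thesis by (simp add: sample_density_def sum_nonneg)
    next
      case False
      have "residual 0 x j = - (D j x / basis_det x)" if "j < m" for j
      proof -
        have "alternant m ((\<lambda>l i. e l (x i))(j := \<lambda>i. f (x i))) = \<beta> j * basis_det x + D j x"
          using alternant_expand[OF that, of "\<lambda>l i. e l (x i)" \<beta> "\<lambda>i. g (x i)"]
          by (simp add: D basis_det_def f_eq lin_comb_def add.commute)
        then show ?thesis using False by (simp add: residual_def field_simps)
      qed
      then have "squared_residual 0 x = (\<Sum>j<m. (cmod (D j x))\<^sup>2) / (cmod (basis_det x))\<^sup>2"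
        by (simp add: squared_residual_def norm_divide power_divide sum_divide_distrib)
      then show ?thesis using False by (simp add: sample_density_def)
    qed
    then show "ennreal (sample_density 0 x * squared_residual 0 x)
        \<le> ennreal (1 / fact m) * (\<Sum>j<m. ennreal ((cmod (D j x))\<^sup>2))"
      by (simp add: ennreal_mult[symmetric] sum_nonneg ennreal_leI)
  qed
  also have "\<dots> = ennreal (1 / fact m) * (\<integral>\<^sup>+x. (\<Sum>j<m. ennreal ((cmod (D j x))\<^sup>2)) \<partial>points m)"
    by (intro nn_integral_cmult borel_measurable_sum Dm)
  also have "\<dots> = ennreal (1 / fact m) * (\<Sum>j<m. \<integral>\<^sup>+x. ennreal ((cmod (D j x))\<^sup>2) \<partial>points m)"
    by (subst nn_integral_sum[OF Dm]) auto
  also have "\<dots> = ennreal (1 / fact m) * ennreal (m * (fact m * G.sq g))"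
    by (simp add: DI G.sq_nonneg[OF g_in] ennreal_of_nat_eq_real_of_nat ennreal_mult)
  also have "\<dots> = ennreal (m * G.sq g)"
    by (subst ennreal_mult[symmetric]) (simp_all add: G.sq_nonneg[OF g_in])
  finally show ?thesis .
qed

lemma expected_residual_Suc:
  assumes \<gamma>: "\<gamma> \<ge> 0" and \<rho>: "1 - 2 * \<gamma> + \<gamma>\<^sup>2 * m \<ge> 0"
  shows "expected_residual (Suc t)
    \<le> ennreal (1 - 2 * \<gamma> + \<gamma>\<^sup>2 * m) * expected_residual t + ennreal (\<gamma>\<^sup>2 * m * G.sq g)"
proof -
  let ?\<rho> = "1 - 2 * \<gamma> + \<gamma>\<^sup>2 * m" and ?c = "\<gamma>\<^sup>2 * m * G.sq g"
  have c0: "?c \<ge> 0" using G.sq_nonneg[OF g_in] by simp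
  have "expected_residual (Suc t) = (\<integral>\<^sup>+x. \<integral>\<^sup>+z. ennreal (sample_density (Suc t) (x(m + t := z))
      * squared_residual (Suc t) (x(m + t := z))) \<partial>\<mu> \<partial>points (m + t))"
    unfolding expected_residual_def by (rule nn_integral_points_Suc[OF weighted_residual_measurable])
  also have "\<dots> \<le> (\<integral>\<^sup>+x. ennreal ?\<rho> * ennreal (sample_density t x * squared_residual t x)
      + ennreal ?c * ennreal (sample_density t x) \<partial>points (m + t))"
  proof (rule nn_integral_mono)
    fix x
    let ?b = "residual t x"
    let ?upd = "\<lambda>z. leverage z * (\<Sum>j<m. (cmod (?b j - of_real \<gamma> * (g z + lin_comb m e ?b z)
        * cnj (e j z) / of_real (leverage z)))\<^sup>2)"
    have eq: "sample_density (Suc t) (x(m + t := z)) * squared_residual (Suc t) (x(m + t := z))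
       = sample_density t x * ?upd z" for z
    proof -
      let ?x = "x(m + t := z)"
      have c: "coeffs ?x (\<lambda>i. f (?x i)) t j = coeffs x (\<lambda>i. f (x i)) t j" if "j < m" for j
        using that by (intro coeffs_local) auto
      have "f z - lin_comb m e (coeffs ?x (\<lambda>i. f (?x i)) t) z = g z + lin_comb m e ?b z"
      proof -
        have "lin_comb m e (coeffs ?x (\<lambda>i. f (?x i)) t) z = lin_comb m e (coeffs x (\<lambda>i. f (x i)) t) z"
          unfolding lin_comb_def by (intro sum.cong refl) (use c in simp)
        then show ?thesis
          using f_eq[of z] by (simp add: lin_comb_def residual_def sum_subtractf left_diff_distrib)
      qed
      then have "residual (Suc t) ?x j = ?b j - of_real \<gamma> * (g z + lin_comb m e ?b z)
        * cnj (e j z) / of_real (leverage z)" if "j < m" for j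
        using c[OF that] by (simp add: residual_def)
      moreover have "sample_density t ?x = sample_density t x" by (rule sample_density_local) auto
      ultimately show ?thesis by (simp add: squared_residual_def sample_density_Suc)
    qed
    have upd0: "?upd z \<ge> 0" for z by (intro mult_nonneg_nonneg leverage_nonneg sum_nonneg) simp
    have [measurable]: "(\<lambda>z. lin_comb m e ?b z) \<in> borel_measurable \<mu>"
      using G.lin_comb_in[of m e ?b] e_in residual_scalar by (intro spaceG_measurable) auto
    have [measurable]: "g \<in> borel_measurable \<mu>" by (rule spaceG_measurable[OF g_in])
    have updm: "(\<lambda>z. ennreal (?upd z)) \<in> borel_measurable \<mu>"
      by (intro measurable_compose[OF _ measurable_ennreal] borel_measurable_times leverage_measurable
          borel_measurable_sum borel_measurable_power measurable_compose[OF _ borel_measurable_norm]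
          borel_measurable_diff borel_measurable_divide borel_measurable_cnj e_measurable) auto
    have "(\<integral>\<^sup>+z. ennreal (sample_density (Suc t) (x(m + t := z)) * squared_residual (Suc t) (x(m + t := z))) \<partial>\<mu>)
       = ennreal (sample_density t x) * (\<integral>\<^sup>+z. ennreal (?upd z) \<partial>\<mu>)"
      unfolding eq using upd0 updm
      by (simp only: ennreal_mult[OF sample_density_nonneg upd0] nn_integral_cmult)
    also have "\<dots> \<le> ennreal (sample_density t x) * ennreal (?\<rho> * squared_residual t x + ?c)"
      using expected_update[where b = "residual t x" and g = g, OF g_in g_perp residual_scalar \<gamma>]
      by (intro mult_left_mono) (simp_all add: squared_residual_def)
    also have "\<dots> = ennreal ?\<rho> * ennreal (sample_density t x * squared_residual t x)
      + ennreal ?c * ennreal (sample_density t x)"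
    proof -
      have n: "0 \<le> ?\<rho> * squared_residual t x + ?c"
        by (rule add_nonneg_nonneg[OF mult_nonneg_nonneg[OF \<rho> squared_residual_nonneg] c0])
      have "ennreal (sample_density t x) * ennreal (?\<rho> * squared_residual t x + ?c)
          = ennreal (?\<rho> * (sample_density t x * squared_residual t x) + ?c * sample_density t x)"
        by (subst ennreal_mult[OF sample_density_nonneg n, symmetric]) (simp add: algebra_simps)
      also have "\<dots> = ennreal (?\<rho> * (sample_density t x * squared_residual t x)) + ennreal (?c * sample_density t x)"
        by (rule ennreal_plus[OF mult_nonneg_nonneg[OF \<rho> mult_nonneg_nonneg[OF sample_density_nonneg squared_residual_nonneg]]
              mult_nonneg_nonneg[OF c0 sample_density_nonneg]])
      also have "ennreal (?\<rho> * (sample_density t x * squared_residual t x))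
          = ennreal ?\<rho> * ennreal (sample_density t x * squared_residual t x)"
        by (rule ennreal_mult[OF \<rho> mult_nonneg_nonneg[OF sample_density_nonneg squared_residual_nonneg]])
      also have "ennreal (?c * sample_density t x) = ennreal ?c * ennreal (sample_density t x)"
        by (rule ennreal_mult[OF c0 sample_density_nonneg])
      finally show ?thesis .
    qed
    finally show "(\<integral>\<^sup>+z. ennreal (sample_density (Suc t) (x(m + t := z)) * squared_residual (Suc t) (x(m + t := z))) \<partial>\<mu>)
       \<le> ennreal ?\<rho> * ennreal (sample_density t x * squared_residual t x)
      + ennreal ?c * ennreal (sample_density t x)" .
  qed
  also have "\<dots> = ennreal ?\<rho> * expected_residual t + ennreal ?c * 1"
  proof -
    have dm: "(\<lambda>x. ennreal (sample_density t x)) \<in> borel_measurable (points (m + t))"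
      by (intro measurable_compose[OF _ measurable_ennreal] sample_density_measurable component_measurable)
    show ?thesis
      using weighted_residual_measurable[of t] dm
      unfolding expected_residual_def sample_density_integral[of t, symmetric]
      by (subst nn_integral_add) (auto simp: nn_integral_cmult)
  qed
  finally show ?thesis by simp
qed

text \<open>
  The recursion contracts by \<open>1 - \<delta> / m\<close> and adds \<open>\<delta>\<^sup>2 / m\<close> in each step, whose fixed point is \<open>\<delta>\<close>.
\<close>
lemma expected_residual_bound:
  assumes \<gamma>: "\<gamma> = \<delta> / m" and \<delta>: "0 < \<delta>" "\<delta> \<le> 1"
  shows "expected_residual t \<le> ennreal (((1 - \<delta> / m) ^ t * m + \<delta>) * G.sq g)"
proof (induction t)
  case 0
  have "m * G.sq g \<le> (1 * m + \<delta>) * G.sq g"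
    using \<delta> G.sq_nonneg[OF g_in] by (intro mult_right_mono) auto
  then show ?case using expected_residual_0 by (auto intro: order_trans ennreal_leI)
next
  case (Suc t)
  define p where "p = 1 - \<delta> / m"
  have m0: "real m \<ge> 1" using m by simp
  have p: "0 \<le> p" "1 - 2 * \<gamma> + \<gamma>\<^sup>2 * m \<le> p"
  proof -
    show "0 \<le> p" using \<delta> m0 by (simp add: p_def)
    have "\<gamma>\<^sup>2 * m = \<delta> * (\<delta> / m)" using m0 by (simp add: \<gamma> power2_eq_square)
    also have "\<dots> \<le> 1 * (\<delta> / m)" using \<delta> m0 by (intro mult_right_mono) auto
    finally show "1 - 2 * \<gamma> + \<gamma>\<^sup>2 * m \<le> p" by (simp add: p_def \<gamma>)
  qed
  have \<rho>: "0 \<le> 1 - 2 * \<gamma> + \<gamma>\<^sup>2 * m"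
  proof -
    have "0 \<le> (1 - \<gamma>)\<^sup>2 + \<gamma>\<^sup>2 * (real m - 1)" using m0 by (intro add_nonneg_nonneg) auto
    then show ?thesis by (simp add: power2_eq_square algebra_simps)
  qed
  have sg: "G.sq g \<ge> 0" by (rule G.sq_nonneg[OF g_in])
  have E0: "0 \<le> (p ^ t * m + \<delta>) * G.sq g" using p \<delta> sg by simp
  have "expected_residual (Suc t)
    \<le> ennreal (1 - 2 * \<gamma> + \<gamma>\<^sup>2 * m) * expected_residual t + ennreal (\<gamma>\<^sup>2 * m * G.sq g)"
    using \<delta> \<rho> by (intro expected_residual_Suc) (auto simp: \<gamma>)
  also have "\<dots> \<le> ennreal p * ennreal ((p ^ t * m + \<delta>) * G.sq g) + ennreal (\<gamma>\<^sup>2 * m * G.sq g)"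
    using Suc p sg by (intro add_mono mult_mono ennreal_leI) (auto simp: p_def)
  also have "\<dots> = ennreal (p * ((p ^ t * m + \<delta>) * G.sq g) + \<gamma>\<^sup>2 * m * G.sq g)"
    using p E0 sg by (subst ennreal_mult[symmetric], simp, simp, subst ennreal_plus[symmetric]) auto
  also have "p * ((p ^ t * m + \<delta>) * G.sq g) + \<gamma>\<^sup>2 * m * G.sq g = (p ^ Suc t * m + \<delta>) * G.sq g"
    using m0 by (simp add: p_def \<gamma> field_simps power2_eq_square)
  finally show ?case by (simp add: p_def)
qed

lemma approximation_error:
  "(normG d P (\<lambda>z. f z - lin_comb m e (coeffs x (\<lambda>i. f (x i)) t) z))\<^sup>2 = G.sq g + squared_residual t x"
proof -
  have "(\<lambda>z. f z - lin_comb m e (coeffs x (\<lambda>i. f (x i)) t) z) = (\<lambda>z. g z + lin_comb m e (residual t x) z)"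
    using f_eq by (simp add: lin_comb_def residual_def sum_subtractf left_diff_distrib add_diff_eq)
  moreover have "G.sq (\<lambda>z. g z + lin_comb m e (residual t x) z) = G.sq g + G.sq (lin_comb m e (residual t x))"
    using e_in residual_scalar g_in g_perp by (intro G.sq_add_perp)
  moreover have "G.sq (lin_comb m e (residual t x)) = squared_residual t x"
    unfolding squared_residual_def using e_in residual_scalar e_orth sq_e
    by (subst G.sq_lin_comb_orthogonal) auto
  ultimately show ?thesis by (simp add: normG_square G.sq_def[symmetric])
qed

lemma expected_error_bound:
  assumes \<gamma>: "\<gamma> = \<delta> / m" and \<delta>: "0 < \<delta>" "\<delta> \<le> 1"
  shows "(\<integral>\<^sup>+x. ennreal (sample_density t x) *
      ennreal ((normG d P (\<lambda>z. f z - lin_comb m e (coeffs x (\<lambda>i. f (x i)) t) z))\<^sup>2) \<partial>points (m + t))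
    \<le> ennreal ((1 + (1 - \<delta> / m) ^ t * m + \<delta>) * G.sq g)"
proof -
  have sg: "G.sq g \<ge> 0" by (rule G.sq_nonneg[OF g_in])
  have dm: "(\<lambda>x. ennreal (sample_density t x)) \<in> borel_measurable (points (m + t))"
    by (intro measurable_compose[OF _ measurable_ennreal] sample_density_measurable component_measurable)
  have "(\<integral>\<^sup>+x. ennreal (sample_density t x) *
      ennreal ((normG d P (\<lambda>z. f z - lin_comb m e (coeffs x (\<lambda>i. f (x i)) t) z))\<^sup>2) \<partial>points (m + t))
    = (\<integral>\<^sup>+x. ennreal (G.sq g) * ennreal (sample_density t x)
        + ennreal (sample_density t x * squared_residual t x) \<partial>points (m + t))"
    unfolding approximation_error using sg sample_density_nonneg squared_residual_nonneg
    by (intro nn_integral_cong) (simp add: ennreal_mult distrib_left mult.commute)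
  also have "\<dots> = ennreal (G.sq g) * 1 + expected_residual t"
    using weighted_residual_measurable[of t] dm
    unfolding expected_residual_def sample_density_integral[of t, symmetric]
    by (subst nn_integral_add) (auto simp: nn_integral_cmult)
  also have "\<dots> \<le> ennreal (G.sq g) + ennreal (((1 - \<delta> / m) ^ t * m + \<delta>) * G.sq g)"
    using expected_residual_bound[OF assms] by (simp add: add_left_mono)
  also have "\<dots> = ennreal ((1 + (1 - \<delta> / m) ^ t * m + \<delta>) * G.sq g)"
  proof -
    have "0 \<le> 1 - \<delta> / m" using \<delta> m by (simp add: field_simps)
    then show ?thesis using sg \<delta>
      by (subst ennreal_plus[symmetric]) (auto simp: algebra_simps)
  qed
  finally show ?thesis .
qed

end

section \<open>The sampling method as a randomized algorithm\<close>

text \<open>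
  Packs finitely many points of dimension \<open>d\<close> into one sequence of reals; sequences of reals can be
  embedded into the type of elementary events.
\<close>
definition interleave :: "nat \<Rightarrow> (nat \<Rightarrow> point) \<Rightarrow> nat \<Rightarrow> real" where
  "interleave d x k = x (k div d) (k mod d)"

lemma interleave_inj_on:
  assumes D: "D \<subseteq> extensional {..<d}" and d: "d \<ge> 1"
  shows "inj_on (interleave d) ({..<n} \<rightarrow>\<^sub>E D)"
proof (rule inj_onI)
  fix x y assume xy: "x \<in> {..<n} \<rightarrow>\<^sub>E D" "y \<in> {..<n} \<rightarrow>\<^sub>E D" "interleave d x = interleave d y"
  show "x = y"
  proof
    fix i
    show "x i = y i"
    proof (cases "i < n")
      case True
      then have ext: "x i \<in> extensional {..<d}" "y i \<in> extensional {..<d}" using xy D by auto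
      have "x i j = y i j" for j
      proof (cases "j < d")
        case True
        then show ?thesis using fun_cong[OF xy(3), of "i * d + j"] by (simp add: interleave_def)
      qed (use ext in \<open>simp add: extensional_def\<close>)
      then show ?thesis by blast
    qed (use xy in \<open>simp add: PiE_def extensional_def\<close>)
  qed
qed

lemma lin_comb_measurable:
  assumes "\<And>i. i < k \<Longrightarrow> (\<lambda>q. c q i) \<in> borel_measurable N"
    and "\<And>i. i < k \<Longrightarrow> (\<lambda>q. g i (h q)) \<in> borel_measurable N"
  shows "(\<lambda>q. lin_comb k g (c q) (h q)) \<in> borel_measurable N"
  unfolding lin_comb_def by (intro borel_measurable_sum borel_measurable_times assms) auto

context sampling
begin

lemma domain_extensional: "domain P \<subseteq> extensional {..<d}"
proof -
  have "domain P \<subseteq> space (lebesgue_d d)"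
    using is_problem by (auto simp: is_approx_problem_def admissible_domain_def dest: sets.sets_into_space)
  then show ?thesis by (auto simp: lebesgue_d_def space_PiM PiE_def)
qed

definition sample_measure :: "nat \<Rightarrow> (nat \<Rightarrow> point) measure" where
  "sample_measure t = density (points (m + t)) (\<lambda>x. ennreal (sample_density t x))"

lemma sample_density_measurable': "(\<lambda>x. ennreal (sample_density t x)) \<in> borel_measurable (points (m + t))"
  by (intro measurable_compose[OF _ measurable_ennreal] sample_density_measurable component_measurable)

lemma prob_space_sample_measure: "prob_space (sample_measure t)"
proof
  have "emeasure (sample_measure t) (space (sample_measure t))
      = (\<integral>\<^sup>+x. ennreal (sample_density t x) * indicator (space (points (m + t))) x \<partial>points (m + t))"
    unfolding sample_measure_def using sample_density_measurable' by (subst emeasure_density) auto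
  also have "\<dots> = (\<integral>\<^sup>+x. ennreal (sample_density t x) \<partial>points (m + t))"
    by (intro nn_integral_cong) auto
  finally show "emeasure (sample_measure t) (space (sample_measure t)) = 1"
    by (simp add: sample_density_integral)
qed

lemma space_sample_measure: "space (sample_measure t) = {..<m + t} \<rightarrow>\<^sub>E domain P"
  by (simp add: sample_measure_def space_PiM space_\<mu>)

text \<open>
  The elementary events are the images of the sample points under an injection \<open>J\<close>, and \<open>X\<close> decodes
  them. Queries are indexed modulo \<open>m + t\<close> and outputs for lists of the wrong length or with entries
  outside of \<open>K\<close> are zero, because an algorithm has to issue function values and return elements of G
  for arbitrary lists.
\<close>
definition sampling_alg :: "nat \<Rightarrow> ((nat \<Rightarrow> point) \<Rightarrow> 'w) \<Rightarrow> 'w ran_alg" where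
  "sampling_alg t J =
     (let X = inv_into (space (sample_measure t)) J
      in \<lparr>prob_space_of = embed_measure (sample_measure t) J,
          query = (\<lambda>w ys f. f (X w (length ys mod (m + t)))),
          halts = (\<lambda>w ys. length ys = m + t),
          outcome = (\<lambda>w ys. if length ys = m + t \<and> set ys \<subseteq> K
             then lin_comb m e (coeffs (X w) (\<lambda>i. ys ! i) t) else (\<lambda>_. 0))\<rparr>)"

context
  fixes t :: nat and J :: "(nat \<Rightarrow> point) \<Rightarrow> 'w"
  assumes J: "inj_on J (space (sample_measure t))"
begin

private abbreviation "X \<equiv> inv_into (space (sample_measure t)) J"
private abbreviation "A \<equiv> sampling_alg t J"
private abbreviation "\<Omega> \<equiv> embed_measure (sample_measure t) J"

private lemma prob_space_of_A: "prob_space_of A = \<Omega>"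
  by (simp add: sampling_alg_def Let_def)

private lemma length_info_values: "length (info_values A w f k) = k"
  by (induction k) simp_all

private lemma info_values_A:
  "k \<le> m + t \<Longrightarrow> info_values A w f k = map (\<lambda>i. f (X w i)) [0..<k]"
proof (induction k)
  case (Suc k)
  have "query A w ys f = f (X w (length ys mod (m + t)))" for ys
    by (simp add: sampling_alg_def Let_def)
  then show ?case using Suc by simp
qed simp

private lemma cardinality_A: "cardinality A f w = m + t"
proof -
  have "halts A w (info_values A w f j) \<longleftrightarrow> j = m + t" for j
    using length_info_values[of w f j] by (simp add: sampling_alg_def Let_def)
  moreover have "(LEAST j. j = m + t) = m + t" by (rule Least_equality) auto
  ultimately show ?thesis by (simp add: cardinality_def)
qed

private lemma run_A:
  assumes "\<And>x. f x \<in> K"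
  shows "run A w f = lin_comb m e (coeffs (X w) (\<lambda>i. f (X w i)) t)"
proof -
  have "coeffs (X w) (\<lambda>i. map (\<lambda>i. f (X w i)) [0..<m + t] ! i) t j
      = coeffs (X w) (\<lambda>i. f (X w i)) t j" if "j < m" for j
    using that by (intro coeffs_local) auto
  then have "lin_comb m e (coeffs (X w) (\<lambda>i. map (\<lambda>i. f (X w i)) [0..<m + t] ! i) t)
      = lin_comb m e (coeffs (X w) (\<lambda>i. f (X w i)) t)"
    by (simp add: lin_comb_def)
  moreover have "outcome A w ys = (if length ys = m + t \<and> set ys \<subseteq> K
             then lin_comb m e (coeffs (X w) (\<lambda>i. ys ! i) t) else (\<lambda>_. 0))" for ys
    by (simp add: sampling_alg_def Let_def)
  ultimately show ?thesis using assms
    unfolding run_def cardinality_A by (auto simp: info_values_A simp del: upt_Suc)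
qed

private lemma X_measurable: "X \<in> measurable \<Omega> (sample_measure t)"
proof (rule measurable_embed_measure1)
  have "X (J x) = x" if "x \<in> space (sample_measure t)" for x
    using J that by (rule inv_into_f_f)
  then show "(\<lambda>x. X (J x)) \<in> measurable (sample_measure t) (sample_measure t)"
    by (subst measurable_cong[where g = "\<lambda>x. x"]) auto
qed

private lemma X_component: "i < m + t \<Longrightarrow> (\<lambda>w. X w i) \<in> measurable \<Omega> \<mu>"
proof -
  assume i: "i < m + t"
  have "X \<in> measurable \<Omega> (points (m + t))"
    using X_measurable by (simp add: sample_measure_def cong: measurable_cong_sets)
  from measurable_compose[OF this component_measurable[OF i]] show ?thesis .
qed

private lemma prob_space_\<Omega>: "prob_space \<Omega>"
  by (subst embed_measure_eq_distr'[OF J])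
    (intro prob_space.prob_space_distr prob_space_sample_measure measurable_embed_measure2'[OF J])

private lemma nn_integral_\<Omega>:
  assumes "h \<in> borel_measurable \<Omega>"
  shows "(\<integral>\<^sup>+w. h w \<partial>\<Omega>) = (\<integral>\<^sup>+x. h (J x) \<partial>sample_measure t)"
  by (rule nn_integral_embed_measure'[OF J assms])

private lemma joint_measurable:
  assumes g: "\<And>i. i < k \<Longrightarrow> g i \<in> spaceG K d P"
  shows "(\<lambda>(c, w). event_error d P A (lin_comb k g c) w)
     \<in> borel_measurable (scalar_vectors K k \<Otimes>\<^sub>M \<Omega>)"
proof -
  let ?N = "scalar_vectors K k \<Otimes>\<^sub>M \<Omega>"
  have K: "lin_comb k g (fst p) x \<in> K" if "p \<in> space ?N" for p x
  proof -
    have "fst p i \<in> K" if "i < k" for i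
      using \<open>p \<in> space ?N\<close> that
      by (auto simp: scalar_vectors_def space_pair_measure space_PiM space_restrict_space PiE_def Pi_def)
    then show ?thesis unfolding lin_comb_def
      using spaceG_scalar[OF g] by (intro scalar_closed(8,10)[OF field]) auto
  qed
  have c: "(\<lambda>p. fst p i) \<in> borel_measurable ?N" if "i < k" for i
  proof -
    have "(\<lambda>c. c i) \<in> measurable (scalar_vectors K k) (restrict_space borel K)"
      unfolding scalar_vectors_def using that by (intro measurable_component_singleton) simp
    moreover have "(\<lambda>x. x) \<in> measurable (restrict_space borel K) (borel :: complex measure)"
      by (rule measurable_restrict_space1) simp
    ultimately have "(\<lambda>c. c i) \<in> borel_measurable (scalar_vectors K k)" by (rule measurable_compose)
    from measurable_compose[OF measurable_fst this] show ?thesis .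
  qed
  have Xp: "(\<lambda>p. X (snd p) i) \<in> measurable ?N \<mu>" if "i < m + t" for i
    by (rule measurable_compose[OF measurable_snd X_component[OF that]])
  have Y: "(\<lambda>p. lin_comb k g (fst p) (X (snd p) i)) \<in> borel_measurable ?N" if "i < m + t" for i
    unfolding lin_comb_def
    by (intro borel_measurable_sum borel_measurable_times c measurable_compose[OF Xp[OF that] spaceG_measurable] g) auto
  have a: "(\<lambda>p. coeffs (X (snd p)) (\<lambda>i. lin_comb k g (fst p) (X (snd p) i)) t j) \<in> borel_measurable ?N"
    if "j < m" for j
    using coeffs_measurable[where X = "\<lambda>i p. X (snd p) i" and Y = "\<lambda>i p. lin_comb k g (fst p) (X (snd p) i)",
        OF Xp Y that] by simp
  define D where "D = (\<lambda>q. lin_comb k g (fst (fst q)) (snd q)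
      - lin_comb m e (coeffs (X (snd (fst q))) (\<lambda>i. lin_comb k g (fst (fst q)) (X (snd (fst q)) i)) t) (snd q))"
  have D: "D \<in> borel_measurable (?N \<Otimes>\<^sub>M \<mu>)"
    unfolding D_def
    by (intro borel_measurable_diff lin_comb_measurable
        measurable_compose[OF measurable_fst c] measurable_compose[OF measurable_fst a]
        measurable_compose[OF measurable_snd spaceG_measurable] g e_in)
  have "(\<lambda>q. (cmod (D q))\<^sup>2) \<in> borel_measurable (?N \<Otimes>\<^sub>M \<mu>)" using D by measurable
  then have "(\<lambda>p. \<integral>x. (cmod (D (p, x)))\<^sup>2 \<partial>\<mu>) \<in> borel_measurable ?N"
    by (intro M.borel_measurable_lebesgue_integral) (simp add: case_prod_unfold)
  then have "(\<lambda>p. sqrt (\<integral>x. (cmod (D (p, x)))\<^sup>2 \<partial>\<mu>)) \<in> borel_measurable ?N" by measurable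
  moreover have "(case p of (c, w) \<Rightarrow> event_error d P A (lin_comb k g c) w) = sqrt (\<integral>x. (cmod (D (p, x)))\<^sup>2 \<partial>\<mu>)"
    if "p \<in> space ?N" for p
    using run_A[of "lin_comb k g (fst p)" "snd p"] K[OF that]
    by (simp add: case_prod_unfold event_error_def normG_def D_def)
  ultimately show ?thesis by (subst measurable_cong) auto
qed

lemma sampling_alg_randomized: "randomized_algorithm K d P Info_std A"
  unfolding randomized_algorithm_def jointly_measurable_def
proof (intro conjI ballI allI impI)
  show "prob_space (prob_space_of A)" using prob_space_\<Omega> by (simp add: prob_space_of_A)
next
  fix w and ys :: "complex list" assume "w \<in> space (prob_space_of A)"
  then have "X w \<in> space (sample_measure t)"
    by (auto simp: prob_space_of_A space_embed_measure inv_into_into)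
  moreover have "x i \<in> domain P" if "x \<in> space (sample_measure t)" "i < m + t" for x i
    using that by (auto simp: space_sample_measure)
  moreover have "length ys mod (m + t) < m + t" using m by simp
  ultimately have "X w (length ys mod (m + t)) \<in> domain P" by blast
  then show "query A w ys \<in> functionals K P Info_std"
    by (auto simp: sampling_alg_def Let_def)
  show "outcome A w ys \<in> spaceG K d P"
  proof (cases "length ys = m + t \<and> set ys \<subseteq> K")
    case True
    have "lin_comb m e (coeffs (X w) (\<lambda>i. ys ! i) t) \<in> spaceG K d P"
    proof (intro G.lin_comb_in e_in coeffs_scalar)
      fix i assume "i < m + t"
      then show "ys ! i \<in> K" using True nth_mem[of i ys] by auto
    qed
    then show ?thesis using True by (simp add: sampling_alg_def Let_def)
  next
    case False
    then show ?thesis using G.zero_in by (auto simp: sampling_alg_def Let_def)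
  qed
next
  fix w f
  have "halts A w (info_values A w f (m + t))"
    using length_info_values[of w f "m + t"] by (simp add: sampling_alg_def Let_def)
  then show "\<exists>j. halts A w (info_values A w f j)" ..
next
  fix k and g :: "nat \<Rightarrow> func" assume g: "\<forall>i<k. g i \<in> spaceF P"
  show "(\<lambda>(c, w). cardinality A (lin_comb k g c) w)
      \<in> measurable (scalar_vectors K k \<Otimes>\<^sub>M prob_space_of A) (count_space UNIV)"
    by (simp add: cardinality_A case_prod_unfold)
  show "(\<lambda>(c, w). event_error d P A (lin_comb k g c) w)
      \<in> borel_measurable (scalar_vectors K k \<Otimes>\<^sub>M prob_space_of A)"
    unfolding prob_space_of_A using g embedded by (intro joint_measurable) auto
qed

lemma sampling_alg_card: "ran_card P A \<le> of_nat (m + t)"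
proof -
  interpret prob_space \<Omega> by (rule prob_space_\<Omega>)
  show ?thesis unfolding ran_card_def prob_space_of_A cardinality_A
    by (intro SUP_least) (simp add: emeasure_space_1)
qed

lemma sampling_alg_error:
  assumes f: "f \<in> spaceG K d P"
  shows "(\<integral>\<^sup>+w. ennreal ((event_error d P A f w)\<^sup>2) \<partial>prob_space_of A)
    = (\<integral>\<^sup>+x. ennreal (sample_density t x) *
      ennreal ((normG d P (\<lambda>z. f z - lin_comb m e (coeffs x (\<lambda>i. f (x i)) t) z))\<^sup>2) \<partial>points (m + t))"
proof -
  define h where "h = (\<lambda>x. ennreal ((normG d P (\<lambda>z. f z - lin_comb m e (coeffs x (\<lambda>i. f (x i)) t) z))\<^sup>2))"
  have err: "event_error d P A f w = normG d P (\<lambda>z. f z - lin_comb m e (coeffs (X w) (\<lambda>i. f (X w i)) t) z)" for w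
    using run_A[OF spaceG_scalar[OF f]] by (simp add: event_error_def)
  have one: "lin_comb 1 (\<lambda>_. f) (\<lambda>i\<in>{..<1}. 1) = f" by (simp add: lin_comb_def)
  have "(\<lambda>i\<in>{..<1}. 1) \<in> space (scalar_vectors K 1)"
    using scalar_closed(3)[OF field]
    by (auto simp: scalar_vectors_def space_PiM space_restrict_space PiE_def extensional_def)
  from measurable_compose[OF measurable_Pair1'[OF this, of \<Omega>] joint_measurable[of 1 "\<lambda>_. f"]]
  have em: "(\<lambda>w. event_error d P A f w) \<in> borel_measurable \<Omega>" using f one by simp
  then have em2: "(\<lambda>w. ennreal ((event_error d P A f w)\<^sup>2)) \<in> borel_measurable \<Omega>" by measurable
  have hJ: "ennreal ((event_error d P A f (J x))\<^sup>2) = h x" if "x \<in> space (sample_measure t)" for x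
    using inv_into_f_f[OF J that] by (simp add: err h_def)
  have "(\<lambda>x. ennreal ((event_error d P A f (J x))\<^sup>2)) \<in> borel_measurable (sample_measure t)"
    by (rule measurable_compose[OF measurable_embed_measure2'[OF J] em2])
  then have hm: "h \<in> borel_measurable (points (m + t))"
    using hJ by (subst (asm) measurable_cong[where g = h]) (auto simp: sample_measure_def)
  have "(\<integral>\<^sup>+w. ennreal ((event_error d P A f w)\<^sup>2) \<partial>\<Omega>) = (\<integral>\<^sup>+x. h x \<partial>sample_measure t)"
    unfolding nn_integral_\<Omega>[OF em2] by (intro nn_integral_cong hJ)
  also have "\<dots> = (\<integral>\<^sup>+x. ennreal (sample_density t x) * h x \<partial>points (m + t))"
    unfolding sample_measure_def by (rule nn_integral_density[OF sample_density_measurable' hm])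
  finally show ?thesis by (simp add: prob_space_of_A h_def)
qed

end

end

section \<open>Comparison of the two classes of information\<close>

lemma ennreal_sqrt_le:
  assumes "x \<le> ennreal b" "b \<ge> 0"
  shows "ennreal_sqrt x \<le> ennreal (sqrt b)"
proof (cases x)
  case (real r)
  then have "r \<le> b" using assms by simp
  then show ?thesis using real by (simp add: ennreal_sqrt_def ennreal_leI)
qed (use assms in \<open>simp add: top_unique\<close>)

context problem
begin

text \<open>
  Normalizing a singular system in G gives the orthonormal family of the sampling method. The
  F-projection onto the system leaves a rest that is F-orthogonal, hence G-orthogonal to the system,
  and that has squared G-norm at most \<open>\<theta>\<close>.
\<close>
lemma singular_system_sampling:
  fixes \<iota> :: "(nat \<Rightarrow> real) \<Rightarrow> 'w"
  assumes \<iota>: "inj \<iota>" and d: "d \<ge> 1" and m: "m \<ge> 1"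
    and sys: "singular_system d P f m" and \<theta>: "\<theta> \<ge> 0" and pos: "\<And>i. i < m \<Longrightarrow> G.sq (f i) > 0"
    and small: "\<And>h. h \<in> spaceF P \<Longrightarrow> (\<forall>j<m. innerF P h (f j) = 0) \<Longrightarrow> G.sq h \<le> \<theta> * F.sq h"
    and \<delta>: "0 < \<delta>" "\<delta> \<le> 1"
  shows "\<exists>A :: 'w ran_alg. randomized_algorithm K d P Info_std A \<and> ran_card P A \<le> of_nat (m + t) \<and>
     ran_error d P A \<le> ennreal (sqrt ((1 + (1 - \<delta> / m) ^ t * m + \<delta>) * \<theta>))"
proof -
  have fF: "f i \<in> spaceF P" if "i < m" for i using sys that by (simp add: singular_system_def)
  define a where "a = (\<lambda>j. sqrt (G.sq (f j)))"
  have a: "a j > 0" "(a j)\<^sup>2 = G.sq (f j)" if "j < m" for j using pos[OF that] by (auto simp: a_def)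
  define e where "e = (\<lambda>j x. of_real (1 / a j) * f j x)"
  have aK: "complex_of_real r \<in> K" for r by (rule scalar_closed(1)[OF field])
  have eG: "e j \<in> spaceG K d P" if "j < m" for j
    unfolding e_def by (intro G.scale_in aK embedded fF that)
  interpret sampling K d P e m "\<delta> / m"
  proof
    fix i j assume ij: "i < m" "j < m"
    have "innerG d P (e i) (e j) = of_real (1 / a i) * (of_real (1 / a j) * innerG d P (f i) (f j))"
      unfolding e_def using ij fF[THEN embedded] aK
      by (simp only: G.form_scale G.form_scale_right G.scale_in complex_cnj_complex_of_real)
    also have "\<dots> = (if i = j then 1 else 0)"
    proof (cases "i = j")
      case True
      have "innerG d P (f j) (f j) = of_real ((a j)\<^sup>2)"
        using G.form_self[OF embedded[OF fF[OF ij(2)]]] a(2)[OF ij(2)] by simp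
      then show ?thesis using True a(1)[OF ij(2)] by (simp add: power2_eq_square)
    qed (use sys ij in \<open>simp add: singular_system_def\<close>)
    finally show "innerG d P (e i) (e j) = (if i = j then 1 else 0)" .
  qed (use m eG in auto)
  define J where "J = \<iota> \<circ> interleave d"
  have J: "inj_on J (space (sample_measure t))"
    unfolding J_def space_sample_measure
    by (intro comp_inj_on interleave_inj_on domain_extensional d inj_on_subset[OF \<iota>]) simp
  let ?B = "(1 + (1 - \<delta> / m) ^ t * m + \<delta>) * \<theta>"
  have c0: "0 \<le> 1 + (1 - \<delta> / m) ^ t * m + \<delta>"
  proof -
    have "0 \<le> 1 - \<delta> / m" using \<delta> m by (simp add: field_simps)
    then show ?thesis using \<delta> by (intro add_nonneg_nonneg mult_nonneg_nonneg) auto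
  qed
  have "ran_error d P (sampling_alg t J) \<le> ennreal (sqrt ?B)"
    unfolding ran_error_def
  proof (rule SUP_least)
    fix h assume "h \<in> unit_ballF P"
    then have h: "h \<in> spaceF P" "F.sq h \<le> 1" by (auto simp: unit_ball_iff)
    define c where "c = (\<lambda>j. innerF P h (f j))"
    have cK: "c j \<in> K" if "j < m" for j unfolding c_def by (intro F.form_scalar h fF that)
    define p where "p = lin_comb m f c"
    have pF: "p \<in> spaceF P" unfolding p_def using fF cK by (intro F.lin_comb_in)
    define g where "g = (\<lambda>x. h x - p x)"
    have gF: "g \<in> spaceF P" unfolding g_def by (intro F.diff_in h pF)
    have perpF: "innerF P g (f j) = 0" if j: "j < m" for j
    proof -
      have "innerF P p (f j) = (\<Sum>i<m. c i * innerF P (f i) (f j))"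
        unfolding p_def using fF cK j by (intro F.form_lin_comb)
      also have "\<dots> = (\<Sum>i<m. c i * (if i = j then 1 else 0))"
        using sys j by (intro sum.cong refl) (simp add: singular_system_def)
      also have "\<dots> = c j" using j by (simp add: if_distrib cong: if_cong)
      finally show ?thesis unfolding g_def using F.form_diff[OF h(1) pF fF[OF j]] by (simp add: c_def)
    qed
    have perpG: "innerG d P (e j) g = 0" if j: "j < m" for j
    proof -
      have "innerG d P g (f j) = 0" using sys gF perpF j by (simp add: singular_system_def)
      then have "innerG d P (f j) g = 0"
        using G.hermitian[OF embedded[OF gF] embedded[OF fF[OF j]]] by simp
      then show ?thesis unfolding e_def using embedded[OF fF[OF j]] embedded[OF gF] aK
        by (simp only: G.form_scale mult_zero_right)
    qed
    have "G.sq g \<le> \<theta> * F.sq g" using small[OF gF] perpF by blast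
    also have "\<dots> \<le> \<theta> * 1"
    proof (rule mult_left_mono[OF _ \<theta>])
      have "innerF P (f i) g = 0" if "i < m" for i
        using F.hermitian[OF gF fF[OF that]] perpF[OF that] by simp
      then have "F.sq (\<lambda>x. g x + lin_comb m f c x) = F.sq g + F.sq p"
        unfolding p_def using fF cK gF by (intro F.sq_add_perp)
      moreover have "(\<lambda>x. g x + lin_comb m f c x) = h" by (simp add: g_def p_def)
      ultimately show "F.sq g \<le> 1" using F.sq_nonneg[OF pF] h(2) by simp
    qed
    finally have g\<theta>: "G.sq g \<le> \<theta>" by simp
    interpret sampling_target K d P e m "\<delta> / m" h g "\<lambda>j. c j * of_real (a j)"
    proof
      show "h \<in> spaceG K d P" "g \<in> spaceG K d P" using h gF embedded by auto
      show "innerG d P (e j) g = 0" if "j < m" for j by (rule perpG[OF that])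
      show "c j * of_real (a j) \<in> K" if "j < m" for j
        by (intro scalar_closed(8)[OF field] cK that aK)
      have "c j * of_real (a j) * e j x = c j * f j x" if "j < m" for j x
        using a(1)[OF that] by (simp add: e_def)
      then have "lin_comb m e (\<lambda>j. c j * of_real (a j)) x = p x" for x
        unfolding p_def lin_comb_def by (intro sum.cong refl) simp
      then show "h x = g x + lin_comb m e (\<lambda>j. c j * of_real (a j)) x" for x
        by (simp add: g_def)
    qed
    have "(\<integral>\<^sup>+w. ennreal ((event_error d P (sampling_alg t J) h w)\<^sup>2) \<partial>prob_space_of (sampling_alg t J))
       \<le> ennreal ((1 + (1 - \<delta> / m) ^ t * m + \<delta>) * G.sq g)"
      unfolding sampling_alg_error[OF J embedded[OF h(1)]] by (rule expected_error_bound[OF refl \<delta>])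
    also have "\<dots> \<le> ennreal ?B"
      using g\<theta> c0 by (intro ennreal_leI mult_left_mono)
    finally show "ennreal_sqrt (\<integral>\<^sup>+w. ennreal ((event_error d P (sampling_alg t J) h w)\<^sup>2)
        \<partial>prob_space_of (sampling_alg t J)) \<le> ennreal (sqrt ?B)"
      by (rule ennreal_sqrt_le) (use c0 \<theta> in simp)
  qed
  then show ?thesis using sampling_alg_randomized[OF J] sampling_alg_card[OF J] by blast
qed

lemma initial_error_le:
  assumes "\<And>h. h \<in> spaceF P \<Longrightarrow> G.sq h \<le> \<theta> * F.sq h" "\<theta> \<le> b\<^sup>2" "b \<ge> 0" "\<theta> \<ge> 0"
  shows "min_ran_error W K d P \<Lambda> 0 \<le> ennreal b"
  unfolding min_ran_error_def
proof (simp, rule SUP_least)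
  fix h assume "h \<in> unit_ballF P"
  then have h: "h \<in> spaceF P" "F.sq h \<le> 1" by (auto simp: unit_ball_iff)
  have "G.sq h \<le> \<theta> * 1"
    using assms(1)[OF h(1)] mult_left_mono[OF h(2) assms(4)] by simp
  then have "normG d P h \<le> b" using assms(2,3) by (simp add: normG_eq real_le_lsqrt)
  then show "ennreal (normG d P h) \<le> ennreal b" by (rule ennreal_leI)
qed

lemma min_ran_error_all_le_std:
  "min_ran_error (W :: 'w itself) K d P Info_all n \<le> min_ran_error W K d P Info_std n"
proof (cases "n = 0")
  case False
  have "functionals K P Info_std \<subseteq> functionals K P Info_all"
    using embedded spaceG_scalar by (auto simp: image_iff)
  then have "randomized_algorithm K d P Info_all A" if "randomized_algorithm K d P Info_std A" for A :: "'w ran_alg"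
    using that unfolding randomized_algorithm_def by blast
  then show ?thesis using False unfolding min_ran_error_def by (auto intro!: INF_superset_mono)
qed (simp add: min_ran_error_def)

end

text \<open>
  About \<open>z ln z\<close> steps with \<open>z = k / \<delta>1\<close> suffice, and \<open>ln z \<le> z powr \<delta> / \<delta>\<close> turns the logarithm into an
  arbitrarily small power.
\<close>
lemma sampling_size_bound:
  fixes \<delta> \<delta>1 :: real and k M n :: nat
  assumes \<delta>: "0 < \<delta>" and \<delta>1: "0 < \<delta>1" "\<delta>1 \<le> 1" and k: "1 \<le> k" "k \<le> M * n" and n: "n \<ge> 1"
  obtains t :: nat where "(1 - \<delta>1 / k) ^ t * k \<le> \<delta>1"
    "real (k + t) \<le> (2 * M + (M / \<delta>1) powr (1 + \<delta>) / \<delta>) * real n powr (1 + \<delta>)"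
proof -
  define z where "z = k / \<delta>1"
  have z: "z \<ge> 1" using \<delta>1 k by (simp add: z_def field_simps)
  define t where "t = nat \<lceil>z * ln z\<rceil>"
  have t: "real t \<ge> z * ln z" "real t \<le> z * ln z + 1"
    using z by (auto simp: t_def)
  have inv: "\<delta>1 / k = 1 / z" using \<delta>1 k by (simp add: z_def)
  have "(1 - \<delta>1 / k) ^ t \<le> exp (- (1 / z)) ^ t"
    using exp_ge_add_one_self[of "- (1 / z)"] z by (intro power_mono) (auto simp: inv)
  also have "\<dots> = exp (- (t / z))" by (simp add: exp_of_nat_mult[symmetric])
  also have "\<dots> \<le> exp (- ln z)" using t(1) z by (simp add: field_simps)
  also have "\<dots> = 1 / z" using z by (simp add: exp_minus inverse_eq_divide)
  finally have "(1 - \<delta>1 / k) ^ t * k \<le> 1 / z * k" using k by (intro mult_right_mono) auto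
  then have 1: "(1 - \<delta>1 / k) ^ t * k \<le> \<delta>1" using \<delta>1 k by (simp add: z_def)
  define m where "m = real M * real n"
  have km: "real k \<le> m" unfolding m_def using k(2) by (metis of_nat_le_iff of_nat_mult)
  have m1: "m \<ge> 1" using km k by linarith
  have n1: "real n \<le> real n powr (1 + \<delta>)"
    using powr_mono[of 1 "1 + \<delta>" "real n"] n \<delta> by simp
  have "z * ln z \<le> z * (z powr \<delta> / \<delta>)" using ln_powr_bound[OF z \<delta>] z by (intro mult_left_mono) auto
  also have "\<dots> = z powr (1 + \<delta>) / \<delta>" using z by (simp add: powr_add)
  also have "\<dots> \<le> (m / \<delta>1) powr (1 + \<delta>) / \<delta>"
    using km \<delta>1 \<delta> z by (intro divide_right_mono powr_mono2) (auto simp: z_def divide_right_mono)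
  also have "\<dots> = (M / \<delta>1) powr (1 + \<delta>) / \<delta> * real n powr (1 + \<delta>)"
    using \<delta>1 by (simp add: m_def powr_mult[symmetric])
  finally have "real (k + t) \<le> m + 1 + (M / \<delta>1) powr (1 + \<delta>) / \<delta> * real n powr (1 + \<delta>)"
    using t(2) km by simp
  also have "m + 1 \<le> 2 * m" using m1 by simp
  also have "2 * m \<le> 2 * M * real n powr (1 + \<delta>)" unfolding m_def using n1 by (simp add: mult_left_mono mult.assoc)
  finally have "real (k + t) \<le> (2 * M + (M / \<delta>1) powr (1 + \<delta>) / \<delta>) * real n powr (1 + \<delta>)"
    by (simp add: algebra_simps)
  then show thesis using 1 that by blast
qed

text \<open>
  With \<open>r = sqrt (1 + \<delta>)\<close> and \<open>e = \<epsilon> / (1 + \<delta>)\<close>, so that \<open>\<epsilon> = e r\<^sup>2\<close>, the threshold is \<open>\<theta> = e\<^sup>2 r\<^sup>3\<close>. The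
  powers of \<open>r\<close> leave room on both sides: an algorithm with squared error at most \<open>e\<^sup>2 r\<close> contradicts
  the lower bound \<open>\<theta> / r = e\<^sup>2 r\<^sup>2\<close>, and sampling achieves \<open>r \<theta> = \<epsilon>\<^sup>2\<close>.
\<close>
lemma standard_information_comparison:
  fixes \<delta> :: real
  assumes \<delta>: "0 < \<delta>" "\<delta> \<le> 1" and rich: "\<exists>\<iota> :: (nat \<Rightarrow> real) \<Rightarrow> 'w. inj \<iota>"
  shows "\<exists>C>0. \<forall>K d P \<epsilon> n. (K = \<real> \<or> K = UNIV) \<longrightarrow> is_approx_problem K d P \<longrightarrow> d \<ge> 1 \<longrightarrow> \<epsilon> > 0 \<longrightarrow>
     min_ran_error TYPE('w) K d P Info_all n \<le> ennreal (\<epsilon> / (1 + \<delta>)) \<longrightarrow>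
     (\<exists>N. real N \<le> C * real n powr (1 + \<delta>) \<and> min_ran_error TYPE('w) K d P Info_std N \<le> ennreal \<epsilon>)"
proof -
  obtain \<iota> :: "(nat \<Rightarrow> real) \<Rightarrow> 'w" where \<iota>: "inj \<iota>" using rich by blast
  define r where "r = sqrt (1 + \<delta>)"
  have r: "r > 1" "r\<^sup>2 = 1 + \<delta>" "r \<le> 2" using \<delta> by (auto simp: r_def real_le_lsqrt)
  obtain M :: nat where M: "M \<ge> 1" and lower: "\<forall>K d P (A :: 'w ran_alg) m n f \<theta> e.
     (K = \<real> \<or> K = UNIV) \<longrightarrow> is_approx_problem K d P \<longrightarrow> randomized_algorithm K d P Info_all A \<longrightarrow>
     expansive d P \<theta> m f \<longrightarrow> \<theta> \<ge> 0 \<longrightarrow> ran_card P A \<le> of_nat n \<longrightarrow> ran_error d P A \<le> ennreal e \<longrightarrow>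
     e \<ge> 0 \<longrightarrow> n \<ge> 1 \<longrightarrow> m \<ge> M * n \<longrightarrow> 1 / r * \<theta> \<le> e\<^sup>2"
    using randomized_lower_bound[of "1 / r", where ?'w = 'w] r by auto
  define \<delta>1 where "\<delta>1 = (r - 1) / 2"
  have \<delta>1: "0 < \<delta>1" "\<delta>1 \<le> 1" using r by (auto simp: \<delta>1_def)
  define C where "C = 2 * M + (M / \<delta>1) powr (1 + \<delta>) / \<delta>"
  have C: "C > 0" using M \<delta> by (auto simp: C_def intro!: add_pos_nonneg)
  show ?thesis
  proof (intro exI[of _ C] conjI allI impI C)
    fix K d P \<epsilon> n
    assume K: "K = \<real> \<or> K = UNIV" and P: "is_approx_problem K d P" and d: "d \<ge> 1" and \<epsilon>: "\<epsilon> > (0 :: real)"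
      and n: "min_ran_error TYPE('w) K d P Info_all n \<le> ennreal (\<epsilon> / (1 + \<delta>))"
    interpret problem K d P by standard (use K P in auto)
    show "\<exists>N. real N \<le> C * real n powr (1 + \<delta>) \<and> min_ran_error TYPE('w) K d P Info_std N \<le> ennreal \<epsilon>"
    proof (cases "n = 0")
      case True
      have "ennreal (\<epsilon> / (1 + \<delta>)) \<le> ennreal \<epsilon>" using \<epsilon> \<delta> by (intro ennreal_leI) (simp add: field_simps)
      then have "min_ran_error TYPE('w) K d P Info_std 0 \<le> ennreal \<epsilon>"
        using n True by (simp add: min_ran_error_def)
      then show ?thesis using True by (intro exI[of _ 0]) simp
    next
      case False
      then have n1: "n \<ge> 1" by simp
      define e where "e = \<epsilon> / (1 + \<delta>)"
      have e: "e > 0" "\<epsilon> = e * r\<^sup>2" using \<epsilon> \<delta> r by (auto simp: e_def)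
      \<comment> \<open>The infimum over algorithms need not be attained, hence the extra factor.\<close>
      have "ennreal e < ennreal (e * sqrt r)" using e r by (intro ennreal_lessI) auto
      then have "min_ran_error TYPE('w) K d P Info_all n < ennreal (e * sqrt r)"
        using n by (simp add: e_def order_le_less_trans)
      then obtain A :: "'w ran_alg" where A: "randomized_algorithm K d P Info_all A"
        "ran_card P A \<le> of_nat n" "ran_error d P A < ennreal (e * sqrt r)"
        using False unfolding min_ran_error_def by (auto simp: INF_less_iff)
      define \<theta> where "\<theta> = e\<^sup>2 * r ^ 3"
      have \<theta>: "\<theta> > 0" using e r by (simp add: \<theta>_def)
      have \<theta>\<epsilon>: "r * \<theta> = \<epsilon>\<^sup>2" by (simp add: \<theta>_def e(2) power_mult_distrib power2_eq_square power3_eq_cube)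
      show ?thesis
      proof (rule singular_value_dichotomy[of \<theta> "M * n"])
        show "\<theta> \<ge> 0" using \<theta> by simp
      next
        fix f assume f: "singular_system d P f (M * n)" "\<And>i. i < M * n \<Longrightarrow> G.sq (f i) > \<theta>"
        let ?m = "M * n"
        have fF: "f i \<in> spaceF P" if "i < ?m" for i using f that by (simp add: singular_system_def)
        have xK: "complex_of_real s \<in> K" for s by (rule scalar_closed(1)[OF K])
        have sqF: "F.sq (f i) = 1" if "i < ?m" for i using f that by (simp add: singular_system_def F.sq_def)
        have "expansive d P \<theta> ?m f"
          unfolding expansive_def
        proof (intro conjI allI impI fF)
          fix x :: "nat \<Rightarrow> real"
          have "(\<Sum>i<?m. (x i)\<^sup>2 * \<theta>) \<le> (\<Sum>i<?m. (cmod (of_real (x i)))\<^sup>2 * G.sq (f i))"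
            using f(2) by (intro sum_mono) (simp add: mult_left_mono less_imp_le)
          also have "\<dots> = G.sq (real_comb ?m f x)"
            using f fF embedded xK by (intro G.sq_lin_comb_orthogonal[symmetric]) (auto simp: singular_system_def)
          finally show "\<theta> * sqn ?m x \<le> (normG d P (real_comb ?m f x))\<^sup>2"
            by (simp add: normG_square G.sq_def sqn_def sum_distrib_left mult.commute)
          have "F.sq (real_comb ?m f x) = (\<Sum>i<?m. (cmod (of_real (x i)))\<^sup>2 * F.sq (f i))"
            using f fF xK by (intro F.sq_lin_comb_orthogonal) (auto simp: singular_system_def)
          then show "normF P (real_comb ?m f x) = sqrt (sqn ?m x)"
            by (simp add: normF_eq sqF sqn_def)
        qed
        then have "1 / r * \<theta> \<le> (e * sqrt r)\<^sup>2"
          using lower K P A n1 \<theta> e r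
          by (intro lower[rule_format, of K d P A \<theta> ?m f n]) (auto intro: less_imp_le)
        also have "\<dots> = e\<^sup>2 * r" using r by (simp add: power_mult_distrib)
        finally have "e\<^sup>2 * r\<^sup>2 \<le> e\<^sup>2 * r" using r by (simp add: \<theta>_def power3_eq_cube power2_eq_square)
        then have "r\<^sup>2 \<le> r" using e by simp
        then have False using r by (simp add: power2_eq_square)
        then show ?thesis ..
      next
        fix f k
        assume k: "k < M * n" "singular_system d P f k" "\<And>i. i < k \<Longrightarrow> G.sq (f i) > \<theta>"
          and small: "\<And>h. h \<in> spaceF P \<Longrightarrow> (\<forall>j<k. innerF P h (f j) = 0) \<Longrightarrow> G.sq h \<le> \<theta> * F.sq h"
        show ?thesis
        proof (cases "k = 0")
          case True
          have "\<theta> \<le> \<epsilon>\<^sup>2" using \<theta> r mult_right_mono[of 1 r \<theta>] by (simp add: \<theta>\<epsilon>[symmetric])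
          then have "min_ran_error TYPE('w) K d P Info_std 0 \<le> ennreal \<epsilon>"
            using small True \<epsilon> \<theta> by (intro initial_error_le[of \<theta>]) auto
          then show ?thesis using C by (intro exI[of _ 0]) simp
        next
          case False
          then have k1: "k \<ge> 1" by simp
          obtain t where t: "(1 - \<delta>1 / k) ^ t * k \<le> \<delta>1" "real (k + t) \<le> C * real n powr (1 + \<delta>)"
            using sampling_size_bound[OF \<delta>(1) \<delta>1 k1 less_imp_le[OF k(1)] n1] unfolding C_def by blast
          have "\<exists>B :: 'w ran_alg. randomized_algorithm K d P Info_std B \<and> ran_card P B \<le> of_nat (k + t) \<and>
             ran_error d P B \<le> ennreal (sqrt ((1 + (1 - \<delta>1 / k) ^ t * k + \<delta>1) * \<theta>))"
            using k(3) \<theta> by (intro singular_system_sampling[OF \<iota> d k1 k(2) _ _ small \<delta>1]) force+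
          then obtain B :: "'w ran_alg" where B: "randomized_algorithm K d P Info_std B"
            "ran_card P B \<le> of_nat (k + t)"
            "ran_error d P B \<le> ennreal (sqrt ((1 + (1 - \<delta>1 / k) ^ t * k + \<delta>1) * \<theta>))" by blast
          have "2 * \<delta>1 = r - 1" by (simp add: \<delta>1_def)
          then have "1 + (1 - \<delta>1 / k) ^ t * k + \<delta>1 \<le> r" using t(1) by linarith
          then have "(1 + (1 - \<delta>1 / k) ^ t * k + \<delta>1) * \<theta> \<le> r * \<theta>" using \<theta> by (intro mult_right_mono) auto
          then have "sqrt ((1 + (1 - \<delta>1 / k) ^ t * k + \<delta>1) * \<theta>) \<le> \<epsilon>"
            unfolding \<theta>\<epsilon> using \<epsilon> by (intro real_le_lsqrt) auto
          then have "ran_error d P B \<le> ennreal \<epsilon>" using B(3) by (meson ennreal_leI order_trans)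
          then have "min_ran_error TYPE('w) K d P Info_std (k + t) \<le> ennreal \<epsilon>"
            using B k1 unfolding min_ran_error_def by (auto intro!: INF_lower2)
          then show ?thesis using t(2) by blast
        qed
      qed
    qed
  qed
qed

section \<open>Tractability\<close>

lemma info_complexity_all_le_std:
  assumes "K = \<real> \<or> K = UNIV" "is_approx_problem K d (APP d)"
  shows "info_complexity W K APP Info_all \<epsilon> d \<le> info_complexity W K APP Info_std \<epsilon> d"
proof -
  interpret problem K d "APP d" by standard (use assms in auto)
  show ?thesis unfolding info_complexity_def
    by (intro INF_superset_mono) (auto intro: order_trans[OF min_ran_error_all_le_std])
qed

lemma info_complexity_attained:
  assumes "info_complexity W K APP \<Lambda> \<epsilon> d \<noteq> \<infinity>"
  obtains n where "info_complexity W K APP \<Lambda> \<epsilon> d = enat n" "min_ran_error W K d (APP d) \<Lambda> n \<le> ennreal \<epsilon>"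
proof -
  let ?S = "enat ` {n. min_ran_error W K d (APP d) \<Lambda> n \<le> ennreal \<epsilon>}"
  have "?S \<noteq> {}"
  proof
    assume "?S = {}"
    then have "info_complexity W K APP \<Lambda> \<epsilon> d = Inf {}" unfolding info_complexity_def by (simp only:)
    then show False using assms by (simp add: Inf_enat_def)
  qed
  then have "Inf ?S \<in> ?S" unfolding Inf_enat_def by (auto intro: LeastI)
  then show thesis using that unfolding info_complexity_def by auto
qed

lemma info_complexity_comparison:
  fixes \<delta> :: real
  assumes K: "K = \<real> \<or> K = UNIV" and P: "\<forall>d\<ge>1. is_approx_problem K d (APP d)"
    and rich: "\<exists>\<iota> :: (nat \<Rightarrow> real) \<Rightarrow> 'w. inj \<iota>" and \<delta>: "0 < \<delta>" "\<delta> \<le> 1"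
  obtains C where "C > 0" "\<And>\<epsilon> d x. \<lbrakk>d \<ge> 1; \<epsilon> > 0; x \<ge> 0;
      ereal_of_enat (info_complexity TYPE('w) K APP Info_all (\<epsilon> / (1 + \<delta>)) d) \<le> ereal x\<rbrakk>
    \<Longrightarrow> ereal_of_enat (info_complexity TYPE('w) K APP Info_std \<epsilon> d) \<le> ereal (C * x powr (1 + \<delta>))"
proof -
  obtain C where C: "C > 0" and cmp: "\<forall>K d P \<epsilon> n. (K = \<real> \<or> K = UNIV) \<longrightarrow> is_approx_problem K d P \<longrightarrow> d \<ge> 1 \<longrightarrow> \<epsilon> > 0 \<longrightarrow>
     min_ran_error TYPE('w) K d P Info_all n \<le> ennreal (\<epsilon> / (1 + \<delta>)) \<longrightarrow>
     (\<exists>N. real N \<le> C * real n powr (1 + \<delta>) \<and> min_ran_error TYPE('w) K d P Info_std N \<le> ennreal \<epsilon>)"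
    using standard_information_comparison[OF \<delta> rich] by auto
  show thesis
  proof (rule that[OF C])
    fix \<epsilon> x :: real and d :: nat
    assume d: "d \<ge> 1" and \<epsilon>: "\<epsilon> > 0" and x: "x \<ge> 0"
      and le: "ereal_of_enat (info_complexity TYPE('w) K APP Info_all (\<epsilon> / (1 + \<delta>)) d) \<le> ereal x"
    have "info_complexity TYPE('w) K APP Info_all (\<epsilon> / (1 + \<delta>)) d \<noteq> \<infinity>"
    proof
      assume "info_complexity TYPE('w) K APP Info_all (\<epsilon> / (1 + \<delta>)) d = \<infinity>"
      then show False using le by simp
    qed
    then obtain n where n: "info_complexity TYPE('w) K APP Info_all (\<epsilon> / (1 + \<delta>)) d = enat n"
      "min_ran_error TYPE('w) K d (APP d) Info_all n \<le> ennreal (\<epsilon> / (1 + \<delta>))"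
      by (rule info_complexity_attained)
    have nx: "real n \<le> x" using le n(1) by simp
    obtain N where N: "real N \<le> C * real n powr (1 + \<delta>)" "min_ran_error TYPE('w) K d (APP d) Info_std N \<le> ennreal \<epsilon>"
      using cmp K P d \<epsilon> n(2) by blast
    have "info_complexity TYPE('w) K APP Info_std \<epsilon> d \<le> enat N"
      unfolding info_complexity_def using N(2) by (intro INF_lower) simp
    then have "ereal_of_enat (info_complexity TYPE('w) K APP Info_std \<epsilon> d) \<le> ereal_of_enat (enat N)"
      by (simp only: ereal_of_enat_le_iff)
    also have "\<dots> \<le> ereal (C * x powr (1 + \<delta>))"
    proof -
      have "C * real n powr (1 + \<delta>) \<le> C * x powr (1 + \<delta>)"
        using nx C \<delta> by (intro mult_left_mono powr_mono2) auto
      then show ?thesis using N(1) by simp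
    qed
    finally show "ereal_of_enat (info_complexity TYPE('w) K APP Info_std \<epsilon> d) \<le> ereal (C * x powr (1 + \<delta>))" .
  qed
qed

lemma scaled_inverse_power:
  fixes \<epsilon> \<delta> p B :: real
  assumes "B \<ge> 0" "\<epsilon> > 0" "\<delta> > 0"
  shows "(B * (\<epsilon> / (1 + \<delta>)) powr (- p)) powr (1 + \<delta>)
     = (B * (1 + \<delta>) powr p) powr (1 + \<delta>) * \<epsilon> powr (- (p * (1 + \<delta>)))"
proof -
  have "(\<epsilon> / (1 + \<delta>)) powr (- p) = (1 + \<delta>) powr p * \<epsilon> powr (- p)"
    using assms by (simp add: powr_divide powr_minus field_simps)
  then have eq: "B * (\<epsilon> / (1 + \<delta>)) powr (- p) = (B * (1 + \<delta>) powr p) * \<epsilon> powr (- p)" by simp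
  show ?thesis unfolding eq using assms by (simp add: powr_mult powr_powr)
qed

text \<open>
  Exponents agree if one class of admissible exponents is contained in the other one and each exponent of
  the latter becomes admissible for the former after multiplication by factors tending to 1.
\<close>
lemma INF_eq_if_scalable:
  fixes S T :: "real set" and h :: "real \<Rightarrow> real"
  assumes "T \<subseteq> S" and "\<And>p \<delta>. p \<in> S \<Longrightarrow> 0 < \<delta> \<Longrightarrow> \<delta> \<le> 1 \<Longrightarrow> p * h \<delta> \<in> T"
    and h: "(h \<longlongrightarrow> 1) (at_right 0)"
  shows "(INF p\<in>S. ereal p) = (INF p\<in>T. ereal p)"
proof (rule antisym)
  show "(INF p\<in>S. ereal p) \<le> (INF p\<in>T. ereal p)" using assms(1) by (intro INF_superset_mono) auto
  show "(INF p\<in>T. ereal p) \<le> (INF p\<in>S. ereal p)"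
  proof (rule INF_greatest)
    fix p assume p: "p \<in> S"
    have "((\<lambda>\<delta>. p * h \<delta>) \<longlongrightarrow> p * 1) (at_right 0)" by (intro tendsto_mult_left h)
    then have "((\<lambda>\<delta>. ereal (p * h \<delta>)) \<longlongrightarrow> ereal p) (at_right 0)" by simp
    moreover have "eventually (\<lambda>\<delta>. (INF p\<in>T. ereal p) \<le> ereal (p * h \<delta>)) (at_right (0 :: real))"
      unfolding eventually_at_right_field
      by (intro exI[of _ 1] conjI allI impI INF_lower assms(2)[OF p]) auto
    ultimately show "(INF p\<in>T. ereal p) \<le> ereal p"
      by (intro tendsto_lowerbound) auto
  qed
qed

text \<open>
  The defining limit of weak tractability in terms of real bounds.
\<close>
definition scaled_limit_zero :: "(real \<Rightarrow> nat \<Rightarrow> enat) \<Rightarrow> bool" where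
  "scaled_limit_zero N \<longleftrightarrow> (\<forall>\<eta>>0. \<exists>R. \<forall>\<epsilon>\<in>{0<..<1}. \<forall>d\<ge>1. 1 / \<epsilon> + real d \<ge> R \<longrightarrow>
     ln_enat (N \<epsilon> d) \<le> ereal (\<eta> * (1 / \<epsilon> + real d)))"

lemma ln_enat_nonneg: "ln_enat N \<ge> 0"
  by (cases N) (auto simp: ln_enat_def zero_ereal_def)

lemma ALG_WT_iff: "ALG_WT W K APP \<Lambda> \<longleftrightarrow> scaled_limit_zero (info_complexity W K APP \<Lambda>)"
proof -
  define F where "F = inf (filtercomap (\<lambda>(\<epsilon>, d). 1 / \<epsilon> + real d) at_top) (principal ({0<..<(1 :: real)} \<times> {1 :: nat..}))"
  define q where "q = (\<lambda>(\<epsilon>, d). ln_enat (info_complexity W K APP \<Lambda> \<epsilon> d) / ereal (1 / \<epsilon> + real d))"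
  have ev: "eventually Q F \<longleftrightarrow> (\<exists>R. \<forall>\<epsilon>\<in>{0<..<1}. \<forall>d\<ge>1. 1 / \<epsilon> + real d \<ge> R \<longrightarrow> Q (\<epsilon>, d))" for Q
    unfolding F_def eventually_inf_principal eventually_filtercomap eventually_at_top_linorder
  proof safe
    fix Q' :: "real \<Rightarrow> bool" and R
    assume "\<forall>x\<ge>R. Q' x" "\<forall>x. Q' (case x of (\<epsilon>, d) \<Rightarrow> 1 / \<epsilon> + real d) \<longrightarrow> x \<in> {0<..<1} \<times> {1..} \<longrightarrow> Q x"
    then show "\<exists>R. \<forall>\<epsilon>\<in>{0<..<1}. \<forall>d\<ge>1. R \<le> 1 / \<epsilon> + real d \<longrightarrow> Q (\<epsilon>, d)"
      by (intro exI[of _ R]) auto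
  next
    fix R assume "\<forall>\<epsilon>\<in>{0<..<1}. \<forall>d\<ge>1. R \<le> 1 / \<epsilon> + real d \<longrightarrow> Q (\<epsilon>, d)"
    then show "\<exists>Q'. (\<exists>N. \<forall>n\<ge>N. Q' n) \<and>
        (\<forall>x. Q' (case x of (\<epsilon>, d) \<Rightarrow> 1 / \<epsilon> + real d) \<longrightarrow> x \<in> {0<..<1} \<times> {1..} \<longrightarrow> Q x)"
      by (intro exI[of _ "\<lambda>s. s \<ge> R"]) auto
  qed
  have div: "q (\<epsilon>, d) \<le> ereal \<eta> \<longleftrightarrow> ln_enat (info_complexity W K APP \<Lambda> \<epsilon> d) \<le> ereal (\<eta> * (1 / \<epsilon> + real d))"
    if "\<epsilon> \<in> {0<..<1}" for \<epsilon> d \<eta>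
  proof -
    have "0 < 1 / \<epsilon> + real d" using that by (simp add: add_pos_nonneg)
    then show ?thesis unfolding q_def by (simp add: ereal_divide_le_pos mult.commute)
  qed
  have q0: "q (\<epsilon>, d) \<ge> 0" if "\<epsilon> \<in> {0<..<1}" for \<epsilon> d
    using that ln_enat_nonneg by (auto simp: q_def intro!: zero_le_divide_ereal)
  have "(q \<longlongrightarrow> 0) F \<longleftrightarrow> (\<forall>\<eta>>0. eventually (\<lambda>x. q x \<le> ereal \<eta>) F)"
  proof
    assume lim: "(q \<longlongrightarrow> 0) F"
    show "\<forall>\<eta>>0. eventually (\<lambda>x. q x \<le> ereal \<eta>) F"
    proof (intro allI impI)
      fix \<eta> :: real assume "\<eta> > 0"
      then have "eventually (\<lambda>x. q x < ereal \<eta>) F" using order_tendstoD(2)[OF lim, of "ereal \<eta>"] by simp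
      then show "eventually (\<lambda>x. q x \<le> ereal \<eta>) F" by (rule eventually_mono) simp
    qed
  next
    assume b: "\<forall>\<eta>>0. eventually (\<lambda>x. q x \<le> ereal \<eta>) F"
    show "(q \<longlongrightarrow> 0) F"
    proof (rule order_tendstoI)
      fix a :: ereal assume "a < 0"
      then show "eventually (\<lambda>x. a < q x) F"
        unfolding ev using less_le_trans[OF _ q0] by (intro exI[of _ 0] ballI allI impI) blast
    next
      fix a :: ereal assume "0 < a"
      then obtain \<eta> where "0 < ereal \<eta>" "ereal \<eta> < a" using ereal_dense2 by blast
      then show "eventually (\<lambda>x. q x < a) F"
        using b by (auto elim!: eventually_mono intro: le_less_trans)
    qed
  qed
  also have "\<dots> \<longleftrightarrow> scaled_limit_zero (info_complexity W K APP \<Lambda>)"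
    unfolding ev scaled_limit_zero_def using div by (intro all_cong ex_cong ball_cong refl) auto
  finally show ?thesis unfolding ALG_WT_def F_def q_def .
qed

theorem theorem2p5:
  fixes K :: "complex set" and APP :: "nat \<Rightarrow> approx_problem"
  assumes scalars: "K = \<real> \<or> K = UNIV"
    and problem: "\<forall>d\<ge>1. is_approx_problem K d (APP d)"
    and rich: "\<exists>\<iota> :: (nat \<Rightarrow> real) \<Rightarrow> 'w. inj \<iota>"
  shows "(ALG_SPT TYPE('w) K APP Info_all \<longleftrightarrow> ALG_SPT TYPE('w) K APP Info_std) \<and>
         (ALG_PT TYPE('w) K APP Info_all \<longleftrightarrow> ALG_PT TYPE('w) K APP Info_std) \<and>
         (ALG_QPT TYPE('w) K APP Info_all \<longleftrightarrow> ALG_QPT TYPE('w) K APP Info_std) \<and>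
         (ALG_WT TYPE('w) K APP Info_all \<longleftrightarrow> ALG_WT TYPE('w) K APP Info_std) \<and>
         ALG_SPT_exponent TYPE('w) K APP Info_all = ALG_SPT_exponent TYPE('w) K APP Info_std \<and>
         ALG_QPT_exponent TYPE('w) K APP Info_all = ALG_QPT_exponent TYPE('w) K APP Info_std"
proof -
  define Na where "Na = info_complexity TYPE('w) K APP Info_all"
  define Ns where "Ns = info_complexity TYPE('w) K APP Info_std"
  have mono: "Na \<epsilon> d \<le> Ns \<epsilon> d" if "d \<ge> 1" for \<epsilon> d
    unfolding Na_def Ns_def using scalars problem that by (intro info_complexity_all_le_std) auto
  have mono_real: "ereal_of_enat (Na \<epsilon> d) \<le> b" if "d \<ge> 1" "ereal_of_enat (Ns \<epsilon> d) \<le> b" for \<epsilon> d b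
    using mono[OF that(1), of \<epsilon>] that(2) by (meson ereal_of_enat_le_iff order_trans)
  have SPT_mono: "SPT_with TYPE('w) K APP Info_all p" if "SPT_with TYPE('w) K APP Info_std p" for p
    using that mono_real unfolding SPT_with_def Na_def Ns_def by meson
  have QPT_mono: "QPT_with TYPE('w) K APP Info_all p" if "QPT_with TYPE('w) K APP Info_std p" for p
    using that mono_real unfolding QPT_with_def Na_def Ns_def by meson
  have PT_mono: "ALG_PT TYPE('w) K APP Info_all" if "ALG_PT TYPE('w) K APP Info_std"
    using that mono_real unfolding ALG_PT_def Na_def Ns_def by meson
  have SPT: "SPT_with TYPE('w) K APP Info_std (p * (1 + \<delta>))"
    if p: "SPT_with TYPE('w) K APP Info_all p" and \<delta>: "0 < \<delta>" "\<delta> \<le> 1" for p \<delta>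
  proof -
    obtain C where C: "C > 0" and cmp: "\<And>\<epsilon> d x. \<lbrakk>d \<ge> 1; \<epsilon> > 0; x \<ge> 0; ereal_of_enat (Na (\<epsilon> / (1 + \<delta>)) d) \<le> ereal x\<rbrakk>
      \<Longrightarrow> ereal_of_enat (Ns \<epsilon> d) \<le> ereal (C * x powr (1 + \<delta>))"
      using info_complexity_comparison[OF scalars problem rich \<delta>] unfolding Na_def Ns_def by metis
    obtain B where p0: "p \<ge> 0" and B: "B > 0" "\<And>d \<epsilon>. d \<ge> 1 \<Longrightarrow> \<epsilon> \<in> {0<..<1} \<Longrightarrow> ereal_of_enat (Na \<epsilon> d) \<le> ereal (B * \<epsilon> powr (- p))"
      using p unfolding SPT_with_def Na_def by auto
    have "ereal_of_enat (Ns \<epsilon> d) \<le> ereal (C * (B * (1 + \<delta>) powr p) powr (1 + \<delta>) * \<epsilon> powr (- (p * (1 + \<delta>))))"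
      if d: "d \<ge> 1" and \<epsilon>: "\<epsilon> \<in> {0<..<1}" for \<epsilon> d
    proof -
      have "\<epsilon> / (1 + \<delta>) \<in> {0<..<1}" using \<epsilon> \<delta> by (auto simp: field_simps)
      from cmp[OF d _ _ B(2)[OF d this]] show ?thesis
        using \<epsilon> B(1) \<delta> by (simp add: scaled_inverse_power mult.assoc)
    qed
    then show ?thesis using p0 \<delta> B(1) C unfolding SPT_with_def Ns_def
      by (intro conjI exI[of _ "C * (B * (1 + \<delta>) powr p) powr (1 + \<delta>)"]) auto
  qed
  \<comment> \<open>Without exponents to compare, \<open>\<delta> = 1\<close> is small enough here and for weak tractability.\<close>
  have PT: "ALG_PT TYPE('w) K APP Info_std" if PT: "ALG_PT TYPE('w) K APP Info_all"
  proof -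
    obtain C where C: "C > 0" and cmp: "\<And>\<epsilon> d x. \<lbrakk>d \<ge> 1; \<epsilon> > 0; x \<ge> 0; ereal_of_enat (Na (\<epsilon> / (1 + 1)) d) \<le> ereal x\<rbrakk>
      \<Longrightarrow> ereal_of_enat (Ns \<epsilon> d) \<le> ereal (C * x powr (1 + 1))"
      using info_complexity_comparison[OF scalars problem rich, of 1] unfolding Na_def Ns_def by (metis order_refl zero_less_one)
    obtain B p q where pq: "p \<ge> 0" "q \<ge> 0" and B: "B > 0"
      "\<And>d \<epsilon>. d \<ge> 1 \<Longrightarrow> \<epsilon> \<in> {0<..<1} \<Longrightarrow> ereal_of_enat (Na \<epsilon> d) \<le> ereal (B * real d powr q * \<epsilon> powr (- p))"
      using PT unfolding ALG_PT_def Na_def by auto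
    have "ereal_of_enat (Ns \<epsilon> d) \<le> ereal (C * (B * 2 powr p) powr 2 * real d powr (q * 2) * \<epsilon> powr (- (p * 2)))"
      if d: "d \<ge> 1" and \<epsilon>: "\<epsilon> \<in> {0<..<1}" for \<epsilon> d
    proof -
      have "\<epsilon> / (1 + 1) \<in> {0<..<1}" using \<epsilon> by auto
      from cmp[OF d _ _ B(2)[OF d this]]
      have "ereal_of_enat (Ns \<epsilon> d) \<le> ereal (C * ((B * real d powr q) * (\<epsilon> / (1 + 1)) powr (- p)) powr (1 + 1))"
        using \<epsilon> B(1) by simp
      also have "((B * real d powr q) * (\<epsilon> / (1 + 1)) powr (- p)) powr (1 + 1)
         = (B * real d powr q * (1 + 1) powr p) powr (1 + 1) * \<epsilon> powr (- (p * (1 + 1)))"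
        using \<epsilon> B(1) by (intro scaled_inverse_power) auto
      also have "(B * real d powr q * (1 + 1) powr p) powr (1 + 1) = (B * 2 powr p) powr 2 * real d powr (q * 2)"
        using B(1) by (simp add: powr_mult powr_powr)
      finally show ?thesis by (simp add: mult.assoc)
    qed
    then show ?thesis using pq B(1) C unfolding ALG_PT_def Ns_def
      by (intro exI[of _ "C * (B * 2 powr p) powr 2"] exI[of _ "p * 2"] exI[of _ "q * 2"] conjI) auto
  qed
  have QPT: "QPT_with TYPE('w) K APP Info_std (t * ((1 + \<delta>) * (1 + ln (1 + \<delta>))))"
    if t: "QPT_with TYPE('w) K APP Info_all t" and \<delta>: "0 < \<delta>" "\<delta> \<le> 1" for t \<delta>
  proof -
    obtain C where C: "C > 0" and cmp: "\<And>\<epsilon> d x. \<lbrakk>d \<ge> 1; \<epsilon> > 0; x \<ge> 0; ereal_of_enat (Na (\<epsilon> / (1 + \<delta>)) d) \<le> ereal x\<rbrakk>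
      \<Longrightarrow> ereal_of_enat (Ns \<epsilon> d) \<le> ereal (C * x powr (1 + \<delta>))"
      using info_complexity_comparison[OF scalars problem rich \<delta>] unfolding Na_def Ns_def by metis
    obtain B where t0: "t \<ge> 0" and B: "B > 0" "\<And>d \<epsilon>. d \<ge> 1 \<Longrightarrow> \<epsilon> \<in> {0<..<1} \<Longrightarrow>
        ereal_of_enat (Na \<epsilon> d) \<le> ereal (B * exp (t * (1 + ln (real d)) * (1 + ln (1 / \<epsilon>))))"
      using t unfolding QPT_with_def Na_def by auto
    let ?t = "t * ((1 + \<delta>) * (1 + ln (1 + \<delta>)))"
    have l0: "ln (1 + \<delta>) \<ge> 0" using \<delta> by simp
    have "ereal_of_enat (Ns \<epsilon> d) \<le> ereal (C * B powr (1 + \<delta>) * exp (?t * (1 + ln (real d)) * (1 + ln (1 / \<epsilon>))))"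
      if d: "d \<ge> 1" and \<epsilon>: "\<epsilon> \<in> {0<..<1}" for \<epsilon> d
    proof -
      let ?a = "1 + ln (real d)" and ?b = "1 + ln (1 / \<epsilon>)"
      have a: "?a \<ge> 0" using d by simp
      have b: "?b \<ge> 1" using \<epsilon> by simp
      have "\<epsilon> / (1 + \<delta>) \<in> {0<..<1}" using \<epsilon> \<delta> by (auto simp: field_simps)
      from cmp[OF d _ _ B(2)[OF d this]]
      have "ereal_of_enat (Ns \<epsilon> d) \<le> ereal (C * (B * exp (t * ?a * (1 + ln (1 / (\<epsilon> / (1 + \<delta>)))))) powr (1 + \<delta>))"
        using \<epsilon> B(1) by simp
      also have "(B * exp (t * ?a * (1 + ln (1 / (\<epsilon> / (1 + \<delta>)))))) powr (1 + \<delta>)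
         = B powr (1 + \<delta>) * exp (t * ?a * (1 + ln (1 / (\<epsilon> / (1 + \<delta>)))) * (1 + \<delta>))"
        using B(1) by (simp add: powr_mult exp_powr_real)
      also have "1 + ln (1 / (\<epsilon> / (1 + \<delta>))) = ?b + ln (1 + \<delta>)"
        using \<epsilon> \<delta> by (simp add: ln_div)
      also have "ereal (C * (B powr (1 + \<delta>) * exp (t * ?a * (?b + ln (1 + \<delta>)) * (1 + \<delta>))))
         \<le> ereal (C * B powr (1 + \<delta>) * exp (?t * ?a * ?b))"
      proof -
        \<comment> \<open>The loss in \<open>\<epsilon>\<close> adds a constant to a quantity that is at least 1: a factor close to 1.\<close>
        have "?b + ln (1 + \<delta>) \<le> ?b * (1 + ln (1 + \<delta>))"
          using mult_right_mono[OF b l0] by (simp add: algebra_simps)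
        then have "(t * ?a * (1 + \<delta>)) * (?b + ln (1 + \<delta>)) \<le> (t * ?a * (1 + \<delta>)) * (?b * (1 + ln (1 + \<delta>)))"
          using t0 a \<delta> by (intro mult_left_mono) auto
        then have "t * ?a * (?b + ln (1 + \<delta>)) * (1 + \<delta>) \<le> ?t * ?a * ?b"
          by (simp add: ac_simps)
        then show ?thesis using C B(1) by (simp add: mult.assoc)
      qed
      finally show ?thesis .
    qed
    then show ?thesis using t0 \<delta> l0 B(1) C unfolding QPT_with_def Ns_def
      by (intro conjI exI[of _ "C * B powr (1 + \<delta>)"]) auto
  qed
  have WT: "scaled_limit_zero Na \<longleftrightarrow> scaled_limit_zero Ns"
  proof
    have le: "ln_enat (Na \<epsilon> d) \<le> ln_enat (Ns \<epsilon> d)" if "d \<ge> 1" for \<epsilon> d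
    proof (cases "Na \<epsilon> d" "Ns \<epsilon> d" rule: enat2_cases)
    qed (use mono[OF that, of \<epsilon>] in \<open>auto simp: ln_enat_def\<close>)
    show "scaled_limit_zero Ns \<Longrightarrow> scaled_limit_zero Na"
      unfolding scaled_limit_zero_def using le by (meson order_trans)
  next
    assume lim: "scaled_limit_zero Na"
    obtain C where C: "C > 0" and cmp: "\<And>\<epsilon> d x. \<lbrakk>d \<ge> 1; \<epsilon> > 0; x \<ge> 0; ereal_of_enat (Na (\<epsilon> / (1 + 1)) d) \<le> ereal x\<rbrakk>
      \<Longrightarrow> ereal_of_enat (Ns \<epsilon> d) \<le> ereal (C * x powr (1 + 1))"
      using info_complexity_comparison[OF scalars problem rich, of 1] unfolding Na_def Ns_def by (metis order_refl zero_less_one)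
    show "scaled_limit_zero Ns"
      unfolding scaled_limit_zero_def
    proof (intro allI impI)
      fix \<eta> :: real assume \<eta>: "\<eta> > 0"
      \<comment> \<open>Halving \<open>\<epsilon>\<close> at most doubles \<open>1 / \<epsilon> + d\<close>, and squaring the complexity doubles its logarithm;
        half of the allowed bound remains for \<open>ln C\<close>.\<close>
      then obtain R where R: "\<And>\<epsilon> d. \<epsilon> \<in> {0<..<1} \<Longrightarrow> d \<ge> 1 \<Longrightarrow> 1 / \<epsilon> + real d \<ge> R \<Longrightarrow>
         ln_enat (Na \<epsilon> d) \<le> ereal (\<eta> / 8 * (1 / \<epsilon> + real d))"
        using lim unfolding scaled_limit_zero_def by (metis divide_pos_pos zero_less_numeral)
      define R' where "R' = max R (2 * \<bar>ln C\<bar> / \<eta>)"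
      have "ln_enat (Ns \<epsilon> d) \<le> ereal (\<eta> * (1 / \<epsilon> + real d))"
        if \<epsilon>: "\<epsilon> \<in> {0<..<1}" and d: "d \<ge> 1" and big: "1 / \<epsilon> + real d \<ge> R'" for \<epsilon> d
      proof -
        define s where "s = 1 / \<epsilon> + real d"
        have s: "s > 0" "s \<ge> R" "2 * \<bar>ln C\<bar> / \<eta> \<le> s" using \<epsilon> big by (auto simp: s_def R'_def add_pos_nonneg)
        have half: "\<epsilon> / (1 + 1) \<in> {0<..<1}" using \<epsilon> by auto
        have s2: "s \<le> 1 / (\<epsilon> / (1 + 1)) + real d" "1 / (\<epsilon> / (1 + 1)) + real d \<le> 2 * s"
          using \<epsilon> by (auto simp: s_def field_simps)
        have Nl: "ln_enat (Na (\<epsilon> / (1 + 1)) d) \<le> ereal (\<eta> / 4 * s)"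
        proof -
          have "ln_enat (Na (\<epsilon> / (1 + 1)) d) \<le> ereal (\<eta> / 8 * (1 / (\<epsilon> / (1 + 1)) + real d))"
            using s s2 by (intro R half d) linarith
          also have "\<dots> \<le> ereal (\<eta> / 8 * (2 * s))"
            using s2(2) \<eta> unfolding ereal_less_eq(3) by (intro mult_left_mono) auto
          finally show ?thesis by simp
        qed
        then obtain n where n: "Na (\<epsilon> / (1 + 1)) d = enat n" by (auto simp: ln_enat_def split: enat.splits)
        have "ereal_of_enat (Ns \<epsilon> d) \<le> ereal (C * real n powr (1 + 1))"
          using \<epsilon> n by (intro cmp d) auto
        then obtain N where N: "Ns \<epsilon> d = enat N" "real N \<le> C * real n powr 2"
          by (cases "Ns \<epsilon> d") auto
        show ?thesis
        proof (cases "N = 0")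
          case True
          then show ?thesis using N(1) \<eta> s(1) by (simp add: ln_enat_def s_def[symmetric])
        next
          case False
          then have n0: "n > 0" using N(2) by (cases "n = 0") auto
          have "ln (real N) \<le> ln (C * real n powr 2)" using N(2) False by (intro ln_mono) auto
          also have "\<dots> = ln C + 2 * ln (real n)" using C n0 by (simp add: ln_mult ln_realpow)
          also have "\<dots> \<le> \<eta> / 2 * s + 2 * (\<eta> / 4 * s)"
          proof (intro add_mono mult_left_mono)
            show "ln C \<le> \<eta> / 2 * s" using s(3) \<eta> by (simp add: field_simps)
            show "ln (real n) \<le> \<eta> / 4 * s" using Nl n n0 by (simp add: ln_enat_def)
          qed simp
          finally show ?thesis using N(1) False by (simp add: ln_enat_def s_def[symmetric])
        qed
      qed
      then show "\<exists>R. \<forall>\<epsilon>\<in>{0<..<1}. \<forall>d\<ge>1. 1 / \<epsilon> + real d \<ge> R \<longrightarrow> ln_enat (Ns \<epsilon> d) \<le> ereal (\<eta> * (1 / \<epsilon> + real d))"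
        by blast
    qed
  qed
  have lim1: "((\<lambda>\<delta> :: real. 1 + \<delta>) \<longlongrightarrow> 1) (at_right 0)"
    by (rule tendsto_eq_intros | simp)+
  have lim2: "((\<lambda>\<delta> :: real. (1 + \<delta>) * (1 + ln (1 + \<delta>))) \<longlongrightarrow> 1) (at_right 0)"
    by (rule tendsto_eq_intros | simp)+
  show ?thesis
  proof (intro conjI)
    show "ALG_SPT TYPE('w) K APP Info_all \<longleftrightarrow> ALG_SPT TYPE('w) K APP Info_std"
      unfolding ALG_SPT_def using SPT[OF _ zero_less_one order_refl] SPT_mono by blast
    show "ALG_PT TYPE('w) K APP Info_all \<longleftrightarrow> ALG_PT TYPE('w) K APP Info_std"
      using PT PT_mono by blast
    show "ALG_QPT TYPE('w) K APP Info_all \<longleftrightarrow> ALG_QPT TYPE('w) K APP Info_std"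
      unfolding ALG_QPT_def using QPT[OF _ zero_less_one order_refl] QPT_mono by blast
    show "ALG_WT TYPE('w) K APP Info_all \<longleftrightarrow> ALG_WT TYPE('w) K APP Info_std"
      unfolding ALG_WT_iff using WT by (simp add: Na_def Ns_def)
    show "ALG_SPT_exponent TYPE('w) K APP Info_all = ALG_SPT_exponent TYPE('w) K APP Info_std"
      unfolding ALG_SPT_exponent_def
      by (rule INF_eq_if_scalable[OF _ _ lim1]) (use SPT SPT_mono in auto)
    show "ALG_QPT_exponent TYPE('w) K APP Info_all = ALG_QPT_exponent TYPE('w) K APP Info_std"
      unfolding ALG_QPT_exponent_def
      by (rule INF_eq_if_scalable[OF _ _ lim2]) (use QPT QPT_mono in auto)
  qed
qed

end
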